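(* Let $X$ be a finite set with $|X|\ge 2$ and let $G$ be a countable group acting self-similarly on $X^\omega$. Assume $\mu\big((X^\omega)_{G\text{-gen}}\big)=1$. Then the linear functional $\psi$ given by $$\psi(S_{u_1}gS_{u_2}^* )=\delta_{u_1,u_2}\,|X|^{-|u_1|}\,\mu\big((X^\omega)_g\big)\qquad (g\in G,\ u_1,u_2\in X^* )$$ on the $*$-algebra generated by $\{S_x\}_{x\in X}$ and $G$ extends to a KMS state $\psi_{\min}\in K_{\log|X|}(\mathcal O_{G_{\min}})$, and $\psi_{\min}$ is the unique element of $K_{\log |X|}(\mathcal O_{G_{\min}})$.
   Context: $X^*=\bigcup_{n\ge 0}X^n$ is the set of finite words (including the empty word), $|u|$ is the length of $u\in X^*$, and $X^\omega\cong X^{\mathbb N}$ is the set of unilateral infinite words over $X$ with the product topology. A faithful action of a group $G$ on $X^\omega$ is self-similar if for every $g\in G$, $x\in X$ there exist $h\in G$, $v\in X$ with $g(xw)=v\,h(w)$ for all $w\in X^\omega$. Then for all $n$, $g\in G$, $u\in X^n$ there are unique $h(g,u)\in G$ and $v(g,u)\in X^n$ with $g(uw)=v(g,u)\,h(g,u)(w)$ for all $w\in X^\omega$. $\mu$ is the Bernoulli measure on $X^\omega$ (product of the uniform probability measures on $X$). $(X^\omega)_g$ is the set of fixed points of $g$. A point $w$ is $g$-generic if $g(w)\ne w$ or some neighborhood of $w$ consists of fixed points of $g$; $(X^\omega)_{G\text{-gen}}$ is the set of points that are $g$-generic for all $g\in G$. For $u\in X^*$ let $T_u:X^\omega\to X^\omega$,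 $w\mapsto uw$, let $T_u^*$ be its inverse defined on $uX^\omega=\{uw: w\in X^\omega\}$, and let $\langle G,X\rangle=\{T_{u_1}gT_{u_2}^*: u_1,u_2\in X^*,\ g\in G\}$ (partially defined maps). A point $w$ is strictly $G$-generic if for every $f\in\langle G,X\rangle$, either $f$ is not defined at $w$, or $f(w)\neq w$, or $f$ fixes every point of a neighborhood of $w$. Strictly $G$-generic points exist. $\mathcal O_{G_{\max}}$ is the universal C$^*$-algebra generated by $G$ (all relations of $G$ being preserved) and $\{S_x\}_{x\in X}$ subject to $g^*g=gg^*=1$, $S_x^*S_y=\delta_{x,y}$, $\sum_{x\in X}S_xS_x^*=1$, $gS_x=S_{v(g,x)}h(g,x)$ for $x,y\in X$, $g\in G$. For $u=x_1\cdots x_n$, $S_u=S_{x_1}\cdots S_{x_n}$. For a strictly $G$-generic $w$ let $\langle G,X\rangle(w)=\{f(w): f\in\langle G,X\rangle \text{ defined at } w\}$, and let $\pi_w$ be the representation of $\mathcal O_{G_{\max}}$ on $\ell^2(\langle G,X\rangle(w))$ with $S_x\delta_{w_1}=\delta_{xw_1}$, $g\delta_{w_1}=\delta_{g(w_1)}$. The C$^*$-algebra $\mathcal O_{G_{\min}}:=\pi_w(\mathcal O_{G_{\max}})$ does not depend (up to canonical isomorphism) on the choice of $w$; the images of $S_x$ and $g$ in it are denoted by the same symbols. The canonical gauge action $\Gamma$ of $\mathbb R$ on $\mathcal O_{G_{\min}}$ is given by $\Gamma_t(g)=g$, $\Gamma_t(S_x)=e^{it}S_x$. $K_\beta(\mathcal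 O_{G_{\min}})$ is the set of KMS states on $\mathcal O_{G_{\min}}$ for $\Gamma$ with inverse temperature $\beta>0$, i.e. states $\varphi$ with $\varphi(a\,\Gamma_{i\beta}(b))=\varphi(ba)$ for all $\Gamma$-analytic $a,b$ (in particular $\varphi(S_{u_1}gS_{u_2}^* )=e^{-\beta|u_1|}\varphi(gS_{u_2}^*S_{u_1})$). *)

theory Defs
  imports
    "HOL-Probability.Probability"
    "HOL-Algebra.Group_Action"
    "HOL-Library.Omega_Words_Fun"
begin

section \<open>The Hilbert space of square-summable families\<close>

typedef 'a ell2 = "{x :: 'a \<Rightarrow> complex. (\<lambda>a. (cmod (x a))\<^sup>2) summable_on UNIV}"
  by (rule exI[of _ "\<lambda>_. 0"]) simp

setup_lifting type_definition_ell2

lemma sq_summable_add: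
  fixes x y :: "'a \<Rightarrow> complex"
  assumes "(\<lambda>a. (cmod (x a))\<^sup>2) summable_on A" "(\<lambda>a. (cmod (y a))\<^sup>2) summable_on A"
  shows "(\<lambda>a. (cmod (x a + y a))\<^sup>2) summable_on A"
proof (rule summable_on_comparison_test)
  show "(\<lambda>a. 2 * (cmod (x a))\<^sup>2 + 2 * (cmod (y a))\<^sup>2) summable_on A"
    by (intro summable_on_add summable_on_cmult_right assms)
  fix a
  have "(cmod (x a + y a))\<^sup>2 \<le> (cmod (x a) + cmod (y a))\<^sup>2"
    by (intro power_mono norm_triangle_ineq) auto
  also have "\<dots> \<le> 2 * (cmod (x a))\<^sup>2 + 2 * (cmod (y a))\<^sup>2"
    using sum_squares_bound[of "cmod (x a)" "cmod (y a)"] by (simp add: power2_sum)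
  finally show "(cmod (x a + y a))\<^sup>2 \<le> 2 * (cmod (x a))\<^sup>2 + 2 * (cmod (y a))\<^sup>2" .
qed simp

lemma sq_summable_scale:
  fixes x :: "'a \<Rightarrow> complex"
  assumes "(\<lambda>a. (cmod (x a))\<^sup>2) summable_on A"
  shows "(\<lambda>a. (cmod (c * x a))\<^sup>2) summable_on A"
  using summable_on_cmult_right[OF assms, of "(cmod c)\<^sup>2"]
  by (simp add: norm_mult power_mult_distrib)

lemma sq_summable_mult:
  fixes x y :: "'a \<Rightarrow> complex"
  assumes "(\<lambda>a. (cmod (x a))\<^sup>2) summable_on A" "(\<lambda>a. (cmod (y a))\<^sup>2) summable_on A"
  shows "(\<lambda>a. norm (x a * y a)) summable_on A"
proof (rule summable_on_comparison_test)
  show "(\<lambda>a. (cmod (x a))\<^sup>2 + (cmod (y a))\<^sup>2) summable_on A"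
    by (intro summable_on_add assms)
  fix a
  show "norm (x a * y a) \<le> (cmod (x a))\<^sup>2 + (cmod (y a))\<^sup>2"
    unfolding norm_mult
    using sum_squares_bound[of "cmod (x a)" "cmod (y a)"]
      mult_nonneg_nonneg[OF norm_ge_zero[of "x a"] norm_ge_zero[of "y a"]]
    by linarith
qed simp

lift_definition cscale :: "complex \<Rightarrow> 'a ell2 \<Rightarrow> 'a ell2" (infixr \<open>*\<^sub>\<complex>\<close> 75)
  is "\<lambda>c x a. c * x a"
  by (rule sq_summable_scale)

lift_definition ell2_basis :: "'a \<Rightarrow> 'a ell2" (\<open>\<delta>\<close>)
  is "\<lambda>v a. if a = v then 1 else 0"
proof -
  fix v :: 'a
  have "(\<lambda>a. (cmod (if a = v then 1 else 0))\<^sup>2) summable_on {v}" by simp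
  then show "(\<lambda>a. (cmod (if a = v then 1 else 0))\<^sup>2) summable_on UNIV"
    by (rule summable_on_cong_neutral[THEN iffD1, rotated -1]) auto
qed

lift_definition cinner :: "'a ell2 \<Rightarrow> 'a ell2 \<Rightarrow> complex"
  is "\<lambda>x y. \<Sum>\<^sub>\<infinity>a. cnj (x a) * y a" .

instantiation ell2 :: (type) real_inner
begin

lift_definition zero_ell2 :: "'a ell2" is "\<lambda>_. 0" by simp
lift_definition plus_ell2 :: "'a ell2 \<Rightarrow> 'a ell2 \<Rightarrow> 'a ell2" is "\<lambda>x y a. x a + y a"
  by (rule sq_summable_add)
lift_definition uminus_ell2 :: "'a ell2 \<Rightarrow> 'a ell2" is "\<lambda>x a. - x a" by simp
lift_definition minus_ell2 :: "'a ell2 \<Rightarrow> 'a ell2 \<Rightarrow> 'a ell2" is "\<lambda>x y a. x a - y a"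
  using sq_summable_add[of _ UNIV "\<lambda>a. - _ a"] by simp
lift_definition scaleR_ell2 :: "real \<Rightarrow> 'a ell2 \<Rightarrow> 'a ell2" is "\<lambda>c x a. of_real c * x a"
  by (rule sq_summable_scale)
lift_definition inner_ell2 :: "'a ell2 \<Rightarrow> 'a ell2 \<Rightarrow> real" is "\<lambda>x y. \<Sum>\<^sub>\<infinity>a. Re (cnj (x a) * y a)" .

definition norm_ell2 :: "'a ell2 \<Rightarrow> real" where "norm_ell2 x = sqrt (inner x x)"
definition dist_ell2 :: "'a ell2 \<Rightarrow> 'a ell2 \<Rightarrow> real" where "dist_ell2 x y = norm (x - y)"
definition sgn_ell2 :: "'a ell2 \<Rightarrow> 'a ell2" where "sgn_ell2 x = inverse (norm x) *\<^sub>R x"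
definition uniformity_ell2 :: "('a ell2 \<times> 'a ell2) filter"
  where "uniformity_ell2 = (INF e\<in>{0<..}. principal {(x, y). dist x y < e})"
definition open_ell2 :: "'a ell2 set \<Rightarrow> bool"
  where "open_ell2 U = (\<forall>x\<in>U. \<forall>\<^sub>F (x', y) in uniformity. x' = x \<longrightarrow> y \<in> U)"

instance
proof
  fix x y z :: "'a ell2" and r s :: real and U :: "'a ell2 set"
  show "x + y + z = x + (y + z)" by transfer (simp add: add.assoc)
  show "x + y = y + x" by transfer (simp add: add.commute)
  show "0 + x = x" by transfer simp
  show "- x + x = 0" by transfer simp
  show "x - y = x + - y" by transfer simp
  show "r *\<^sub>R (x + y) = r *\<^sub>R x + r *\<^sub>R y" by transfer (simp add: algebra_simps)
  show "(r + s) *\<^sub>R x = r *\<^sub>R x + s *\<^sub>R x" by transfer (simp add: algebra_simps)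
  show "r *\<^sub>R s *\<^sub>R x = (r * s) *\<^sub>R x" by transfer (simp add: algebra_simps)
  show "1 *\<^sub>R x = x" by transfer simp
  show "dist x y = norm (x - y)" by (rule dist_ell2_def)
  show "sgn x = inverse (norm x) *\<^sub>R x" by (rule sgn_ell2_def)
  show "uniformity = (INF e\<in>{0<..}. principal {(x :: 'a ell2, y). dist x y < e})"
    by (rule uniformity_ell2_def)
  show "open U = (\<forall>x\<in>U. \<forall>\<^sub>F (x', y) in uniformity. x' = x \<longrightarrow> y \<in> U)"
    by (rule open_ell2_def)
  have summ: "(\<lambda>a. Re (cnj (f a) * g a)) summable_on UNIV"
    if "(\<lambda>a. (cmod (f a))\<^sup>2) summable_on UNIV" "(\<lambda>a. (cmod (g a))\<^sup>2) summable_on UNIV"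
    for f g :: "'a \<Rightarrow> complex"
  proof (rule summable_on_Re, rule abs_summable_summable, rule sq_summable_mult)
    show "(\<lambda>a. (cmod (cnj (f a)))\<^sup>2) summable_on UNIV" using that(1) by simp
  qed (rule that(2))
  show "inner x y = inner y x"
  proof -
    have "Re (cnj c * d) = Re (cnj d * c)" for c d by simp
    then show ?thesis by (simp only: inner_ell2.rep_eq)
  qed
  show "inner (x + y) z = inner x z + inner y z"
  proof transfer
    fix x y z :: "'a \<Rightarrow> complex"
    assume "(\<lambda>a. (cmod (x a))\<^sup>2) summable_on UNIV" "(\<lambda>a. (cmod (y a))\<^sup>2) summable_on UNIV"
      "(\<lambda>a. (cmod (z a))\<^sup>2) summable_on UNIV"
    from infsum_add[OF summ[OF this(1,3)] summ[OF this(2,3)]]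
    show "(\<Sum>\<^sub>\<infinity>a. Re (cnj (x a + y a) * z a)) =
      (\<Sum>\<^sub>\<infinity>a. Re (cnj (x a) * z a)) + (\<Sum>\<^sub>\<infinity>a. Re (cnj (y a) * z a))"
      by (simp add: algebra_simps)
  qed
  show "inner (r *\<^sub>R x) y = r * inner x y"
  proof transfer
    fix r :: real and x y :: "'a \<Rightarrow> complex"
    have "Re (cnj (of_real r * x a) * y a) = r * Re (cnj (x a) * y a)" for a
      by (simp add: algebra_simps)
    then show "(\<Sum>\<^sub>\<infinity>a. Re (cnj (of_real r * x a) * y a)) = r * (\<Sum>\<^sub>\<infinity>a. Re (cnj (x a) * y a))"
      by (simp only: infsum_cmult_right')
  qed
  have sq: "Re (cnj c * c) = (cmod c)\<^sup>2" for c
    by (simp add: cmod_power2) (simp add: power2_eq_square)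
  show "0 \<le> inner x x"
    by transfer (simp only: sq, rule infsum_nonneg, simp)
  show "(inner x x = 0) = (x = 0)"
  proof transfer
    fix x :: "'a \<Rightarrow> complex"
    assume s: "(\<lambda>a. (cmod (x a))\<^sup>2) summable_on UNIV"
    show "((\<Sum>\<^sub>\<infinity>a. Re (cnj (x a) * x a)) = 0) = (x = (\<lambda>_. 0))"
    proof
      assume "(\<Sum>\<^sub>\<infinity>a. Re (cnj (x a) * x a)) = 0"
      then have "(\<Sum>\<^sub>\<infinity>a. (cmod (x a))\<^sup>2) \<le> 0" by (simp only: sq)
      from nonneg_infsum_le_0D[OF this s] show "x = (\<lambda>_. 0)" by auto
    qed simp
  qed
  show "norm x = sqrt (inner x x)" by (rule norm_ell2_def)
qed

end

lemma norm_ell2_sq: "(norm x)\<^sup>2 = (\<Sum>\<^sub>\<infinity>a. (cmod (Rep_ell2 x a))\<^sup>2)"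
proof -
  have "Re (cnj c * c) = (cmod c)\<^sup>2" for c
    by (simp add: cmod_power2) (simp add: power2_eq_square)
  then have "inner x x = (\<Sum>\<^sub>\<infinity>a. (cmod (Rep_ell2 x a))\<^sup>2)"
    by (simp only: inner_ell2.rep_eq)
  then show ?thesis by (simp add: power2_norm_eq_inner)
qed

lemma sum_le_norm_ell2_sq:
  "finite F \<Longrightarrow> (\<Sum>a\<in>F. (cmod (Rep_ell2 x a))\<^sup>2) \<le> (norm x)\<^sup>2"
  unfolding norm_ell2_sq using Rep_ell2[of x] by (intro finite_sum_le_infsum) auto

lemma norm_ell2_le:
  assumes "\<And>F. finite F \<Longrightarrow> (\<Sum>a\<in>F. (cmod (Rep_ell2 x a))\<^sup>2) \<le> B\<^sup>2" "0 \<le> B"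
  shows "norm x \<le> B"
proof -
  have "(norm x)\<^sup>2 \<le> B\<^sup>2"
    unfolding norm_ell2_sq using Rep_ell2[of x] assms(1) by (intro infsum_le_finite_sums) auto
  then show ?thesis using assms(2) by (rule power2_le_imp_le)
qed

instance ell2 :: (type) complete_space
proof
  fix X :: "nat \<Rightarrow> 'a ell2"
  assume C: "Cauchy X"
  have comp: "cmod (Rep_ell2 x a) \<le> norm x" for x :: "'a ell2" and a
    using sum_le_norm_ell2_sq[of "{a}" x] by (auto intro: power2_le_imp_le)
  have "Cauchy (\<lambda>n. Rep_ell2 (X n) a)" for a
  proof (rule CauchyI)
    fix e :: real assume "e > 0"
    then obtain M where M: "\<forall>m\<ge>M. \<forall>n\<ge>M. norm (X m - X n) < e" using CauchyD[OF C] by blast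
    have "norm (Rep_ell2 (X m) a - Rep_ell2 (X n) a) < e" if "m \<ge> M" "n \<ge> M" for m n
      using comp[of "X m - X n" a] M that by (fastforce simp: minus_ell2.rep_eq)
    then show "\<exists>M. \<forall>m\<ge>M. \<forall>n\<ge>M. norm (Rep_ell2 (X m) a - Rep_ell2 (X n) a) < e" by blast
  qed
  then have "\<exists>l. (\<lambda>n. Rep_ell2 (X n) a) \<longlonglongrightarrow> l" for a
    using Cauchy_convergent convergent_def by blast
  then obtain f where f: "\<And>a. (\<lambda>n. Rep_ell2 (X n) a) \<longlonglongrightarrow> f a" by metis
  have bound: "\<exists>M. \<forall>m\<ge>M. \<forall>F. finite F \<longrightarrow> (\<Sum>a\<in>F. (cmod (Rep_ell2 (X m) a - f a))\<^sup>2) \<le> e\<^sup>2"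
    if "e > 0" for e
  proof -
    from CauchyD[OF C that] obtain M where M: "\<forall>m\<ge>M. \<forall>n\<ge>M. norm (X m - X n) < e" by blast
    have "(\<Sum>a\<in>F. (cmod (Rep_ell2 (X m) a - f a))\<^sup>2) \<le> e\<^sup>2" if "m \<ge> M" "finite F" for m F
    proof (rule LIMSEQ_le_const2)
      show "(\<lambda>n. \<Sum>a\<in>F. (cmod (Rep_ell2 (X m) a - Rep_ell2 (X n) a))\<^sup>2)
        \<longlonglongrightarrow> (\<Sum>a\<in>F. (cmod (Rep_ell2 (X m) a - f a))\<^sup>2)"
        by (intro tendsto_intros f)
      have "(\<Sum>a\<in>F. (cmod (Rep_ell2 (X m) a - Rep_ell2 (X n) a))\<^sup>2) \<le> e\<^sup>2" if "n \<ge> M" for n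
      proof -
        have "(\<Sum>a\<in>F. (cmod (Rep_ell2 (X m - X n) a))\<^sup>2) \<le> (norm (X m - X n))\<^sup>2"
          using \<open>finite F\<close> by (rule sum_le_norm_ell2_sq)
        also have "\<dots> \<le> e\<^sup>2"
          using M \<open>m \<ge> M\<close> that by (intro power_mono) (auto intro: less_imp_le)
        finally show ?thesis by (simp add: minus_ell2.rep_eq)
      qed
      then show "\<exists>N. \<forall>n\<ge>N. (\<Sum>a\<in>F. (cmod (Rep_ell2 (X m) a - Rep_ell2 (X n) a))\<^sup>2) \<le> e\<^sup>2"
        by blast
    qed
    then show ?thesis by blast
  qed
  from bound[of 1] obtain M where M:
    "\<And>F. finite F \<Longrightarrow> (\<Sum>a\<in>F. (cmod (Rep_ell2 (X M) a - f a))\<^sup>2) \<le> 1"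
    by auto
  have "(\<lambda>a. (cmod (Rep_ell2 (X M) a - f a))\<^sup>2) summable_on UNIV"
    by (rule nonneg_bdd_above_summable_on) (auto intro!: bdd_aboveI2[where M = 1] M)
  from sq_summable_add[OF sq_summable_scale[OF this, of "-1"], of "Rep_ell2 (X M)"]
  have fs: "(\<lambda>a. (cmod (f a))\<^sup>2) summable_on UNIV"
    using Rep_ell2[of "X M"] by simp
  define l where "l = Abs_ell2 f"
  have l: "Rep_ell2 l = f" using fs by (simp add: l_def Abs_ell2_inverse)
  have "X \<longlonglongrightarrow> l"
  proof (rule LIMSEQ_I)
    fix e :: real assume "e > 0"
    with bound[of "e/2"] obtain M where M:
      "\<And>m F. m \<ge> M \<Longrightarrow> finite F \<Longrightarrow> (\<Sum>a\<in>F. (cmod (Rep_ell2 (X m) a - f a))\<^sup>2) \<le> (e/2)\<^sup>2"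
      by auto
    have "norm (X m - l) \<le> e/2" if "m \<ge> M" for m
      using M[OF that] \<open>e > 0\<close> by (intro norm_ell2_le) (auto simp: minus_ell2.rep_eq l)
    then show "\<exists>M. \<forall>m\<ge>M. norm (X m - l) < e" using \<open>e > 0\<close> by (intro exI[of _ M]) force
  qed
  then show "convergent X" by (auto simp: convergent_def)
qed

instance ell2 :: (type) banach ..

lemma norm_cscale: "norm (c *\<^sub>\<complex> x) = cmod c * norm x"
proof -
  have "(norm (c *\<^sub>\<complex> x))\<^sup>2 = (cmod c * norm x)\<^sup>2"
    by (simp add: norm_ell2_sq cscale.rep_eq norm_mult power_mult_distrib infsum_cmult_right')
  then show ?thesis by (simp add: power2_eq_iff_nonneg)
qed

lemma bounded_linear_cscale: "bounded_linear (\<lambda>x :: 'a ell2. c *\<^sub>\<complex> x)"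
proof (rule bounded_linear_intro)
  show "c *\<^sub>\<complex> (x + y) = c *\<^sub>\<complex> x + c *\<^sub>\<complex> y" for x y :: "'a ell2"
    by transfer (simp add: algebra_simps)
  show "c *\<^sub>\<complex> (r *\<^sub>R x) = r *\<^sub>R (c *\<^sub>\<complex> x)" for r and x :: "'a ell2"
    by transfer (simp add: algebra_simps)
  show "norm (c *\<^sub>\<complex> x) \<le> norm x * cmod c" for x :: "'a ell2"
    by (simp add: norm_cscale)
qed


section \<open>Bounded operators\<close>

text \<open>
  \<^typ>\<open>'a ell2 \<Rightarrow>\<^sub>L 'a ell2\<close> consists of the real-linear bounded maps, with the operator norm;
  complex scalars act by post-composition.
\<close>

type_synonym 'a ell2_op = "'a ell2 \<Rightarrow>\<^sub>L 'a ell2"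

definition op_scale :: "complex \<Rightarrow> 'a ell2_op \<Rightarrow> 'a ell2_op" (infixr \<open>\<cdot>\<^sub>\<complex>\<close> 75)
  where "c \<cdot>\<^sub>\<complex> T = Blinfun (\<lambda>x. c *\<^sub>\<complex> blinfun_apply T x)"

lemma op_scale_apply: "blinfun_apply (c \<cdot>\<^sub>\<complex> T) x = c *\<^sub>\<complex> blinfun_apply T x"
  unfolding op_scale_def
  by (subst bounded_linear_Blinfun_apply)
    (rule bounded_linear_compose[OF bounded_linear_cscale blinfun.bounded_linear_right], simp)

definition complex_linear :: "'a ell2_op \<Rightarrow> bool"
  where "complex_linear T \<longleftrightarrow> (\<forall>c x. blinfun_apply T (c *\<^sub>\<complex> x) = c *\<^sub>\<complex> blinfun_apply T x)"

definition op_adj :: "'a ell2_op \<Rightarrow> 'a ell2_op"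
  where "op_adj T = (THE S. \<forall>x y. cinner (blinfun_apply T x) y = cinner x (blinfun_apply S y))"

text \<open>
  Operators on \<open>\<ell>\<^sup>2(I)\<close>, for a subset \<open>I\<close> of the index type, are identified with the operators on
  the whole space that vanish on \<open>\<ell>\<^sup>2(I)\<^sup>\<bottom>\<close> and have range in \<open>\<ell>\<^sup>2(I)\<close>. In particular the unit of
  \<open>B(\<ell>\<^sup>2(I))\<close> is the projection \<open>op_on I id\<close>.
\<close>

definition op_on :: "'a set \<Rightarrow> ('a \<Rightarrow> 'a) \<Rightarrow> 'a ell2_op"
  where "op_on I f = (THE T. complex_linear T \<and>
    (\<forall>v. blinfun_apply T (\<delta> v) = (if v \<in> I then \<delta> (f v) else 0)))"

lemma Diff_Int_self: "(A - B) \<inter> B = {}"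
  by blast

lemma ell2_op_eqI:
  assumes "complex_linear S" "complex_linear T"
    and eq: "\<And>v. blinfun_apply S (\<delta> v) = blinfun_apply T (\<delta> v)"
  shows "S = T"
proof (rule blinfun_eqI)
  fix x :: "'a ell2"
  define D where "D = S - T"
  have Dlin: "blinfun_apply D (c *\<^sub>\<complex> y) = c *\<^sub>\<complex> blinfun_apply D y" for c y
  proof -
    have "c *\<^sub>\<complex> (u - v) = c *\<^sub>\<complex> u - c *\<^sub>\<complex> v" for u v :: "'a ell2"
      by transfer (simp add: algebra_simps)
    then show ?thesis
      using assms(1,2) by (simp add: D_def complex_linear_def blinfun.diff_left)
  qed
  have D\<delta>: "blinfun_apply D (\<delta> v) = 0" for v by (simp add: D_def blinfun.diff_left eq)
  have c0: "c *\<^sub>\<complex> 0 = (0 :: 'a ell2)" for c by transfer simp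
  define tr where "tr F = (\<Sum>a\<in>F. Rep_ell2 x a *\<^sub>\<complex> \<delta> a)" for F
  have Dtr: "blinfun_apply D (tr F) = 0" for F
    by (simp add: tr_def blinfun.sum_right Dlin D\<delta> c0)
  have Rtr: "Rep_ell2 (tr F) a = (if a \<in> F then Rep_ell2 x a else 0)" if "finite F" for F a
    using that unfolding tr_def
    by (induction F rule: finite_induct)
      (auto simp: zero_ell2.rep_eq plus_ell2.rep_eq cscale.rep_eq ell2_basis.rep_eq)
  have summ: "(\<lambda>a. (cmod (Rep_ell2 x a))\<^sup>2) summable_on UNIV" using Rep_ell2[of x] by simp
  have le: "norm (blinfun_apply D x) \<le> norm D * e" if "e > 0" for e
  proof -
    from summ have "((\<lambda>a. (cmod (Rep_ell2 x a))\<^sup>2) has_sum (norm x)\<^sup>2) UNIV"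
      by (simp add: norm_ell2_sq)
    then have "\<forall>\<^sub>F F in finite_subsets_at_top UNIV.
        dist (\<Sum>a\<in>F. (cmod (Rep_ell2 x a))\<^sup>2) ((norm x)\<^sup>2) < e\<^sup>2"
      unfolding has_sum_def using that by (intro tendstoD) auto
    then obtain F where F: "finite F" "dist (\<Sum>a\<in>F. (cmod (Rep_ell2 x a))\<^sup>2) ((norm x)\<^sup>2) < e\<^sup>2"
      by (metis (mono_tags, lifting) eventually_finite_subsets_at_top order_refl subset_UNIV)
    have "norm (x - tr F) \<le> e"
    proof (rule norm_ell2_le)
      fix H :: "'a set" assume H: "finite H"
      have "(\<Sum>a\<in>H. (cmod (Rep_ell2 (x - tr F) a))\<^sup>2) = (\<Sum>a\<in>H - F. (cmod (Rep_ell2 x a))\<^sup>2)"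
        using H F(1) by (intro sum.mono_neutral_cong_right) (auto simp: minus_ell2.rep_eq Rtr)
      also have "\<dots> = (\<Sum>a\<in>H \<union> F. (cmod (Rep_ell2 x a))\<^sup>2) - (\<Sum>a\<in>F. (cmod (Rep_ell2 x a))\<^sup>2)"
        using sum.union_disjoint[OF _ F(1) Diff_Int_self, of H "\<lambda>a. (cmod (Rep_ell2 x a))\<^sup>2"] H
        by (simp add: Un_Diff_cancel2)
      also have "\<dots> \<le> (norm x)\<^sup>2 - (\<Sum>a\<in>F. (cmod (Rep_ell2 x a))\<^sup>2)"
        using sum_le_norm_ell2_sq[of "H \<union> F" x] H F(1) by simp
      also have "\<dots> \<le> e\<^sup>2" using F(2) by (simp add: dist_real_def)
      finally show "(\<Sum>a\<in>H. (cmod (Rep_ell2 (x - tr F) a))\<^sup>2) \<le> e\<^sup>2" .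
    qed (use that in simp)
    moreover have "blinfun_apply D x = blinfun_apply D (x - tr F)"
      by (simp add: blinfun.diff_right Dtr)
    ultimately show ?thesis
      using norm_blinfun[of D "x - tr F"] mult_left_mono[of "norm (x - tr F)" e "norm D"] by auto
  qed
  have "norm (blinfun_apply D x) \<le> 0"
  proof (rule field_le_epsilon)
    fix e :: real assume "e > 0"
    have "norm D * (e / (norm D + 1)) \<le> e"
      using \<open>e > 0\<close> add_nonneg_pos[OF norm_ge_zero[of D] zero_less_one]
      by (simp add: divide_le_eq algebra_simps)
    moreover have "norm (blinfun_apply D x) \<le> norm D * (e / (norm D + 1))"
      using \<open>e > 0\<close> by (intro le divide_pos_pos add_nonneg_pos) auto
    ultimately show "norm (blinfun_apply D x) \<le> 0 + e" by simp
  qed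
  then show "blinfun_apply S x = blinfun_apply T x" by (simp add: D_def blinfun.diff_left)
qed

lemma op_on:
  assumes inj: "inj_on f I"
  shows "complex_linear (op_on I f)"
    and "blinfun_apply (op_on I f) (\<delta> v) = (if v \<in> I then \<delta> (f v) else 0)"
proof -
  define t where "t x u = (if u \<in> f ` I then Rep_ell2 x (inv_into I f u) else 0)"
    for x :: "'a ell2" and u
  have bnd: "(\<Sum>u\<in>F. (cmod (t x u))\<^sup>2) \<le> (norm x)\<^sup>2" if "finite F" for x F
  proof -
    have "(\<Sum>u\<in>F. (cmod (t x u))\<^sup>2) = (\<Sum>u\<in>F \<inter> f ` I. (cmod (Rep_ell2 x (inv_into I f u)))\<^sup>2)"
      using that by (intro sum.mono_neutral_cong_right) (auto simp: t_def)
    also have "\<dots> = (\<Sum>a\<in>inv_into I f ` (F \<inter> f ` I). (cmod (Rep_ell2 x a))\<^sup>2)"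
      by (subst sum.reindex) (auto intro: inj_on_inv_into)
    also have "\<dots> \<le> (norm x)\<^sup>2" using that by (intro sum_le_norm_ell2_sq) auto
    finally show ?thesis .
  qed
  have ts: "(\<lambda>u. (cmod (t x u))\<^sup>2) summable_on UNIV" for x
    by (rule nonneg_bdd_above_summable_on) (auto intro!: bdd_aboveI2[where M = "(norm x)\<^sup>2"] bnd)
  define T where "T x = Abs_ell2 (t x)" for x
  have RT: "Rep_ell2 (T x) = t x" for x using ts by (simp add: T_def Abs_ell2_inverse)
  have "bounded_linear T"
  proof (rule bounded_linear_intro)
    show "T (x + y) = T x + T y" for x y
      by (rule Rep_ell2_inject[THEN iffD1]) (auto simp: RT t_def plus_ell2.rep_eq)
    show "T (r *\<^sub>R x) = r *\<^sub>R T x" for r x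
      by (rule Rep_ell2_inject[THEN iffD1]) (auto simp: RT t_def scaleR_ell2.rep_eq)
    show "norm (T x) \<le> norm x * 1" for x
      using bnd[of _ x] by (intro norm_ell2_le) (auto simp: RT)
  qed
  then have app: "blinfun_apply (Blinfun T) = T" by (rule bounded_linear_Blinfun_apply)
  have 1: "complex_linear (Blinfun T)" unfolding complex_linear_def app
    by (auto intro!: Rep_ell2_inject[THEN iffD1] simp: RT t_def cscale.rep_eq)
  have 2: "\<forall>v. blinfun_apply (Blinfun T) (\<delta> v) = (if v \<in> I then \<delta> (f v) else 0)" unfolding app
    using inj
    by (auto intro!: Rep_ell2_inject[THEN iffD1] ext
        simp: RT t_def ell2_basis.rep_eq zero_ell2.rep_eq inv_into_f_f inv_into_into)
  have "complex_linear (op_on I f) \<and>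
    (\<forall>v. blinfun_apply (op_on I f) (\<delta> v) = (if v \<in> I then \<delta> (f v) else 0))"
    unfolding op_on_def by (rule theI[of _ "Blinfun T"]) (auto intro: ell2_op_eqI simp: 1 2)
  then show "complex_linear (op_on I f)"
    and "blinfun_apply (op_on I f) (\<delta> v) = (if v \<in> I then \<delta> (f v) else 0)" by auto
qed


section \<open>States and KMS states on algebras of operators\<close>

definition clinear_functional_on :: "'a ell2_op set \<Rightarrow> ('a ell2_op \<Rightarrow> complex) \<Rightarrow> bool"
  where "clinear_functional_on V \<psi> \<longleftrightarrow>
    (\<forall>a\<in>V. \<forall>b\<in>V. \<psi> (a + b) = \<psi> a + \<psi> b) \<and> (\<forall>c. \<forall>a\<in>V. \<psi> (c \<cdot>\<^sub>\<complex> a) = c * \<psi> a)"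

text \<open>
  A state on a C*-algebra \<open>A\<close> with unit \<open>e\<close>: a positive linear functional of norm one. Functionals
  are made unique as HOL functions by requiring them to be \<^const>\<open>undefined\<close> outside \<open>A\<close>.
\<close>

definition state_on :: "'a ell2_op set \<Rightarrow> 'a ell2_op \<Rightarrow> ('a ell2_op \<Rightarrow> complex) \<Rightarrow> bool"
  where "state_on A e \<psi> \<longleftrightarrow> \<psi> \<in> extensional A \<and> clinear_functional_on A \<psi> \<and>
    (\<forall>a\<in>A. \<psi> (op_adj a o\<^sub>L a) \<in> \<real>\<^sub>\<ge>\<^sub>0) \<and>
    (\<forall>a\<in>A. cmod (\<psi> a) \<le> norm a) \<and> \<psi> e = 1"

text \<open>
  \<open>F\<close> is the entire extension \<open>z \<mapsto> \<Gamma>\<^sub>z(a)\<close> of \<open>t \<mapsto> \<Gamma>\<^sub>t(a)\<close>; an element is analytic if it has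
  one, and the extension is then unique.
\<close>

definition entire_extension ::
    "'a ell2_op set \<Rightarrow> (real \<Rightarrow> 'a ell2_op \<Rightarrow> 'a ell2_op) \<Rightarrow> 'a ell2_op \<Rightarrow> (complex \<Rightarrow> 'a ell2_op) \<Rightarrow> bool"
  where "entire_extension A \<Gamma> a F \<longleftrightarrow> (\<forall>z. F z \<in> A) \<and>
    (\<forall>z. \<exists>D. (F has_derivative (\<lambda>h. h \<cdot>\<^sub>\<complex> D)) (at z)) \<and> (\<forall>t. F (of_real t) = \<Gamma> t a)"

definition analytic_elements ::
    "'a ell2_op set \<Rightarrow> (real \<Rightarrow> 'a ell2_op \<Rightarrow> 'a ell2_op) \<Rightarrow> 'a ell2_op set"
  where "analytic_elements A \<Gamma> = {a \<in> A. \<exists>F. entire_extension A \<Gamma> a F}"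

definition KMS_states ::
    "'a ell2_op set \<Rightarrow> 'a ell2_op \<Rightarrow> (real \<Rightarrow> 'a ell2_op \<Rightarrow> 'a ell2_op) \<Rightarrow> real \<Rightarrow>
      ('a ell2_op \<Rightarrow> complex) set"
  where "KMS_states A e \<Gamma> \<beta> = {\<psi>. state_on A e \<psi> \<and>
    (\<forall>a\<in>analytic_elements A \<Gamma>. \<forall>b\<in>analytic_elements A \<Gamma>. \<forall>F. entire_extension A \<Gamma> b F \<longrightarrow>
      \<psi> (a o\<^sub>L F (\<i> * of_real \<beta>)) = \<psi> (b o\<^sub>L a))}"

text \<open>*-automorphisms of C*-algebras are automatically isometric.\<close>

definition star_automorphism :: "'a ell2_op set \<Rightarrow> ('a ell2_op \<Rightarrow> 'a ell2_op) \<Rightarrow> bool"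
  where "star_automorphism A \<alpha> \<longleftrightarrow> \<alpha> \<in> extensional A \<and> bij_betw \<alpha> A A \<and>
    (\<forall>a\<in>A. \<forall>b\<in>A. \<alpha> (a + b) = \<alpha> a + \<alpha> b \<and> \<alpha> (a o\<^sub>L b) = \<alpha> a o\<^sub>L \<alpha> b) \<and>
    (\<forall>c. \<forall>a\<in>A. \<alpha> (c \<cdot>\<^sub>\<complex> a) = c \<cdot>\<^sub>\<complex> \<alpha> a) \<and>
    (\<forall>a\<in>A. \<alpha> (op_adj a) = op_adj (\<alpha> a) \<and> norm (\<alpha> a) = norm a)"


section \<open>Self-similar actions\<close>

definition word_topology :: "'x word topology"
  where "word_topology = product_topology (\<lambda>_. discrete_topology UNIV) UNIV"

definition bernoulli_measure :: "('x::finite) word measure"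
  where "bernoulli_measure = PiM UNIV (\<lambda>_. uniform_count_measure UNIV)"

definition self_similar_action ::
    "('g, 'b) monoid_scheme \<Rightarrow> ('g \<Rightarrow> 'x word \<Rightarrow> 'x word) \<Rightarrow> bool"
  where "self_similar_action G \<phi> \<longleftrightarrow> faithful_action G UNIV \<phi> \<and>
    (\<forall>g\<in>carrier G. \<forall>x. \<exists>h\<in>carrier G. \<exists>v. \<forall>w. \<phi> g ([x] \<frown> w) = [v] \<frown> \<phi> h w)"

definition generic_points :: "('g, 'b) monoid_scheme \<Rightarrow> ('g \<Rightarrow> 'x word \<Rightarrow> 'x word) \<Rightarrow> 'x word set"
  where "generic_points G \<phi> = {w. \<forall>g\<in>carrier G. \<phi> g w \<noteq> w \<or>
    (\<exists>U. openin word_topology U \<and> w \<in> U \<and> (\<forall>v\<in>U. \<phi> g v = v))}"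

definition T_star :: "'x list \<Rightarrow> 'x word \<rightharpoonup> 'x word"
  where "T_star u w = (if w \<in> range (conc u) then Some (inv_into UNIV (conc u) w) else None)"

definition partial_maps ::
    "('g, 'b) monoid_scheme \<Rightarrow> ('g \<Rightarrow> 'x word \<Rightarrow> 'x word) \<Rightarrow> ('x word \<rightharpoonup> 'x word) set"
  where "partial_maps G \<phi> =
    {\<lambda>w. map_option (\<lambda>v. u\<^sub>1 \<frown> \<phi> g v) (T_star u\<^sub>2 w) | u\<^sub>1 g u\<^sub>2. g \<in> carrier G}"

definition strictly_generic ::
    "('g, 'b) monoid_scheme \<Rightarrow> ('g \<Rightarrow> 'x word \<Rightarrow> 'x word) \<Rightarrow> 'x word \<Rightarrow> bool"
  where "strictly_generic G \<phi> w \<longleftrightarrow> (\<forall>f\<in>partial_maps G \<phi>. f w = None \<or> f w \<noteq> Some w \<or>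
    (\<exists>U. openin word_topology U \<and> w \<in> U \<and> (\<forall>v\<in>U. f v = Some v)))"

definition partial_orbit ::
    "('g, 'b) monoid_scheme \<Rightarrow> ('g \<Rightarrow> 'x word \<Rightarrow> 'x word) \<Rightarrow> 'x word \<Rightarrow> 'x word set"
  where "partial_orbit G \<phi> w = {v. \<exists>f\<in>partial_maps G \<phi>. f w = Some v}"


section \<open>The universal algebra\<close>

text \<open>
  The free complex *-algebra on the generators \<open>g\<close> and \<open>S\<^sub>x\<close>: its elements are the finitely supported
  functions on words in the generators and their formal adjoints.
\<close>

datatype ('g, 'x) letter = Grp 'g | Grp_adj 'g | Iso 'x | Iso_adj 'x

primrec letter_adj :: "('g, 'x) letter \<Rightarrow> ('g, 'x) letter" where
  "letter_adj (Grp g) = Grp_adj g"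
| "letter_adj (Grp_adj g) = Grp g"
| "letter_adj (Iso x) = Iso_adj x"
| "letter_adj (Iso_adj x) = Iso x"

type_synonym ('g, 'x) free_poly = "('g, 'x) letter list \<Rightarrow> complex"

definition free_star_algebra :: "('g, 'b) monoid_scheme \<Rightarrow> ('g, 'x) free_poly set"
  where "free_star_algebra G = {p. finite {u. p u \<noteq> 0} \<and>
    (\<forall>u. p u \<noteq> 0 \<longrightarrow> set u \<subseteq> Grp ` carrier G \<union> Grp_adj ` carrier G \<union> range Iso \<union> range Iso_adj)}"

definition fp_word :: "('g, 'x) letter list \<Rightarrow> ('g, 'x) free_poly"
  where "fp_word v = (\<lambda>u. if u = v then 1 else 0)"

definition fp_add :: "('g, 'x) free_poly \<Rightarrow> ('g, 'x) free_poly \<Rightarrow> ('g, 'x) free_poly"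
  where "fp_add p q = (\<lambda>u. p u + q u)"

definition fp_diff :: "('g, 'x) free_poly \<Rightarrow> ('g, 'x) free_poly \<Rightarrow> ('g, 'x) free_poly"
  where "fp_diff p q = (\<lambda>u. p u - q u)"

definition fp_scale :: "complex \<Rightarrow> ('g, 'x) free_poly \<Rightarrow> ('g, 'x) free_poly"
  where "fp_scale c p = (\<lambda>u. c * p u)"

definition fp_mult :: "('g, 'x) free_poly \<Rightarrow> ('g, 'x) free_poly \<Rightarrow> ('g, 'x) free_poly"
  where "fp_mult p q = (\<lambda>u. \<Sum>k\<le>length u. p (take k u) * q (drop k u))"

definition fp_adj :: "('g, 'x) free_poly \<Rightarrow> ('g, 'x) free_poly"
  where "fp_adj p = (\<lambda>u. cnj (p (rev (map letter_adj u))))"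

text \<open>
  In the last set \<open>v\<close> and \<open>h\<close> are determined by \<open>g\<close> and \<open>x\<close>, the action being faithful: they are
  \<open>v(g,x)\<close> and \<open>h(g,x)\<close>.
\<close>

definition relators ::
    "('g, 'b) monoid_scheme \<Rightarrow> ('g \<Rightarrow> ('x::finite) word \<Rightarrow> 'x word) \<Rightarrow> ('g, 'x) free_poly set"
  where "relators G \<phi> =
    {fp_diff (fp_word [Grp g, Grp h]) (fp_word [Grp (g \<otimes>\<^bsub>G\<^esub> h)]) | g h.
      g \<in> carrier G \<and> h \<in> carrier G} \<union>
    {fp_diff (fp_word [Grp_adj g, Grp g]) (fp_word []) | g. g \<in> carrier G} \<union>
    {fp_diff (fp_word [Grp g, Grp_adj g]) (fp_word []) | g. g \<in> carrier G} \<union>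
    {fp_diff (fp_word [Iso_adj x, Iso y]) (fp_scale (if x = y then 1 else 0) (fp_word [])) | x y. True} \<union>
    {fp_diff (\<lambda>u. \<Sum>x\<in>UNIV. fp_word [Iso x, Iso_adj x] u) (fp_word [])} \<union>
    {fp_diff (fp_word [Grp g, Iso x]) (fp_word [Iso v, Grp h]) | g x v h.
      g \<in> carrier G \<and> h \<in> carrier G \<and> (\<forall>w. \<phi> g ([x] \<frown> w) = [v] \<frown> \<phi> h w)}"

definition cstar_seminorm ::
    "('g, 'b) monoid_scheme \<Rightarrow> ('g \<Rightarrow> ('x::finite) word \<Rightarrow> 'x word) \<Rightarrow>
      (('g, 'x) free_poly \<Rightarrow> real) \<Rightarrow> bool"
  where "cstar_seminorm G \<phi> N \<longleftrightarrow>
    (\<forall>p\<in>free_star_algebra G. 0 \<le> N p \<and> N (fp_mult (fp_adj p) p) = (N p)\<^sup>2 \<and>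
      (\<forall>c. N (fp_scale c p) = cmod c * N p) \<and>
      (\<forall>q\<in>free_star_algebra G. N (fp_add p q) \<le> N p + N q \<and> N (fp_mult p q) \<le> N p * N q)) \<and>
    (\<forall>p\<in>relators G \<phi>. N p = 0)"

text \<open>
  The universal C*-algebra is the separated completion of the free *-algebra for the largest
  C*-seminorm that vanishes on the relators, realised by classes of Cauchy sequences.
\<close>

definition max_norm ::
    "('g, 'b) monoid_scheme \<Rightarrow> ('g \<Rightarrow> ('x::finite) word \<Rightarrow> 'x word) \<Rightarrow> ('g, 'x) free_poly \<Rightarrow> real"
  where "max_norm G \<phi> p = (SUP N\<in>{N. cstar_seminorm G \<phi> N}. N p)"

definition max_Cauchy ::
    "('g, 'b) monoid_scheme \<Rightarrow> ('g \<Rightarrow> ('x::finite) word \<Rightarrow> 'x word) \<Rightarrow>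
      (nat \<Rightarrow> ('g, 'x) free_poly) set"
  where "max_Cauchy G \<phi> = {p. (\<forall>n. p n \<in> free_star_algebra G) \<and>
    (\<forall>e>0. \<exists>M. \<forall>m\<ge>M. \<forall>n\<ge>M. max_norm G \<phi> (fp_diff (p m) (p n)) < e)}"

definition O_max ::
    "('g, 'b) monoid_scheme \<Rightarrow> ('g \<Rightarrow> ('x::finite) word \<Rightarrow> 'x word) \<Rightarrow>
      (nat \<Rightarrow> ('g, 'x) free_poly) set set"
  where "O_max G \<phi> = max_Cauchy G \<phi> //
    {(p, q) \<in> max_Cauchy G \<phi> \<times> max_Cauchy G \<phi>. (\<lambda>n. max_norm G \<phi> (fp_diff (p n) (q n))) \<longlonglongrightarrow> 0}"


section \<open>The representation on the orbit of a strictly generic point\<close>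

definition rep_letter ::
    "('g, 'b) monoid_scheme \<Rightarrow> ('g \<Rightarrow> 'x word \<Rightarrow> 'x word) \<Rightarrow> 'x word \<Rightarrow>
      ('g, 'x) letter \<Rightarrow> 'x word ell2_op"
  where "rep_letter G \<phi> w l = (case l of
      Grp g \<Rightarrow> op_on (partial_orbit G \<phi> w) (\<phi> g)
    | Grp_adj g \<Rightarrow> op_adj (op_on (partial_orbit G \<phi> w) (\<phi> g))
    | Iso x \<Rightarrow> op_on (partial_orbit G \<phi> w) (conc [x])
    | Iso_adj x \<Rightarrow> op_adj (op_on (partial_orbit G \<phi> w) (conc [x])))"

definition rep_one ::
    "('g, 'b) monoid_scheme \<Rightarrow> ('g \<Rightarrow> 'x word \<Rightarrow> 'x word) \<Rightarrow> 'x word \<Rightarrow> 'x word ell2_op"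
  where "rep_one G \<phi> w = op_on (partial_orbit G \<phi> w) id"

definition rep_word ::
    "('g, 'b) monoid_scheme \<Rightarrow> ('g \<Rightarrow> 'x word \<Rightarrow> 'x word) \<Rightarrow> 'x word \<Rightarrow>
      ('g, 'x) letter list \<Rightarrow> 'x word ell2_op"
  where "rep_word G \<phi> w u = foldr (\<lambda>l T. rep_letter G \<phi> w l o\<^sub>L T) u (rep_one G \<phi> w)"

definition rep_poly ::
    "('g, 'b) monoid_scheme \<Rightarrow> ('g \<Rightarrow> 'x word \<Rightarrow> 'x word) \<Rightarrow> 'x word \<Rightarrow>
      ('g, 'x) free_poly \<Rightarrow> 'x word ell2_op"
  where "rep_poly G \<phi> w p = (\<Sum>u | p u \<noteq> 0. p u \<cdot>\<^sub>\<complex> rep_word G \<phi> w u)"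

definition rep ::
    "('g, 'b) monoid_scheme \<Rightarrow> ('g \<Rightarrow> 'x word \<Rightarrow> 'x word) \<Rightarrow> 'x word \<Rightarrow>
      (nat \<Rightarrow> ('g, 'x) free_poly) set \<Rightarrow> 'x word ell2_op"
  where "rep G \<phi> w C = (THE T. \<forall>p\<in>C. (\<lambda>n. rep_poly G \<phi> w (p n)) \<longlonglongrightarrow> T)"

definition O_min ::
    "('g, 'b) monoid_scheme \<Rightarrow> ('g \<Rightarrow> ('x::finite) word \<Rightarrow> 'x word) \<Rightarrow> 'x word \<Rightarrow>
      'x word ell2_op set"
  where "O_min G \<phi> w = rep G \<phi> w ` O_max G \<phi>"

definition generated_star_algebra ::
    "('g, 'b) monoid_scheme \<Rightarrow> ('g \<Rightarrow> 'x word \<Rightarrow> 'x word) \<Rightarrow> 'x word \<Rightarrow> 'x word ell2_op set"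
  where "generated_star_algebra G \<phi> w = rep_poly G \<phi> w ` free_star_algebra G"

definition grp_op ::
    "('g, 'b) monoid_scheme \<Rightarrow> ('g \<Rightarrow> 'x word \<Rightarrow> 'x word) \<Rightarrow> 'x word \<Rightarrow> 'g \<Rightarrow> 'x word ell2_op"
  where "grp_op G \<phi> w g = rep_word G \<phi> w [Grp g]"

definition S_op ::
    "('g, 'b) monoid_scheme \<Rightarrow> ('g \<Rightarrow> 'x word \<Rightarrow> 'x word) \<Rightarrow> 'x word \<Rightarrow> 'x list \<Rightarrow> 'x word ell2_op"
  where "S_op G \<phi> w u = rep_word G \<phi> w (map Iso u)"

text \<open>\<open>\<Gamma>\<^sub>t\<close> is the unique automorphism with the prescribed values on the generators.\<close>

definition gauge_action ::
    "('g, 'b) monoid_scheme \<Rightarrow> ('g \<Rightarrow> ('x::finite) word \<Rightarrow> 'x word) \<Rightarrow> 'x word \<Rightarrow>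
      real \<Rightarrow> 'x word ell2_op \<Rightarrow> 'x word ell2_op"
  where "gauge_action G \<phi> w t = (THE \<alpha>. star_automorphism (O_min G \<phi> w) \<alpha> \<and>
    (\<forall>g\<in>carrier G. \<alpha> (grp_op G \<phi> w g) = grp_op G \<phi> w g) \<and>
    (\<forall>x. \<alpha> (S_op G \<phi> w [x]) = cis t \<cdot>\<^sub>\<complex> S_op G \<phi> w [x]))"

end

theory Submission
  imports Defs "HOL-Complex_Analysis.Conformal_Mappings"
begin


text \<open>
  Let \<open>\<O>\<close> be the orbit of the strictly generic point \<open>w\<close>, and let \<open>V\<^sub>n \<subseteq> \<O>\<close> contain exactly one
  point of every cylinder of level \<open>n\<close>. The state \<open>\<psi>\<close> is the pointwise limit of the averages
  \<open>\<psi>\<^sub>n(a) = |X|\<^sup>-\<^sup>n \<Sum>\<^bsub>v\<in>V\<^sub>n\<^esub> \<langle>\<delta>\<^sub>v, a \<delta>\<^sub>v\<rangle>\<close>. These are averages of vector states of the representation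
  that defines the reduced algebra, so positivity and the bound \<open>|\<psi>(a)| \<le> \<parallel>a\<parallel>\<close> in the reduced norm
  are inherited by the limit, and it is enough to prove convergence on words in the generators
  (\<open>averages_to_limit\<close>).

  Every such word is zero or equal to some \<open>S\<^sub>u g S\<^sub>v\<^sup>*\<close> (\<open>word_map_normal_form\<close>), and it acts on
  the basis by an injective partial map of \<open>\<O>\<close>. The average of a word is therefore the frequency in
  \<open>V\<^sub>n\<close> of the fixed points of this map. Strict genericity of \<open>w\<close> makes the degree \<open>|u| - |v|\<close>
  depend only on the image of \<open>w\<close> (\<open>degree_at_unique\<close>), so a word of nonzero degree has no fixed
  point in \<open>\<O>\<close>. For an element \<open>g\<close>, the cylinders of level \<open>n\<close> that \<open>g\<close> fixes pointwise, and those
  that it moves, exhaust almost all of \<open>X\<^sup>\<omega>\<close> as \<open>n\<close> grows, because almost every point is generic;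
  hence the frequency tends to the measure of the fixed-point set, for every choice of the sets
  \<open>V\<^sub>n\<close> (\<open>fixed_point_frequency\<close>).

  The freedom in the choice of \<open>V\<^sub>n\<close> gives \<open>\<psi>(a g) = \<psi>(g a)\<close>, since \<open>g\<close> maps one such family to
  another. Deleting the first letter of the points of a cylinder gives \<open>\<psi>(a S\<^sub>x) = |X| \<psi>(S\<^sub>x a)\<close>.
  Together these are the KMS condition with a word as one of the two elements (\<open>Psi_word\<close>). The gauge action
  is implemented by the diagonal unitaries \<open>\<delta>\<^sub>v \<mapsto> e\<^sup>i\<^sup>t\<^sup>d\<^sup>e\<^sup>g\<^sup>(\<^sup>v\<^sup>) \<delta>\<^sub>v\<close>, which leave \<open>\<psi>\<close> invariant; with the
  identity theorem for entire functions this extends the condition to all analytic elements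
  (\<open>Psi_entire\<close>).

  Conversely, a KMS state \<open>\<rho>\<close> vanishes on words of nonzero degree, by the KMS condition with
  the unit as second element, and it satisfies \<open>\<rho>(S\<^sub>u g S\<^sub>v\<^sup>*) = |X|\<^sup>-\<^sup>|\<^sup>u\<^sup>| \<rho>(g S\<^sub>v\<^sup>* S\<^sub>u)\<close>. It remains to find \<open>\<rho>(g)\<close>. Writing
  \<open>1\<close> as the sum of the projections \<open>S\<^sub>u S\<^sub>u\<^sup>*\<close> with \<open>|u| = n\<close> gives \<open>\<rho>(g) = |X|\<^sup>-\<^sup>n \<Sum>\<^sub>u \<rho>(S\<^sub>u\<^sup>* g S\<^sub>u)\<close>; the
  summand is \<open>1\<close> when \<open>g\<close> fixes the cylinder of \<open>u\<close> pointwise and \<open>0\<close> when \<open>g\<close> moves it, and the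
  proportion of the other words tends to \<open>0\<close> (\<open>KMS_group_element\<close>).
\<close>

section \<open>The complex inner product\<close>

lemma cinner_summable:
  "(\<lambda>a. cnj (Rep_ell2 x a) * Rep_ell2 y a) summable_on UNIV"
proof (rule abs_summable_summable, rule sq_summable_mult)
  show "(\<lambda>a. (cmod (cnj (Rep_ell2 x a)))\<^sup>2) summable_on UNIV" using Rep_ell2[of x] by simp
  show "(\<lambda>a. (cmod (Rep_ell2 y a))\<^sup>2) summable_on UNIV" using Rep_ell2[of y] by simp
qed

lemma cinner_add_right: "cinner x (y + z) = cinner x y + cinner x z"
  using infsum_add[OF cinner_summable[of x y] cinner_summable[of x z]]
  by (simp add: cinner.rep_eq plus_ell2.rep_eq algebra_simps)

lemma cinner_scale_right: "cinner x (c *\<^sub>\<complex> y) = c * cinner x y"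
proof -
  have "cnj (Rep_ell2 x a) * (c * Rep_ell2 y a) = c * (cnj (Rep_ell2 x a) * Rep_ell2 y a)" for a
    by (simp add: algebra_simps)
  then show ?thesis by (simp only: cinner.rep_eq cscale.rep_eq infsum_cmult_right')
qed

lemma cinner_commute: "cinner y x = cnj (cinner x y)"
proof -
  have "cnj (cinner x y) = (\<Sum>\<^sub>\<infinity>a. cnj (cnj (Rep_ell2 x a) * Rep_ell2 y a))"
    by (simp only: cinner.rep_eq infsum_cnj)
  then show ?thesis by (simp add: cinner.rep_eq mult.commute)
qed

lemma cinner_add_left: "cinner (x + y) z = cinner x z + cinner y z"
  by (subst (1 2 3) cinner_commute) (simp add: cinner_add_right)

lemma cinner_scale_left: "cinner (c *\<^sub>\<complex> x) y = cnj c * cinner x y"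
  by (subst (1 2) cinner_commute) (simp add: cinner_scale_right)

lemma cscale_of_real: "of_real r *\<^sub>\<complex> x = r *\<^sub>R x"
  by transfer simp

lemma cinner_zero_right [simp]: "cinner x 0 = 0"
  using cinner_add_right[of x 0 0] by simp

lemma cinner_zero_left [simp]: "cinner 0 x = 0"
  by (subst cinner_commute) simp

lemma cinner_diff_right: "cinner x (y - z) = cinner x y - cinner x z"
  using cinner_add_right[of x "y - z" z] by simp

lemma cinner_diff_left: "cinner (x - y) z = cinner x z - cinner y z"
  using cinner_add_left[of "x - y" y z] by simp

lemma Re_cinner: "Re (cinner x y) = inner x y"
  by (simp only: cinner.rep_eq inner_ell2.rep_eq infsum_Re[OF cinner_summable])

lemma cinner_self: "cinner x x = of_real ((norm x)\<^sup>2)"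
proof (rule complex_eqI)
  show "Re (cinner x x) = Re (of_real ((norm x)\<^sup>2))"
    by (simp add: Re_cinner power2_norm_eq_inner)
  show "Im (cinner x x) = Im (of_real ((norm x)\<^sup>2))"
    using cinner_commute[of x x] by (simp add: complex_eq_iff)
qed

lemma cmod_cinner_self: "cmod (cinner x x) = (norm x)\<^sup>2"
  unfolding cinner_self norm_of_real by simp

lemma norm_cinner_le: "cmod (cinner x y) \<le> norm x * norm y"
proof (cases "cinner x y = 0")
  case False
  define s where "s = cnj (sgn (cinner x y))"
  have s: "cmod s = 1" using False by (simp add: s_def norm_sgn)
  have "s * cinner x y = of_real (cmod (cinner x y))"
    using False complex_norm_square[of "cinner x y"]
    by (simp add: s_def sgn_eq power2_eq_square divide_simps mult.commute)
  then have "cmod (cinner x y) = inner x (s *\<^sub>\<complex> y)"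
    by (simp add: Re_cinner[symmetric] cinner_scale_right)
  also have "\<dots> \<le> norm x * norm (s *\<^sub>\<complex> y)" by (rule norm_cauchy_schwarz)
  finally show ?thesis by (simp add: norm_cscale s)
qed simp

lemma cinner_basis_left: "cinner (\<delta> a) x = Rep_ell2 x a"
proof -
  have "cinner (\<delta> a) x = (\<Sum>\<^sub>\<infinity>b\<in>{a}. cnj (Rep_ell2 (\<delta> a) b) * Rep_ell2 x b)"
    unfolding cinner.rep_eq by (rule infsum_cong_neutral) (auto simp: ell2_basis.rep_eq)
  then show ?thesis by (simp add: ell2_basis.rep_eq)
qed

lemma cinner_basis_right: "cinner x (\<delta> a) = cnj (Rep_ell2 x a)"
  by (subst cinner_commute) (simp add: cinner_basis_left)

lemma ell2_eqI: "(\<And>a. Rep_ell2 x a = Rep_ell2 y a) \<Longrightarrow> x = y"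
  by (auto intro!: Rep_ell2_inject[THEN iffD1])

lemma cinner_ext: "(\<And>y. cinner y x = cinner y z) \<Longrightarrow> x = z"
  by (rule ell2_eqI) (metis cinner_basis_left)

lemma norm_ell2_basis [simp]: "norm (\<delta> a) = 1"
proof -
  have "of_real ((norm (\<delta> a))\<^sup>2) = (1 :: complex)"
    using cinner_self[of "\<delta> a"] by (simp add: cinner_basis_left ell2_basis.rep_eq)
  then have "(norm (\<delta> a))\<^sup>2 = 1" using of_real_eq_1_iff by blast
  then show ?thesis by (simp add: power2_eq_1_iff) (smt (verit) norm_ge_zero)
qed

lemma cmod_Rep_ell2_le: "cmod (Rep_ell2 x a) \<le> norm x"
  using norm_cinner_le[of "\<delta> a" x] by (simp add: cinner_basis_left)

lemma cscale_zero [simp]: "c *\<^sub>\<complex> (0 :: 'a ell2) = 0" "0 *\<^sub>\<complex> (x :: 'a ell2) = 0"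
  by (transfer, simp)+

lemma cscale_one [simp]: "1 *\<^sub>\<complex> x = x" by transfer simp

lemma cscale_cscale: "c *\<^sub>\<complex> d *\<^sub>\<complex> x = (c * d) *\<^sub>\<complex> x" by transfer (simp add: mult.assoc)

lemma cscale_add_right: "c *\<^sub>\<complex> (x + y) = c *\<^sub>\<complex> x + c *\<^sub>\<complex> y"
  by transfer (simp add: algebra_simps)

lemma cscale_add_left: "(c + d) *\<^sub>\<complex> x = c *\<^sub>\<complex> x + d *\<^sub>\<complex> x"
  by transfer (simp add: algebra_simps)

lemma cscale_diff_right: "c *\<^sub>\<complex> (x - y) = c *\<^sub>\<complex> x - c *\<^sub>\<complex> y"
  by transfer (simp add: algebra_simps)

section \<open>Complex-linear operators and their adjoints\<close>

lemma complex_linearD: "complex_linear T \<Longrightarrow> blinfun_apply T (c *\<^sub>\<complex> x) = c *\<^sub>\<complex> blinfun_apply T x"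
  by (simp add: complex_linear_def)

lemma complex_linear_add: "complex_linear S \<Longrightarrow> complex_linear T \<Longrightarrow> complex_linear (S + T)"
  by (simp add: complex_linear_def blinfun.add_left cscale_add_right)

lemma complex_linear_diff: "complex_linear S \<Longrightarrow> complex_linear T \<Longrightarrow> complex_linear (S - T)"
  by (simp add: complex_linear_def blinfun.diff_left cscale_diff_right)

lemma complex_linear_scale: "complex_linear T \<Longrightarrow> complex_linear (c \<cdot>\<^sub>\<complex> T)"
  by (simp add: complex_linear_def op_scale_apply cscale_cscale mult.commute)

lemma complex_linear_compose: "complex_linear S \<Longrightarrow> complex_linear T \<Longrightarrow> complex_linear (S o\<^sub>L T)"
  by (simp add: complex_linear_def)

lemma complex_linear_zero [simp]: "complex_linear 0"
  by (simp add: complex_linear_def)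

lemma complex_linear_sum: "(\<And>i. i \<in> I \<Longrightarrow> complex_linear (T i)) \<Longrightarrow> complex_linear (\<Sum>i\<in>I. T i)"
  by (induction I rule: infinite_finite_induct) (auto intro: complex_linear_add)

lemma complex_linear_limit:
  assumes "T \<longlonglongrightarrow> S" "\<And>n. complex_linear (T n)"
  shows "complex_linear S"
  unfolding complex_linear_def
proof (intro allI)
  fix c x
  have "(\<lambda>n. blinfun_apply (T n) (c *\<^sub>\<complex> x)) \<longlonglongrightarrow> blinfun_apply S (c *\<^sub>\<complex> x)"
    by (intro tendsto_intros assms(1))
  moreover have "(\<lambda>n. c *\<^sub>\<complex> blinfun_apply (T n) x) \<longlonglongrightarrow> c *\<^sub>\<complex> blinfun_apply S x"
    by (intro bounded_linear.tendsto[OF bounded_linear_cscale] tendsto_intros assms(1))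
  ultimately show "blinfun_apply S (c *\<^sub>\<complex> x) = c *\<^sub>\<complex> blinfun_apply S x"
    using assms(2) by (auto simp: complex_linearD intro: LIMSEQ_unique)
qed

lemma op_scale_zero [simp]: "c \<cdot>\<^sub>\<complex> 0 = (0 :: 'a ell2_op)" "0 \<cdot>\<^sub>\<complex> T = (0 :: 'a ell2_op)"
  by (auto intro!: blinfun_eqI simp: op_scale_apply)

lemma op_scale_one [simp]: "1 \<cdot>\<^sub>\<complex> T = (T :: 'a ell2_op)"
  by (auto intro!: blinfun_eqI simp: op_scale_apply)

lemma op_scale_op_scale: "c \<cdot>\<^sub>\<complex> d \<cdot>\<^sub>\<complex> T = (c * d) \<cdot>\<^sub>\<complex> (T :: 'a ell2_op)"
  by (auto intro!: blinfun_eqI simp: op_scale_apply cscale_cscale)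

lemma op_scale_add_right: "c \<cdot>\<^sub>\<complex> (S + T) = c \<cdot>\<^sub>\<complex> S + c \<cdot>\<^sub>\<complex> (T :: 'a ell2_op)"
  by (auto intro!: blinfun_eqI simp: op_scale_apply blinfun.add_left cscale_add_right)

lemma op_scale_diff_right: "c \<cdot>\<^sub>\<complex> (S - T) = c \<cdot>\<^sub>\<complex> S - c \<cdot>\<^sub>\<complex> (T :: 'a ell2_op)"
  by (auto intro!: blinfun_eqI simp: op_scale_apply blinfun.diff_left cscale_diff_right)

lemma op_scale_add_left: "(c + d) \<cdot>\<^sub>\<complex> T = c \<cdot>\<^sub>\<complex> T + d \<cdot>\<^sub>\<complex> (T :: 'a ell2_op)"
  by (auto intro!: blinfun_eqI simp: op_scale_apply blinfun.add_left cscale_add_left)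

lemma op_scale_sum_right: "c \<cdot>\<^sub>\<complex> (\<Sum>i\<in>I. T i) = (\<Sum>i\<in>I. c \<cdot>\<^sub>\<complex> (T i :: 'a ell2_op))"
  by (induction I rule: infinite_finite_induct) (auto simp: op_scale_add_right)

lemma op_scale_of_real: "of_real r \<cdot>\<^sub>\<complex> T = r *\<^sub>R (T :: 'a ell2_op)"
  by (auto intro!: blinfun_eqI simp: op_scale_apply cscale_of_real blinfun.scaleR_left)

lemma op_scale_minus_one: "(-1) \<cdot>\<^sub>\<complex> T = - (T :: 'a ell2_op)"
  using op_scale_of_real[of "-1" T] by simp

lemma op_scale_compose_left: "(c \<cdot>\<^sub>\<complex> S) o\<^sub>L T = c \<cdot>\<^sub>\<complex> (S o\<^sub>L T)"
  by (auto intro!: blinfun_eqI simp: op_scale_apply)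

lemma op_scale_compose_right: "complex_linear S \<Longrightarrow> S o\<^sub>L (c \<cdot>\<^sub>\<complex> T) = c \<cdot>\<^sub>\<complex> (S o\<^sub>L T)"
  by (auto intro!: blinfun_eqI simp: op_scale_apply complex_linearD)

lemma norm_op_scale: "norm (c \<cdot>\<^sub>\<complex> T) = cmod c * norm (T :: 'a ell2_op)"
proof (rule antisym)
  show le: "norm (c \<cdot>\<^sub>\<complex> T) \<le> cmod c * norm T" for c and T :: "'a ell2_op"
    using norm_blinfun[of T] by (intro norm_blinfun_bound)
      (auto simp: op_scale_apply norm_cscale mult.assoc intro!: mult_left_mono)
  show "cmod c * norm T \<le> norm (c \<cdot>\<^sub>\<complex> T)"
  proof (cases "c = 0")
    case False
    then have "norm T \<le> cmod (inverse c) * norm (c \<cdot>\<^sub>\<complex> T)"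
      using le[of "inverse c" "c \<cdot>\<^sub>\<complex> T"] by (simp add: op_scale_op_scale)
    then have "cmod c * norm T \<le> cmod c * (inverse (cmod c) * norm (c \<cdot>\<^sub>\<complex> T))"
      by (intro mult_left_mono) (simp_all add: norm_inverse)
    then show ?thesis using False by (simp add: mult.assoc[symmetric])
  qed simp
qed

lemma bounded_linear_op_scale: "bounded_linear (\<lambda>T :: 'a ell2_op. c \<cdot>\<^sub>\<complex> T)"
  by (rule bounded_linear_intro[where K = "cmod c"])
    (auto simp: op_scale_add_right norm_op_scale op_scale_of_real[symmetric] op_scale_op_scale mult.commute)

lemmas tendsto_op_scale = bounded_linear.tendsto[OF bounded_linear_op_scale]

lemma compose_add_left: "(S + T) o\<^sub>L R = (S o\<^sub>L R) + (T o\<^sub>L R)"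
  by (auto intro!: blinfun_eqI simp: blinfun.add_left)

lemma compose_add_right: "R o\<^sub>L (S + T) = (R o\<^sub>L S) + (R o\<^sub>L T)"
  by (auto intro!: blinfun_eqI simp: blinfun.add_left blinfun.add_right)

lemma compose_diff_right: "R o\<^sub>L (S - T) = (R o\<^sub>L S) - (R o\<^sub>L T)"
  by (auto intro!: blinfun_eqI simp: blinfun.diff_left blinfun.diff_right)

lemma compose_zero [simp]: "(R :: 'a ell2_op) o\<^sub>L 0 = 0"
  by (auto intro!: blinfun_eqI)

lemma op_compose_assoc: "(R o\<^sub>L S) o\<^sub>L T = R o\<^sub>L (S o\<^sub>L (T :: 'a ell2_op))"
  by (auto intro!: blinfun_eqI)

lemma compose_sum_left: "(\<Sum>i\<in>I. T i) o\<^sub>L R = (\<Sum>i\<in>I. T i o\<^sub>L (R :: 'a ell2_op))"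
  by (induction I rule: infinite_finite_induct) (auto simp: compose_add_left)

lemma compose_sum_right: "R o\<^sub>L (\<Sum>i\<in>I. T i) = (\<Sum>i\<in>I. (R :: 'a ell2_op) o\<^sub>L T i)"
  by (induction I rule: infinite_finite_induct) (auto simp: compose_add_right)

lemma tendsto_compose:
  "(S \<longlongrightarrow> s) F \<Longrightarrow> (T \<longlongrightarrow> t) F \<Longrightarrow> ((\<lambda>n. S n o\<^sub>L (T n :: 'a ell2_op)) \<longlongrightarrow> s o\<^sub>L t) F"
  by (rule bounded_bilinear.tendsto[OF bounded_bilinear_blinfun_compose])

text \<open>
  Multiplying a fixed basis vector by the values of a functional turns it into an operator, and operators
  are determined by their values on the basis.
\<close>

lemma functional_eqI:
  fixes f g :: "'a ell2 \<Rightarrow> complex"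
  assumes "bounded_linear f" "bounded_linear g"
    and "\<And>c x. f (c *\<^sub>\<complex> x) = c * f x" "\<And>c x. g (c *\<^sub>\<complex> x) = c * g x"
    and "\<And>a. f (\<delta> a) = g (\<delta> a)"
  shows "f x = g x"
proof -
  define b :: "'a ell2" where "b = \<delta> undefined"
  have bl: "bounded_linear (\<lambda>x. h x *\<^sub>\<complex> b)" if "bounded_linear h" for h :: "'a ell2 \<Rightarrow> complex"
  proof (rule bounded_linear_compose[OF _ that], rule bounded_linear_intro[where K = "norm b"])
    show "(x + y) *\<^sub>\<complex> b = x *\<^sub>\<complex> b + y *\<^sub>\<complex> b" for x y by (rule cscale_add_left)
    show "(r *\<^sub>R x) *\<^sub>\<complex> b = r *\<^sub>R (x *\<^sub>\<complex> b)" for r x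
      by (simp add: scaleR_conv_of_real cscale_cscale[symmetric] cscale_of_real)
    show "norm (x *\<^sub>\<complex> b) \<le> norm x * norm b" for x by (simp add: norm_cscale)
  qed
  have "Blinfun (\<lambda>x. f x *\<^sub>\<complex> b) = Blinfun (\<lambda>x. g x *\<^sub>\<complex> b)"
    by (rule ell2_op_eqI) (simp_all add: complex_linear_def bounded_linear_Blinfun_apply bl assms cscale_cscale)
  then have "f x *\<^sub>\<complex> b = g x *\<^sub>\<complex> b"
    by (metis bounded_linear_Blinfun_apply bl assms(1,2))
  then have "Rep_ell2 (f x *\<^sub>\<complex> b) undefined = Rep_ell2 (g x *\<^sub>\<complex> b) undefined" by simp
  then show ?thesis by (simp add: cscale.rep_eq b_def ell2_basis.rep_eq)
qed

lemma bounded_linear_cinner_right: "bounded_linear (\<lambda>x. cinner y x)"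
  by (rule bounded_linear_intro[where K = "norm y"])
    (auto simp: cinner_add_right cscale_of_real[symmetric] cinner_scale_right scaleR_conv_of_real
       mult.commute[of "norm _" "norm y"] norm_cinner_le)

text \<open>
  The coordinates of \<open>T\<^sup>* y\<close> have to be \<open>\<langle>T \<delta>\<^sub>a, y\<rangle>\<close>. A finite piece \<open>v\<close> of this family satisfies
  \<open>\<parallel>v\<parallel>\<^sup>2 = \<langle>T v, y\<rangle> \<le> \<parallel>T\<parallel> \<parallel>v\<parallel> \<parallel>y\<parallel>\<close>, so the family is square-summable.
\<close>

lemma adjoint_exists:
  assumes T: "complex_linear T"
  obtains S where "\<And>x y. cinner (blinfun_apply T x) y = cinner x (blinfun_apply S y)"
proof -
  define s where "s y a = cinner (blinfun_apply T (\<delta> a)) y" for y a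
  have bnd: "(\<Sum>a\<in>F. (cmod (s y a))\<^sup>2) \<le> (norm T * norm y)\<^sup>2" if F: "finite F" for y F
  proof -
    define v where "v = (\<Sum>a\<in>F. s y a *\<^sub>\<complex> \<delta> a)"
    have Rv: "Rep_ell2 v a = (if a \<in> F then s y a else 0)" for a
      using F unfolding v_def by (induction F rule: finite_induct)
        (auto simp: zero_ell2.rep_eq plus_ell2.rep_eq cscale.rep_eq ell2_basis.rep_eq)
    have lin: "cinner z y = (\<Sum>a\<in>F. cnj (s y a) * cinner (Q (\<delta> a)) y)"
      if "z = (\<Sum>a\<in>F. s y a *\<^sub>\<complex> Q (\<delta> a))" for z and Q :: "'a ell2 \<Rightarrow> 'a ell2"
      unfolding that using F by (induction F rule: finite_induct)
        (auto simp: cinner_add_left cinner_scale_left)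
    have "cinner (blinfun_apply T v) y = (\<Sum>a\<in>F. cnj (s y a) * s y a)"
      unfolding s_def[of y, abs_def]
      by (subst lin[of _ "blinfun_apply T"])
        (simp_all add: v_def blinfun.sum_right complex_linearD[OF T] s_def)
    also have "\<dots> = of_real (\<Sum>a\<in>F. (cmod (s y a))\<^sup>2)"
      unfolding of_real_sum by (intro sum.cong refl) (metis complex_norm_square mult.commute)
    finally have 1: "(\<Sum>a\<in>F. (cmod (s y a))\<^sup>2) = cmod (cinner (blinfun_apply T v) y)"
      by (simp only: norm_of_real) (simp add: sum_nonneg)
    have "(norm v)\<^sup>2 = (\<Sum>\<^sub>\<infinity>a\<in>F. (cmod (s y a))\<^sup>2)"
      unfolding norm_ell2_sq by (rule infsum_cong_neutral) (auto simp: Rv)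
    then have 2: "(norm v)\<^sup>2 = (\<Sum>a\<in>F. (cmod (s y a))\<^sup>2)" using F by simp
    have "(norm v)\<^sup>2 \<le> norm T * norm v * norm y"
      unfolding 2 1 using norm_cinner_le[of "blinfun_apply T v" y] norm_blinfun[of T v]
      by (meson mult_right_mono norm_ge_zero order_trans)
    then have "norm v \<le> norm T * norm y"
      by (cases "norm v = 0") (auto simp: power2_eq_square algebra_simps)
    then show ?thesis unfolding 2[symmetric] by (intro power_mono) auto
  qed
  have summ: "(\<lambda>a. (cmod (s y a))\<^sup>2) summable_on UNIV" for y
    by (rule nonneg_bdd_above_summable_on) (auto intro!: bdd_aboveI2[where M = "(norm T * norm y)\<^sup>2"] bnd)
  define S where "S y = Abs_ell2 (s y)" for y
  have RS: "Rep_ell2 (S y) = s y" for y using summ by (simp add: S_def Abs_ell2_inverse)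
  have "bounded_linear S"
  proof (rule bounded_linear_intro)
    show "S (x + y) = S x + S y" for x y
      by (rule ell2_eqI) (simp add: RS plus_ell2.rep_eq s_def cinner_add_right)
    show "S (r *\<^sub>R x) = r *\<^sub>R S x" for r x
      by (rule ell2_eqI) (simp add: RS scaleR_ell2.rep_eq s_def cscale_of_real[symmetric] cinner_scale_right cscale.rep_eq)
    show "norm (S x) \<le> norm x * norm T" for x
      using bnd[of _ x] by (intro norm_ell2_le) (auto simp: RS mult.commute)
  qed
  then have app: "blinfun_apply (Blinfun S) = S" by (rule bounded_linear_Blinfun_apply)
  have "cinner y (blinfun_apply T x) = cinner (S y) x" for x y
  proof (rule functional_eqI[of "\<lambda>x. cinner y (blinfun_apply T x)"])
    show "bounded_linear (\<lambda>x. cinner y (blinfun_apply T x))"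
      by (rule bounded_linear_compose[OF bounded_linear_cinner_right blinfun.bounded_linear_right])
    show "cinner y (blinfun_apply T (\<delta> a)) = cinner (S y) (\<delta> a)" for a
      by (simp add: cinner_basis_right RS s_def) (rule cinner_commute)
  qed (simp_all add: bounded_linear_cinner_right complex_linearD[OF T] cinner_scale_right)
  then have "cinner (blinfun_apply T x) y = cinner x (blinfun_apply (Blinfun S) y)" for x y
    unfolding app by (metis cinner_commute)
  then show ?thesis by (rule that)
qed

text \<open>
  Adjoints are unique, so the description operator in the definition of \<^const>\<open>op_adj\<close> picks the
  operator obtained above.
\<close>

lemma op_adj_eqI:
  assumes "\<And>x y. cinner (blinfun_apply T x) y = cinner x (blinfun_apply S y)"
  shows "op_adj T = S"
  unfolding op_adj_def
proof (rule the_equality)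
  fix R assume "\<forall>x y. cinner (blinfun_apply T x) y = cinner x (blinfun_apply R y)"
  then show "R = S" using assms by (intro blinfun_eqI cinner_ext) metis
qed (simp add: assms)

lemma cinner_op_adj:
  assumes "complex_linear T"
  shows "cinner (blinfun_apply T x) y = cinner x (blinfun_apply (op_adj T) y)"
proof -
  obtain S where S: "\<And>x y. cinner (blinfun_apply T x) y = cinner x (blinfun_apply S y)"
    using adjoint_exists[OF assms] by blast
  then show ?thesis by (simp add: op_adj_eqI[OF S])
qed

lemma cinner_op_adj':
  "complex_linear T \<Longrightarrow> cinner (blinfun_apply (op_adj T) x) y = cinner x (blinfun_apply T y)"
  by (metis cinner_commute cinner_op_adj)

lemma complex_linear_op_adj: "complex_linear T \<Longrightarrow> complex_linear (op_adj T)"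
  unfolding complex_linear_def[of "op_adj T"]
  by (auto intro!: cinner_ext simp: cinner_op_adj[symmetric] cinner_scale_right)

lemma op_adj_op_adj: "complex_linear T \<Longrightarrow> op_adj (op_adj T) = T"
  by (rule op_adj_eqI) (rule cinner_op_adj')

lemma op_adj_add: "complex_linear S \<Longrightarrow> complex_linear T \<Longrightarrow> op_adj (S + T) = op_adj S + op_adj T"
  by (rule op_adj_eqI) (simp add: blinfun.add_left cinner_add_left cinner_add_right cinner_op_adj)

lemma op_adj_diff: "complex_linear S \<Longrightarrow> complex_linear T \<Longrightarrow> op_adj (S - T) = op_adj S - op_adj T"
  by (rule op_adj_eqI) (simp add: blinfun.diff_left cinner_diff_left cinner_diff_right cinner_op_adj)

lemma op_adj_scale: "complex_linear T \<Longrightarrow> op_adj (c \<cdot>\<^sub>\<complex> T) = cnj c \<cdot>\<^sub>\<complex> op_adj T"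
  by (rule op_adj_eqI) (simp add: op_scale_apply cinner_scale_left cinner_scale_right cinner_op_adj)

lemma op_adj_compose:
  "complex_linear S \<Longrightarrow> complex_linear T \<Longrightarrow> op_adj (S o\<^sub>L T) = op_adj T o\<^sub>L op_adj S"
  by (rule op_adj_eqI) (simp add: cinner_op_adj)

lemma op_adj_zero [simp]: "op_adj 0 = 0"
  by (rule op_adj_eqI) simp

lemma op_adj_sum:
  "(\<And>i. i \<in> I \<Longrightarrow> complex_linear (T i)) \<Longrightarrow> op_adj (\<Sum>i\<in>I. T i) = (\<Sum>i\<in>I. op_adj (T i))"
  by (induction I rule: infinite_finite_induct) (auto simp: op_adj_add complex_linear_sum)

lemma norm_le_if_square_le:
  fixes T :: "'a ell2_op"
  assumes "\<And>x. (norm (blinfun_apply T x))\<^sup>2 \<le> B * norm (blinfun_apply T x) * norm x" "B \<ge> 0"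
  shows "norm T \<le> B"
proof (rule norm_blinfun_bound[OF assms(2)])
  fix x show "norm (blinfun_apply T x) \<le> B * norm x"
    using assms(1)[of x] assms(2)
    by (cases "norm (blinfun_apply T x) = 0") (auto simp: power2_eq_square algebra_simps)
qed

lemma norm_op_adj:
  assumes T: "complex_linear T"
  shows "norm (op_adj T) = norm T"
proof -
  have le: "norm (op_adj R) \<le> norm R" if R: "complex_linear R" for R :: "'a ell2_op"
  proof (rule norm_le_if_square_le)
    fix x
    let ?y = "blinfun_apply (op_adj R) x"
    have "(norm ?y)\<^sup>2 = cmod (cinner ?y ?y)" by (simp add: cmod_cinner_self)
    also have "\<dots> = cmod (cinner x (blinfun_apply R ?y))" by (simp add: cinner_op_adj'[OF R])
    also have "\<dots> \<le> norm x * norm (blinfun_apply R ?y)" by (rule norm_cinner_le)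
    also have "\<dots> \<le> norm x * (norm R * norm ?y)" by (intro mult_left_mono norm_blinfun) simp
    finally show "(norm ?y)\<^sup>2 \<le> norm R * norm ?y * norm x" by (simp add: algebra_simps)
  qed simp
  show ?thesis
    using le[OF T] le[OF complex_linear_op_adj[OF T]] by (simp add: op_adj_op_adj[OF T])
qed

lemma norm_op_adj_compose:
  assumes T: "complex_linear T"
  shows "norm (op_adj T o\<^sub>L T) = (norm T)\<^sup>2"
proof (rule antisym)
  show "norm (op_adj T o\<^sub>L T) \<le> (norm T)\<^sup>2"
    using norm_blinfun_compose[of "op_adj T" T] by (simp add: norm_op_adj[OF T] power2_eq_square)
  have "norm T \<le> sqrt (norm (op_adj T o\<^sub>L T))"
  proof (rule norm_blinfun_bound)
    fix x
    have "(norm (blinfun_apply T x))\<^sup>2 = cmod (cinner (blinfun_apply T x) (blinfun_apply T x))"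
      by (simp add: cmod_cinner_self)
    also have "\<dots> = cmod (cinner x (blinfun_apply (op_adj T o\<^sub>L T) x))"
      by (simp add: cinner_op_adj[OF T])
    also have "\<dots> \<le> norm x * norm (blinfun_apply (op_adj T o\<^sub>L T) x)" by (rule norm_cinner_le)
    also have "\<dots> \<le> norm x * (norm (op_adj T o\<^sub>L T) * norm x)"
      by (intro mult_left_mono norm_blinfun) simp
    also have "\<dots> = (sqrt (norm (op_adj T o\<^sub>L T)) * norm x)\<^sup>2"
      by (simp add: power_mult_distrib power2_eq_square)
    finally show "norm (blinfun_apply T x) \<le> sqrt (norm (op_adj T o\<^sub>L T)) * norm x"
      by (rule power2_le_imp_le) simp
  qed simp
  then show "(norm T)\<^sup>2 \<le> norm (op_adj T o\<^sub>L T)"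
    using real_sqrt_le_iff by (metis norm_ge_zero power_mono real_sqrt_pow2)
qed

lemma tendsto_op_adj:
  assumes "T \<longlonglongrightarrow> S" "\<And>n. complex_linear (T n)"
  shows "(\<lambda>n. op_adj (T n)) \<longlonglongrightarrow> op_adj S"
proof -
  have S: "complex_linear S" by (rule complex_linear_limit[OF assms])
  have "norm (op_adj (T n) - op_adj S) = norm (T n - S)" for n
    by (metis S assms(2) complex_linear_diff norm_op_adj op_adj_diff)
  then show ?thesis using assms(1) by (simp add: tendsto_iff dist_norm)
qed

section \<open>Operators of injective partial maps\<close>

definition partial_inj :: "('a \<rightharpoonup> 'a) \<Rightarrow> bool"
  where "partial_inj f \<longleftrightarrow> (\<forall>a b c. f a = Some c \<longrightarrow> f b = Some c \<longrightarrow> a = b)"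

definition pm_op :: "('a \<rightharpoonup> 'a) \<Rightarrow> 'a ell2_op"
  where "pm_op f = op_on (dom f) (the \<circ> f)"

lemma pm_op:
  assumes "partial_inj f"
  shows complex_linear_pm_op: "complex_linear (pm_op f)"
    and pm_op_basis: "blinfun_apply (pm_op f) (\<delta> v) = (case f v of None \<Rightarrow> 0 | Some u \<Rightarrow> \<delta> u)"
proof -
  have inj: "inj_on (the \<circ> f) (dom f)"
    using assms by (auto simp: inj_on_def partial_inj_def)
  show "complex_linear (pm_op f)" unfolding pm_op_def by (rule op_on(1)[OF inj])
  show "blinfun_apply (pm_op f) (\<delta> v) = (case f v of None \<Rightarrow> 0 | Some u \<Rightarrow> \<delta> u)"
    unfolding pm_op_def op_on(2)[OF inj] by (auto split: option.split)
qed

lemma partial_inj_comp: "partial_inj f \<Longrightarrow> partial_inj g \<Longrightarrow> partial_inj (f \<circ>\<^sub>m g)"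
  unfolding partial_inj_def map_comp_Some_iff by metis

lemma pm_op_comp:
  assumes "partial_inj f" "partial_inj g"
  shows "pm_op f o\<^sub>L pm_op g = pm_op (f \<circ>\<^sub>m g)"
proof (rule ell2_op_eqI)
  fix v
  show "blinfun_apply (pm_op f o\<^sub>L pm_op g) (\<delta> v) = blinfun_apply (pm_op (f \<circ>\<^sub>m g)) (\<delta> v)"
    by (cases "g v") (simp_all add: pm_op_basis assms partial_inj_comp)
qed (auto intro: complex_linear_compose complex_linear_pm_op partial_inj_comp assms)

lemma pm_op_adj:
  assumes f: "partial_inj f" and fg: "\<And>a b. f a = Some b \<longleftrightarrow> g b = Some a"
  shows "op_adj (pm_op f) = pm_op g"
proof (rule ell2_op_eqI)
  have g: "partial_inj g" using fg unfolding partial_inj_def by (metis option.inject)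
  note f' = complex_linear_pm_op[OF f]
  show "complex_linear (op_adj (pm_op f))" "complex_linear (pm_op g)"
    by (auto intro: complex_linear_op_adj complex_linear_pm_op f g)
  fix v
  show "blinfun_apply (op_adj (pm_op f)) (\<delta> v) = blinfun_apply (pm_op g) (\<delta> v)"
  proof (rule ell2_eqI)
    fix a
    have "Rep_ell2 (blinfun_apply (op_adj (pm_op f)) (\<delta> v)) a = cinner (blinfun_apply (pm_op f) (\<delta> a)) (\<delta> v)"
      by (simp add: cinner_op_adj[OF f'] cinner_basis_left)
    also have "\<dots> = (if f a = Some v then 1 else 0)"
      by (auto simp: pm_op_basis[OF f] cinner_basis_left ell2_basis.rep_eq split: option.split)
    also have "\<dots> = Rep_ell2 (blinfun_apply (pm_op g) (\<delta> v)) a"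
      by (auto simp: pm_op_basis[OF g] fg ell2_basis.rep_eq zero_ell2.rep_eq split: option.split)
    finally show "Rep_ell2 (blinfun_apply (op_adj (pm_op f)) (\<delta> v)) a =
      Rep_ell2 (blinfun_apply (pm_op g) (\<delta> v)) a" .
  qed
qed

lemma pm_op_empty: "pm_op Map.empty = 0"
proof -
  have "partial_inj Map.empty" by (simp add: partial_inj_def)
  from complex_linear_pm_op[OF this] pm_op_basis[OF this] show ?thesis
    by (intro ell2_op_eqI) simp_all
qed

text \<open>
  With \<open>T\<close> the operator of \<open>f\<close>, the product \<open>T\<^sup>* T\<close> is the projection onto the basis vectors in the domain
  of \<open>f\<close>, so its norm equals its own square and the C*-identity gives the bound.
\<close>

lemma norm_pm_op_le:
  assumes f: "partial_inj f"
  shows "norm (pm_op f) \<le> 1"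
proof -
  define g where "g b = (if \<exists>a. f a = Some b then Some (SOME a. f a = Some b) else None)" for b
  have fg: "f a = Some b \<longleftrightarrow> g b = Some a" for a b
  proof
    assume ab: "f a = Some b"
    then have "f (SOME a. f a = Some b) = Some b" by (rule someI)
    then show "g b = Some a" using ab f by (auto simp: g_def partial_inj_def)
  next
    assume "g b = Some a"
    then show "f a = Some b" by (auto simp: g_def split: if_splits intro: someI)
  qed
  have g: "partial_inj g" using fg unfolding partial_inj_def by (metis option.inject)
  define p where "p = g \<circ>\<^sub>m f"
  have p: "partial_inj p" unfolding p_def by (rule partial_inj_comp[OF g f])
  have pS: "p a = Some b \<longleftrightarrow> a = b \<and> f a \<noteq> None" for a b
    unfolding p_def map_comp_Some_iff by (metis fg not_Some_eq option.inject)
  have fP: "op_adj (pm_op f) o\<^sub>L pm_op f = pm_op p"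
    by (simp add: pm_op_adj[OF f fg] pm_op_comp[OF g f] p_def)
  have "op_adj (pm_op p) = pm_op p" by (rule pm_op_adj[OF p]) (auto simp: pS)
  moreover have "p \<circ>\<^sub>m p = p"
  proof
    fix a show "(p \<circ>\<^sub>m p) a = p a" using pS[of a "the (p a)"] by (cases "p a") auto
  qed
  ultimately have "(norm (pm_op p))\<^sup>2 = norm (pm_op p)"
    using norm_op_adj_compose[OF complex_linear_pm_op[OF p]] by (simp add: pm_op_comp[OF p p])
  then have "norm (pm_op p) \<le> 1" by (auto simp: power2_eq_square)
  then have "(norm (pm_op f))\<^sup>2 \<le> 1\<^sup>2"
    using norm_op_adj_compose[OF complex_linear_pm_op[OF f]] by (simp add: fP)
  then show ?thesis by (rule power2_le_imp_le) simp
qed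

section \<open>Diagonal unitaries\<close>

text \<open>
  Phases are given by real angles, so that every function defines a unitary and inversion is
  negation of the angle.
\<close>

definition phase_op :: "('a \<Rightarrow> real) \<Rightarrow> 'a ell2_op"
  where "phase_op r = Blinfun (\<lambda>x. Abs_ell2 (\<lambda>a. cis (r a) * Rep_ell2 x a))"

lemma Rep_phase_op: "Rep_ell2 (blinfun_apply (phase_op r) x) a = cis (r a) * Rep_ell2 x a"
proof -
  define T where "T x = Abs_ell2 (\<lambda>a. cis (r a) * Rep_ell2 x a)" for x :: "'a ell2"
  have RT: "Rep_ell2 (T x) = (\<lambda>a. cis (r a) * Rep_ell2 x a)" for x
    unfolding T_def using Rep_ell2[of x] by (intro Abs_ell2_inverse) (simp add: norm_mult)
  have "norm (T x) = norm x" for x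
    by (rule power2_eq_imp_eq) (simp_all add: norm_ell2_sq RT norm_mult)
  then have "bounded_linear T"
    by (intro bounded_linear_intro[where K = 1])
      (auto intro!: ell2_eqI simp: RT plus_ell2.rep_eq scaleR_ell2.rep_eq algebra_simps)
  then have "blinfun_apply (phase_op r) = T"
    unfolding phase_op_def T_def by (rule bounded_linear_Blinfun_apply)
  then show ?thesis by (simp add: RT)
qed

lemma complex_linear_phase_op: "complex_linear (phase_op r)"
  unfolding complex_linear_def by (auto intro!: ell2_eqI simp: Rep_phase_op cscale.rep_eq)

lemma norm_phase_op_apply: "norm (blinfun_apply (phase_op r) x) = norm x"
  by (rule power2_eq_imp_eq) (simp_all add: norm_ell2_sq Rep_phase_op norm_mult)

lemma phase_op_basis: "blinfun_apply (phase_op r) (\<delta> a) = cis (r a) *\<^sub>\<complex> \<delta> a"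
  by (rule ell2_eqI) (auto simp: Rep_phase_op ell2_basis.rep_eq cscale.rep_eq)

lemma phase_op_inverse: "blinfun_apply (phase_op (\<lambda>a. - r a)) (blinfun_apply (phase_op r) x) = x"
  by (rule ell2_eqI) (simp add: Rep_phase_op mult.assoc[symmetric] cis_mult)

lemma op_adj_phase_op: "op_adj (phase_op r) = phase_op (\<lambda>a. - r a)"
proof (rule op_adj_eqI)
  fix x y
  have "cnj (cis (r a) * u) * v = cnj u * (cis (- r a) * v)" for a u v
    by (simp add: cis_cnj)
  then show "cinner (blinfun_apply (phase_op r) x) y = cinner x (blinfun_apply (phase_op (\<lambda>a. - r a)) y)"
    by (simp only: cinner.rep_eq Rep_phase_op)
qed

definition phase_conj :: "('a \<Rightarrow> real) \<Rightarrow> 'a ell2_op \<Rightarrow> 'a ell2_op"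
  where "phase_conj r T = phase_op r o\<^sub>L T o\<^sub>L phase_op (\<lambda>a. - r a)"

lemma phase_conj_inverse: "phase_conj (\<lambda>a. - r a) (phase_conj r T) = T"
  using phase_op_inverse[of r] by (auto intro!: blinfun_eqI simp: phase_conj_def)

lemma phase_conj_compose: "phase_conj r (S o\<^sub>L T) = phase_conj r S o\<^sub>L phase_conj r T"
  using phase_op_inverse[of r] by (auto intro!: blinfun_eqI simp: phase_conj_def)

lemma phase_conj_add: "phase_conj r (S + T) = phase_conj r S + phase_conj r T"
  by (simp add: phase_conj_def compose_add_left compose_add_right)

lemma phase_conj_scale: "phase_conj r (c \<cdot>\<^sub>\<complex> T) = c \<cdot>\<^sub>\<complex> phase_conj r T"
  by (simp add: phase_conj_def op_scale_compose_left op_scale_compose_right complex_linear_phase_op)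

lemma phase_conj_adj: "complex_linear T \<Longrightarrow> phase_conj r (op_adj T) = op_adj (phase_conj r T)"
  by (simp add: phase_conj_def op_adj_compose complex_linear_compose complex_linear_phase_op
      op_adj_phase_op op_compose_assoc)

lemma norm_phase_conj: "norm (phase_conj r T) = norm T"
proof -
  have le: "norm (phase_conj r T) \<le> norm T" for r :: "'a \<Rightarrow> real" and T
  proof (rule norm_blinfun_bound)
    show "norm (blinfun_apply (phase_conj r T) x) \<le> norm T * norm x" for x
      using norm_blinfun[of T "blinfun_apply (phase_op (\<lambda>a. - r a)) x"]
      by (simp add: phase_conj_def norm_phase_op_apply)
  qed simp
  show ?thesis using le[of r T] le[of "\<lambda>a. - r a" "phase_conj r T"] by (simp add: phase_conj_inverse)
qed

lemma tendsto_phase_conj: "(S \<longlongrightarrow> s) F \<Longrightarrow> ((\<lambda>n. phase_conj r (S n)) \<longlongrightarrow> phase_conj r s) F"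
  unfolding phase_conj_def by (intro tendsto_compose tendsto_const)


section \<open>Prefixes of infinite words\<close>

text \<open>
  Words are compared through \<open>prefix\<close>, \<open>suffix\<close> and \<open>\<frown>\<close>; the rewrite rules that replace
  these by other operations are switched off.
\<close>

declare build_cons [simp del] build_append [simp del] subsequence_shift [simp del]

lemma prefix_eq_iff: "prefix n a = prefix n b \<longleftrightarrow> (\<forall>i<n. a i = b i)"
  by (auto simp: subsequence_def)

lemma length_prefix [simp]: "length (prefix n a) = n"
  by (simp add: subsequence_def)

lemma prefix_conc [simp]: "length u = n \<Longrightarrow> prefix n (u \<frown> a) = u"
  by (auto simp: subsequence_def intro: nth_equalityI)

lemma suffix_conc [simp]: "length u = n \<Longrightarrow> suffix n (u \<frown> a) = a"
  by (rule ext) simp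

lemma conc_eq_conc_iff: "length u = length v \<Longrightarrow> u \<frown> a = v \<frown> b \<longleftrightarrow> u = v \<and> a = b"
  by (metis prefix_conc suffix_conc)

lemma prefix_conc_suffix: "prefix n a \<frown> suffix n a = a"
  by (rule ext) (simp add: conc_def subsequence_def)

lemma hd_conc_suffix: "[a 0] \<frown> suffix (Suc 0) a = a"
  by (rule ext) (simp add: conc_def)

lemma prefix_add_eq_iff: 
  "prefix (m + n) a = prefix (m + n) b \<longleftrightarrow>
    prefix m a = prefix m b \<and> prefix n (suffix m a) = prefix n (suffix m b)"
proof -
  have "(\<forall>i<m + n. P i) \<longleftrightarrow> (\<forall>i<m. P i) \<and> (\<forall>i<n. P (m + i))" for P
  proof (intro iffI allI impI)
    fix i assume P: "(\<forall>i<m. P i) \<and> (\<forall>i<n. P (m + i))" and i: "i < m + n"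
    show "P i"
    proof (cases "i < m")
      case False
      then obtain j where "i = m + j" using le_Suc_ex linorder_not_less by blast
      then show ?thesis using P i by simp
    qed (use P in simp)
  qed auto
  then show ?thesis unfolding prefix_eq_iff suffix_nth .
qed

lemma prefix_mono: "m \<le> n \<Longrightarrow> prefix n a = prefix n b \<Longrightarrow> prefix m a = prefix m b"
  by (auto simp: prefix_eq_iff)

lemma option_eqI: "(\<And>a. x = Some a \<longleftrightarrow> y = Some a) \<Longrightarrow> x = y"
  by (metis option.exhaust)

lemma T_star_Some_iff: "T_star u a = Some b \<longleftrightarrow> a = u \<frown> b"
proof -
  have "inj (conc u)" by (rule injI) simp
  then show ?thesis by (auto simp: T_star_def inv_into_f_f f_inv_into_f)
qed

lemma T_star_conc [simp]: "T_star u (u \<frown> a) = Some a"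
  by (simp add: T_star_Some_iff)

lemma T_star_Nil [simp]: "T_star [] a = Some a"
  by (simp add: T_star_Some_iff)

lemma openin_word_topologyD:
  assumes "openin word_topology U" "a \<in> U"
  obtains n where "\<And>b. prefix n b = prefix n a \<Longrightarrow> b \<in> U"
proof -
  from assms obtain V where V: "finite {i. V i \<noteq> UNIV}" "\<And>i. a i \<in> V i" "Pi\<^sub>E UNIV V \<subseteq> U"
    unfolding word_topology_def openin_product_topology_alt by (auto simp: PiE_iff)
  obtain n where n: "\<And>i. V i \<noteq> UNIV \<Longrightarrow> i < n"
    using V(1) finite_nat_set_iff_bounded by auto
  have "b \<in> U" if "prefix n b = prefix n a" for b
  proof -
    have "b i \<in> V i" for i using that V(2)[of i] n[of i] by (cases "V i = UNIV") (auto simp: prefix_eq_iff)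
    then show ?thesis using V(3) by (auto simp: PiE_iff)
  qed
  then show ?thesis by (rule that)
qed

section \<open>Self-similar actions\<close>

locale self_similar =
  fixes G :: "('g, 'b) monoid_scheme" and \<phi> :: "'g \<Rightarrow> ('x::finite) word \<Rightarrow> 'x word"
  assumes self_similar: "self_similar_action G \<phi>"
begin

lemma group_action: "group_action G UNIV \<phi>"
  using self_similar by (auto simp: self_similar_action_def faithful_action_def)

sublocale group G
  using group_action by (auto simp: group_action_def group_hom_def)

lemma act_mult: "g \<in> carrier G \<Longrightarrow> h \<in> carrier G \<Longrightarrow> \<phi> (g \<otimes>\<^bsub>G\<^esub> h) a = \<phi> g (\<phi> h a)"
  using group_action.composition_rule[OF group_action] by simp

lemma act_one [simp]: "\<phi> \<one>\<^bsub>G\<^esub> a = a"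
  using group_action.id_eq_one[OF group_action] by (metis UNIV_I restrict_apply')

lemma act_inv [simp]:
  "g \<in> carrier G \<Longrightarrow> \<phi> g (\<phi> (inv\<^bsub>G\<^esub> g) a) = a"
  "g \<in> carrier G \<Longrightarrow> \<phi> (inv\<^bsub>G\<^esub> g) (\<phi> g a) = a"
  by (simp_all add: act_mult[symmetric])

lemma act_inject: "g \<in> carrier G \<Longrightarrow> \<phi> g a = \<phi> g b \<longleftrightarrow> a = b"
  by (metis act_inv(2))

lemma self_similar_letter:
  assumes "g \<in> carrier G"
  obtains h v where "h \<in> carrier G" "\<And>a. \<phi> g ([x] \<frown> a) = [v] \<frown> \<phi> h a"
  using self_similar assms unfolding self_similar_action_def by metis

lemma self_similar_word:
  assumes "g \<in> carrier G"
  obtains h v where "h \<in> carrier G" "length v = length u" "\<And>a. \<phi> g (u \<frown> a) = v \<frown> \<phi> h a"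
  using assms
proof (induction u arbitrary: g thesis)
  case Nil
  show ?case by (rule Nil(1)[of g "[]"]) (simp_all add: Nil)
next
  case (Cons x u)
  obtain h v where h: "h \<in> carrier G" "\<And>a. \<phi> g ([x] \<frown> a) = [v] \<frown> \<phi> h a"
    using self_similar_letter[OF Cons.prems(2)] by blast
  obtain k v' where k: "k \<in> carrier G" "length v' = length u" "\<And>a. \<phi> h (u \<frown> a) = v' \<frown> \<phi> k a"
    using Cons.IH[OF _ h(1)] by blast
  show ?case
  proof (rule Cons.prems(1)[of k "v # v'"])
    fix a
    have "\<phi> g ((x # u) \<frown> a) = \<phi> g ([x] \<frown> u \<frown> a)" by simp
    also have "\<dots> = [v] \<frown> v' \<frown> \<phi> k a" unfolding h(2) k(3) ..
    finally show "\<phi> g ((x # u) \<frown> a) = (v # v') \<frown> \<phi> k a" by simp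
  qed (use k in simp_all)
qed

text \<open>
  A self-similar action acts by isometries of \<open>X\<^sup>\<omega>\<close>: the first place at which two words differ is
  preserved.
\<close>

lemma prefix_act_eq_iff:
  assumes g: "g \<in> carrier G"
  shows "prefix n (\<phi> g a) = prefix n (\<phi> g b) \<longleftrightarrow> prefix n a = prefix n b"
proof -
  have imp: "prefix n (\<phi> h a) = prefix n (\<phi> h b)"
    if eq: "prefix n a = prefix n b" and h: "h \<in> carrier G" for h a b
  proof -
    obtain k v where kv: "length v = n" "\<And>c. \<phi> h (prefix n a \<frown> c) = v \<frown> \<phi> k c"
      using self_similar_word[OF h, of "prefix n a"] unfolding length_prefix by blast
    then have "\<phi> h a = v \<frown> \<phi> k (suffix n a)" "\<phi> h b = v \<frown> \<phi> k (suffix n b)"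
      by (metis eq prefix_conc_suffix)+
    then show ?thesis using kv(1) by simp
  qed
  show ?thesis using imp[of a b g] imp[of "\<phi> g a" "\<phi> g b" "inv\<^bsub>G\<^esub> g"] g by auto
qed

end

section \<open>The orbit and its partial maps\<close>

locale orbit_representation = self_similar G \<phi>
  for G :: "('g, 'b) monoid_scheme" and \<phi> :: "'g \<Rightarrow> ('x::finite) word \<Rightarrow> 'x word" +
  fixes w :: "'x word"
begin

abbreviation orb :: "'x word set" (\<open>\<O>\<close>)
  where "\<O> \<equiv> partial_orbit G \<phi> w"

abbreviation word_op :: "('g, 'x) letter list \<Rightarrow> 'x word ell2_op" (\<open>\<W>\<close>)
  where "\<W> \<equiv> rep_word G \<phi> w"

abbreviation poly_op :: "('g, 'x) free_poly \<Rightarrow> 'x word ell2_op" (\<open>\<R>\<close>)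
  where "\<R> \<equiv> rep_poly G \<phi> w"

abbreviation reduced_algebra :: "'x word ell2_op set" (\<open>\<B>\<close>)
  where "\<B> \<equiv> O_min G \<phi> w"

abbreviation universal_norm :: "('g, 'x) free_poly \<Rightarrow> real" (\<open>\<N>\<close>)
  where "\<N> \<equiv> max_norm G \<phi>"

lemma orbit_iff:
  "v \<in> \<O> \<longleftrightarrow> (\<exists>u\<^sub>1 g u\<^sub>2 z. g \<in> carrier G \<and> w = u\<^sub>2 \<frown> z \<and> v = u\<^sub>1 \<frown> \<phi> g z)"
proof -
  have "v \<in> \<O> \<longleftrightarrow> (\<exists>u\<^sub>1 g u\<^sub>2. g \<in> carrier G \<and> map_option (\<lambda>v. u\<^sub>1 \<frown> \<phi> g v) (T_star u\<^sub>2 w) = Some v)"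
    (is "_ \<longleftrightarrow> (\<exists>u\<^sub>1 g u\<^sub>2. ?P u\<^sub>1 g u\<^sub>2)")
  proof
    assume "v \<in> \<O>"
    then obtain f where "f \<in> partial_maps G \<phi>" "f w = Some v" by (auto simp: partial_orbit_def)
    then show "\<exists>u\<^sub>1 g u\<^sub>2. ?P u\<^sub>1 g u\<^sub>2" unfolding partial_maps_def by clarify blast
  next
    assume "\<exists>u\<^sub>1 g u\<^sub>2. ?P u\<^sub>1 g u\<^sub>2"
    then obtain u\<^sub>1 g u\<^sub>2 where P: "?P u\<^sub>1 g u\<^sub>2" by blast
    then have "(\<lambda>a. map_option (\<lambda>v. u\<^sub>1 \<frown> \<phi> g v) (T_star u\<^sub>2 a)) \<in> partial_maps G \<phi>"
      unfolding partial_maps_def by blast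
    then show "v \<in> \<O>" unfolding partial_orbit_def mem_Collect_eq
      by (rule bexI[rotated]) (use P in simp)
  qed
  moreover have "map_option (\<lambda>v. u\<^sub>1 \<frown> \<phi> g v) (T_star u\<^sub>2 w) = Some v \<longleftrightarrow>
      (\<exists>z. w = u\<^sub>2 \<frown> z \<and> v = u\<^sub>1 \<frown> \<phi> g z)" for u\<^sub>1 g u\<^sub>2
    unfolding map_option_eq_Some T_star_Some_iff by metis
  ultimately show ?thesis by simp
qed

lemma point_in_orbit: "w \<in> \<O>"
  unfolding orbit_iff
  by (intro exI[of _ "[]"] exI[of _ "\<one>\<^bsub>G\<^esub>"] exI[of _ w]) simp

lemma conc_in_orbit: "v \<in> \<O> \<Longrightarrow> u \<frown> v \<in> \<O>"
  unfolding orbit_iff by (elim exE conjE, intro exI conjI, assumption, assumption) (simp add: conc_conc)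

lemma act_in_orbit:
  assumes "v \<in> \<O>" "g \<in> carrier G"
  shows "\<phi> g v \<in> \<O>"
proof -
  obtain u\<^sub>1 h u\<^sub>2 z where h: "h \<in> carrier G" "w = u\<^sub>2 \<frown> z" "v = u\<^sub>1 \<frown> \<phi> h z"
    using assms(1) by (auto simp: orbit_iff)
  obtain k v' where k: "k \<in> carrier G" "\<And>a. \<phi> g (u\<^sub>1 \<frown> a) = v' \<frown> \<phi> k a"
    using self_similar_word[OF assms(2), of u\<^sub>1] by metis
  have "\<phi> g v = v' \<frown> \<phi> (k \<otimes>\<^bsub>G\<^esub> h) z" using h k by (simp add: act_mult)
  then show ?thesis unfolding orbit_iff using h k by blast
qed

text \<open>
  When the point is \<open>g(z)\<close> without a prefix, deleting its first letter amounts to deleting the first letter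
  of \<open>z\<close> and replacing \<open>g\<close> by its section there.
\<close>

lemma suffix_in_orbit:
  assumes "v \<in> \<O>"
  shows "suffix (Suc 0) v \<in> \<O>"
proof -
  obtain u\<^sub>1 g u\<^sub>2 z where g: "g \<in> carrier G" "w = u\<^sub>2 \<frown> z" "v = u\<^sub>1 \<frown> \<phi> g z"
    using assms by (auto simp: orbit_iff)
  show ?thesis
  proof (cases u\<^sub>1)
    case Nil
    obtain h y where h: "h \<in> carrier G" "\<And>a. \<phi> g ([z 0] \<frown> a) = [y] \<frown> \<phi> h a"
      using self_similar_letter[OF g(1), of "z 0"] by metis
    have "v = [y] \<frown> \<phi> h (suffix (Suc 0) z)"
      using g(3) Nil h(2)[of "suffix (Suc 0) z"] by (simp add: hd_conc_suffix)
    then have "suffix (Suc 0) v = \<phi> h (suffix (Suc 0) z)" by simp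
    moreover have "w = (u\<^sub>2 @ [z 0]) \<frown> suffix (Suc 0) z"
      using g(2) by (simp add: conc_conc[symmetric] hd_conc_suffix del: conc_conc)
    ultimately show ?thesis unfolding orbit_iff using h(1) by (metis conc_empty)
  next
    case (Cons x u)
    then have "v = [x] \<frown> u \<frown> \<phi> g z" using g(3) by simp
    then have "suffix (Suc 0) v = u \<frown> \<phi> g z" by (metis suffix_conc length_Cons list.size(3))
    then show ?thesis unfolding orbit_iff using g by blast
  qed
qed

text \<open>
  All generators and their adjoints act on the basis \<open>\<delta>\<^sub>v\<close>, \<open>v \<in> \<O>\<close>, by injective partial maps. Relations
  between operators thereby become equations between partial maps.
\<close>

primrec letter_map :: "('g, 'x) letter \<Rightarrow> 'x word \<rightharpoonup> 'x word" where
  "letter_map (Grp g) = (\<lambda>v. if v \<in> \<O> then Some (\<phi> g v) else None)"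
| "letter_map (Grp_adj g) = (\<lambda>v. if v \<in> \<O> then Some (\<phi> (inv\<^bsub>G\<^esub> g) v) else None)"
| "letter_map (Iso x) = (\<lambda>v. if v \<in> \<O> then Some ([x] \<frown> v) else None)"
| "letter_map (Iso_adj x) = (\<lambda>v. if v \<in> \<O> \<and> v 0 = x then Some (suffix (Suc 0) v) else None)"

definition word_map :: "('g, 'x) letter list \<Rightarrow> 'x word \<rightharpoonup> 'x word"
  where "word_map u = foldr (\<lambda>l f. letter_map l \<circ>\<^sub>m f) u (\<lambda>v. if v \<in> \<O> then Some v else None)"

definition gens :: "('g, 'x) letter set"
  where "gens = Grp ` carrier G \<union> Grp_adj ` carrier G \<union> range Iso \<union> range Iso_adj"

definition gen_words :: "('g, 'x) letter list set"
  where "gen_words = lists gens"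

lemma gen_words_iff: "u \<in> gen_words \<longleftrightarrow> set u \<subseteq> gens"
  by (auto simp: gen_words_def)

lemma gen_words_simps [simp]:
  "[] \<in> gen_words" "l # u \<in> gen_words \<longleftrightarrow> l \<in> gens \<and> u \<in> gen_words"
  "u @ u' \<in> gen_words \<longleftrightarrow> u \<in> gen_words \<and> u' \<in> gen_words"
  "rev u \<in> gen_words \<longleftrightarrow> u \<in> gen_words"
  "map Iso z \<in> gen_words" "map Iso_adj z \<in> gen_words"
  by (auto simp: gen_words_iff gens_def)

lemma gens_simps [simp]:
  "Grp g \<in> gens \<longleftrightarrow> g \<in> carrier G" "Grp_adj g \<in> gens \<longleftrightarrow> g \<in> carrier G"
  "Iso x \<in> gens" "Iso_adj x \<in> gens"
  by (auto simp: gens_def)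

lemma letter_adj_in_gens [simp]: "letter_adj l \<in> gens \<longleftrightarrow> l \<in> gens"
  by (cases l) auto

lemma map_letter_adj_in_gen_words [simp]: "map letter_adj u \<in> gen_words \<longleftrightarrow> u \<in> gen_words"
  by (induction u) auto

lemma letter_map_orbit: "l \<in> gens \<Longrightarrow> letter_map l v = Some v' \<Longrightarrow> v \<in> \<O> \<and> v' \<in> \<O>"
  by (cases l) (auto split: if_splits intro: act_in_orbit conc_in_orbit suffix_in_orbit)

lemma letter_map_adj:
  assumes "l \<in> gens"
  shows "letter_map l a = Some b \<longleftrightarrow> letter_map (letter_adj l) b = Some a"
  using assms
proof (cases l)
  case (Iso x)
  have "b = [x] \<frown> a \<longleftrightarrow> b 0 = x \<and> a = suffix (Suc 0) b"
    using hd_conc_suffix[of b] by auto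
  then show ?thesis using Iso conc_in_orbit[of a "[x]"] suffix_in_orbit[of b] by auto
next
  case (Iso_adj x)
  have "a = [x] \<frown> b \<longleftrightarrow> a 0 = x \<and> b = suffix (Suc 0) a"
    using hd_conc_suffix[of a] by auto
  then show ?thesis using Iso_adj conc_in_orbit[of b "[x]"] suffix_in_orbit[of a] by auto
qed (auto intro: act_in_orbit)

lemma partial_inj_letter_map: "l \<in> gens \<Longrightarrow> partial_inj (letter_map l)"
  unfolding partial_inj_def using letter_map_adj by (metis option.inject)

lemma word_map_Nil: "word_map [] v = (if v \<in> \<O> then Some v else None)"
  by (simp add: word_map_def)

lemma word_map_Cons: "word_map (l # u) = letter_map l \<circ>\<^sub>m word_map u"
  by (simp add: word_map_def)

lemma word_map_orbit: "u \<in> gen_words \<Longrightarrow> word_map u v = Some v' \<Longrightarrow> v \<in> \<O> \<and> v' \<in> \<O>"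
proof (induction u arbitrary: v')
  case Nil
  then show ?case by (auto simp: word_map_Nil split: if_splits)
next
  case (Cons l u)
  then show ?case by (auto simp: word_map_Cons map_comp_Some_iff dest: letter_map_orbit)
qed

lemma partial_inj_word_map: "u \<in> gen_words \<Longrightarrow> partial_inj (word_map u)"
proof (induction u)
  case Nil
  then show ?case by (auto simp: partial_inj_def word_map_Nil split: if_splits)
next
  case (Cons l u)
  then show ?case by (auto simp: word_map_Cons intro: partial_inj_comp partial_inj_letter_map)
qed

lemma word_map_append:
  assumes "u' \<in> gen_words"
  shows "word_map (u @ u') = word_map u \<circ>\<^sub>m word_map u'"
proof (induction u)
  case Nil
  show ?case
  proof
    fix v show "word_map ([] @ u') v = (word_map [] \<circ>\<^sub>m word_map u') v"
      using word_map_orbit[OF assms, of v] by (cases "word_map u' v") (auto simp: word_map_Nil)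
  qed
next
  case (Cons l u)
  then show ?case by (auto simp: word_map_Cons map_comp_def split: option.split)
qed

lemma word_map_single: "l \<in> gens \<Longrightarrow> word_map [l] = letter_map l"
proof
  fix v assume l: "l \<in> gens"
  show "word_map [l] v = letter_map l v"
    using letter_map_orbit[OF l, of v] by (cases "letter_map l v") (auto simp: word_map_Cons word_map_Nil map_comp_def)
qed

lemma op_on_orbit:
  "op_on \<O> f = pm_op (\<lambda>v. if v \<in> \<O> then Some (f v) else None)"
proof -
  have "dom (\<lambda>v. if v \<in> \<O> then Some (f v) else None) = \<O>" by (auto split: if_splits)
  moreover have "op_on \<O> f = op_on \<O> (the \<circ> (\<lambda>v. if v \<in> \<O> then Some (f v) else None))"
    unfolding op_on_def by (simp cong: if_cong)
  ultimately show ?thesis unfolding pm_op_def by simp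
qed

lemma rep_letter_eq:
  assumes "l \<in> gens"
  shows "rep_letter G \<phi> w l = pm_op (letter_map l)"
proof (cases l)
  case (Grp_adj g)
  then have g: "Grp g \<in> gens" using assms by simp
  have "rep_letter G \<phi> w l = op_adj (pm_op (letter_map (Grp g)))"
    unfolding Grp_adj by (simp add: rep_letter_def op_on_orbit)
  also have "\<dots> = pm_op (letter_map (Grp_adj g))"
    using letter_map_adj[OF g] by (intro pm_op_adj partial_inj_letter_map g) simp
  finally show ?thesis unfolding Grp_adj .
next
  case (Iso_adj x)
  have g: "Iso x \<in> gens" by simp
  have "rep_letter G \<phi> w l = op_adj (pm_op (letter_map (Iso x)))"
    unfolding Iso_adj by (simp add: rep_letter_def op_on_orbit)
  also have "\<dots> = pm_op (letter_map (Iso_adj x))"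
    using letter_map_adj[OF g] by (intro pm_op_adj partial_inj_letter_map g) simp
  finally show ?thesis unfolding Iso_adj .
qed (simp_all add: rep_letter_def op_on_orbit)

lemma rep_one_eq: "rep_one G \<phi> w = pm_op (word_map [])"
  by (simp add: rep_one_def op_on_orbit word_map_def cong: if_cong)

lemma rep_word_eq: "u \<in> gen_words \<Longrightarrow> \<W> u = pm_op (word_map u)"
proof (induction u)
  case Nil
  then show ?case by (simp add: rep_word_def rep_one_eq)
next
  case (Cons l u)
  then have "\<W> (l # u) = pm_op (letter_map l) o\<^sub>L pm_op (word_map u)"
    by (simp add: rep_word_def rep_letter_eq)
  then show ?case
    using Cons by (simp add: pm_op_comp partial_inj_letter_map partial_inj_word_map word_map_Cons)
qed

lemma rep_word_Nil: "\<W> [] = rep_one G \<phi> w"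
  by (simp add: rep_word_def)

lemma complex_linear_rep_word: "u \<in> gen_words \<Longrightarrow> complex_linear (\<W> u)"
  by (simp add: rep_word_eq complex_linear_pm_op partial_inj_word_map)

lemma rep_word_basis:
  "u \<in> gen_words \<Longrightarrow>
    blinfun_apply (\<W> u) (\<delta> v) = (case word_map u v of None \<Rightarrow> 0 | Some v' \<Rightarrow> \<delta> v')"
  by (simp add: rep_word_eq pm_op_basis partial_inj_word_map)

lemma norm_rep_word_le: "u \<in> gen_words \<Longrightarrow> norm (\<W> u) \<le> 1"
  by (simp add: rep_word_eq norm_pm_op_le partial_inj_word_map)

lemma rep_word_append:
  "u \<in> gen_words \<Longrightarrow> u' \<in> gen_words \<Longrightarrow>
    \<W> (u @ u') = \<W> u o\<^sub>L \<W> u'"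
  by (simp add: rep_word_eq pm_op_comp partial_inj_word_map word_map_append)

lemma word_map_adj:
  "u \<in> gen_words \<Longrightarrow> word_map u a = Some b \<longleftrightarrow> word_map (rev (map letter_adj u)) b = Some a"
proof (induction u arbitrary: b)
  case Nil
  then show ?case by (auto simp: word_map_Nil)
next
  case (Cons l u)
  then have l: "l \<in> gens" "[letter_adj l] \<in> gen_words" by auto
  have "word_map (l # u) a = Some b \<longleftrightarrow> (\<exists>c. word_map u a = Some c \<and> letter_map l c = Some b)"
    by (auto simp: word_map_Cons map_comp_Some_iff)
  also have "\<dots> \<longleftrightarrow> (\<exists>c. word_map (rev (map letter_adj u)) c = Some a \<and> word_map [letter_adj l] b = Some c)"
    using Cons l letter_map_adj[OF l(1)] by (simp add: word_map_single)
  also have "\<dots> \<longleftrightarrow> word_map (rev (map letter_adj (l # u))) b = Some a"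
    using word_map_append[OF l(2), of "rev (map letter_adj u)"] by (auto simp: map_comp_Some_iff)
  finally show ?case .
qed

lemma op_adj_rep_word:
  "u \<in> gen_words \<Longrightarrow> op_adj (\<W> u) = \<W> (rev (map letter_adj u))"
  by (simp add: rep_word_eq pm_op_adj[OF partial_inj_word_map word_map_adj])

lemma rep_word_eqI:
  "u \<in> gen_words \<Longrightarrow> u' \<in> gen_words \<Longrightarrow> (\<And>v. v \<in> \<O> \<Longrightarrow> word_map u v = word_map u' v) \<Longrightarrow>
    \<W> u = \<W> u'"
proof -
  assume u: "u \<in> gen_words" "u' \<in> gen_words" and eq: "\<And>v. v \<in> \<O> \<Longrightarrow> word_map u v = word_map u' v"
  have "word_map u v = word_map u' v" for v
    using eq[of v] word_map_orbit[OF u(1), of v] word_map_orbit[OF u(2), of v]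
    by (cases "v \<in> \<O>") (metis option.exhaust)+
  then show ?thesis using u by (simp add: rep_word_eq arg_cong[OF ext, of "word_map u" "word_map u'" pm_op])
qed

section \<open>Normal forms of words\<close>

definition mono_word :: "'x list \<Rightarrow> 'g \<Rightarrow> 'x list \<Rightarrow> ('g, 'x) letter list"
  where "mono_word u\<^sub>1 g u\<^sub>2 = map Iso u\<^sub>1 @ [Grp g] @ rev (map Iso_adj u\<^sub>2)"

lemma mono_word_in_gen_words [simp]: "mono_word u\<^sub>1 g u\<^sub>2 \<in> gen_words \<longleftrightarrow> g \<in> carrier G"
  by (simp add: mono_word_def)

lemma word_map_Isos: "v \<in> \<O> \<Longrightarrow> word_map (map Iso u) v = Some (u \<frown> v)"
  by (induction u) (auto simp: word_map_Nil word_map_Cons map_comp_def conc_in_orbit)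

lemma word_map_Iso_adjs: "word_map (rev (map Iso_adj u)) v = (if v \<in> \<O> then T_star u v else None)"
proof -
  have "word_map (rev (map Iso_adj u)) v = Some a \<longleftrightarrow> v \<in> \<O> \<and> v = u \<frown> a" for a
  proof -
    have "word_map (rev (map Iso_adj u)) v = Some a \<longleftrightarrow> word_map (map Iso u) a = Some v"
      using word_map_adj[of "map Iso u" a v] by (simp add: comp_def)
    also have "\<dots> \<longleftrightarrow> a \<in> \<O> \<and> v = u \<frown> a"
      using word_map_Isos[of a u] word_map_orbit[of "map Iso u" a v] by auto
    also have "\<dots> \<longleftrightarrow> v \<in> \<O> \<and> v = u \<frown> a"
    proof -
      have "a \<in> \<O>" if "u \<frown> a \<in> \<O>" using that
      proof (induction u)
        case (Cons x u)
        then have "suffix (Suc 0) ([x] \<frown> u \<frown> a) \<in> \<O>" by (intro suffix_in_orbit) simp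
        then show ?case using Cons by simp
      qed simp
      then show ?thesis by (auto intro: conc_in_orbit)
    qed
    finally show ?thesis .
  qed
  then show ?thesis by (intro option_eqI) (auto simp: T_star_Some_iff)
qed

lemma word_map_mono_word:
  assumes "g \<in> carrier G"
  shows "word_map (mono_word u\<^sub>1 g u\<^sub>2) v =
    (if v \<in> \<O> then map_option (\<lambda>z. u\<^sub>1 \<frown> \<phi> g z) (T_star u\<^sub>2 v) else None)"
proof (cases "word_map (rev (map Iso_adj u\<^sub>2)) v")
  case None
  then show ?thesis using assms unfolding mono_word_def
    by (subst word_map_append, simp)+ (auto simp: word_map_Iso_adjs map_comp_def split: if_splits)
next
  case (Some z)
  then have z: "z \<in> \<O>" "v \<in> \<O>" "T_star u\<^sub>2 v = Some z"
    using word_map_orbit[OF _ Some] by (auto simp: word_map_Iso_adjs)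
  show ?thesis using assms z Some unfolding mono_word_def
    by (subst word_map_append, simp)+ (simp add: map_comp_def word_map_Isos act_in_orbit word_map_single)
qed

lemma S_op_eq: "S_op G \<phi> w u = \<W> (map Iso u)"
  by (simp add: S_op_def)

lemma op_adj_S_op: "op_adj (S_op G \<phi> w u) = \<W> (rev (map Iso_adj u))"
  by (simp add: S_op_def op_adj_rep_word comp_def)

lemma rep_mono_word:
  "g \<in> carrier G \<Longrightarrow>
    S_op G \<phi> w u\<^sub>1 o\<^sub>L grp_op G \<phi> w g o\<^sub>L op_adj (S_op G \<phi> w u\<^sub>2) = \<W> (mono_word u\<^sub>1 g u\<^sub>2)"
  by (simp add: op_adj_S_op S_op_eq[of u\<^sub>1] grp_op_def mono_word_def rep_word_append[symmetric])

primrec letter_degree :: "('g, 'x) letter \<Rightarrow> int" where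
  "letter_degree (Grp g) = 0"
| "letter_degree (Grp_adj g) = 0"
| "letter_degree (Iso x) = 1"
| "letter_degree (Iso_adj x) = -1"

definition word_degree :: "('g, 'x) letter list \<Rightarrow> int"
  where "word_degree u = sum_list (map letter_degree u)"

lemma word_degree_simps [simp]:
  "word_degree [] = 0" "word_degree (l # u) = letter_degree l + word_degree u"
  "word_degree (u @ u') = word_degree u + word_degree u'"
  by (simp_all add: word_degree_def)

lemma letter_degree_adj [simp]: "letter_degree (letter_adj l) = - letter_degree l"
  by (cases l) auto

lemma word_degree_adj [simp]: "word_degree (rev (map letter_adj u)) = - word_degree u"
  by (induction u) auto

lemma word_degree_Isos [simp]:
  "word_degree (map Iso u) = int (length u)" "word_degree (rev (map Iso_adj u)) = - int (length u)"
  by (induction u) auto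

lemma word_degree_mono_word [simp]:
  "word_degree (mono_word u\<^sub>1 g u\<^sub>2) = int (length u\<^sub>1) - int (length u\<^sub>2)"
  by (simp add: mono_word_def)

text \<open>
  By induction, one letter is multiplied from the left to \<open>S\<^sub>u g S\<^sub>v\<^sup>*\<close>. A group element moves past \<open>S\<^sub>u\<close>
  by self-similarity, and \<open>S\<^sub>x\<close> lengthens \<open>u\<close>. The adjoint \<open>S\<^sub>x\<^sup>*\<close> cancels the first letter of \<open>u\<close>
  or annihilates the product; if \<open>u\<close> is empty, \<open>S\<^sub>x\<^sup>* g = h S\<^sub>y\<^sup>*\<close> where \<open>g\<close> maps words that
  start with \<open>y\<close> to words that start with \<open>x\<close>.
\<close>

lemma word_map_normal_form:
  assumes "u \<in> gen_words"
  shows "word_map u = Map.empty \<or>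
    (\<exists>u\<^sub>1 u\<^sub>2. \<exists>g\<in>carrier G. word_degree (mono_word u\<^sub>1 g u\<^sub>2) = word_degree u \<and>
      word_map u = word_map (mono_word u\<^sub>1 g u\<^sub>2))"
  using assms
proof (induction u)
  case Nil
  have "word_map [] = word_map (mono_word [] \<one>\<^bsub>G\<^esub> [])"
    by (rule ext) (simp add: word_map_mono_word word_map_Nil)
  then show ?case by (intro disjI2 exI[of _ "[]"] bexI[of _ "\<one>\<^bsub>G\<^esub>"]) simp_all
next
  case (Cons l u)
  then have l: "l \<in> gens" and u: "u \<in> gen_words" by auto
  note orb = word_map_orbit[OF u]
  consider "word_map u = Map.empty"
    | u\<^sub>1 u\<^sub>2 g where "g \<in> carrier G" "word_degree (mono_word u\<^sub>1 g u\<^sub>2) = word_degree u"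
      "word_map u = word_map (mono_word u\<^sub>1 g u\<^sub>2)"
    using Cons.IH[OF u] by blast
  then show ?case
  proof cases
    case 1
    then show ?thesis by (auto simp: word_map_Cons map_comp_def)
  next
    case 2
    define f where "f z = u\<^sub>1 \<frown> \<phi> g z" for z
    have wm: "word_map u v = (if v \<in> \<O> then map_option f (T_star u\<^sub>2 v) else None)" for v
      using 2 by (simp add: word_map_mono_word f_def[abs_def])
    have fO: "f z \<in> \<O>" if "u\<^sub>2 \<frown> z \<in> \<O>" for z
      using orb[of "u\<^sub>2 \<frown> z" "f z"] that by (simp add: wm)
    have conv: "word_map (l # u) = word_map (mono_word u\<^sub>1' g' u\<^sub>2)"
      if "g' \<in> carrier G"
        "\<And>z. f z \<in> \<O> \<Longrightarrow> letter_map l (f z) = Some (u\<^sub>1' \<frown> \<phi> g' z)" for u\<^sub>1' g'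
    proof
      fix v
      show "word_map (l # u) v = word_map (mono_word u\<^sub>1' g' u\<^sub>2) v"
        by (cases "T_star u\<^sub>2 v")
          (auto simp: word_map_Cons map_comp_def wm word_map_mono_word that T_star_Some_iff fO)
    qed
    have grp: ?thesis
      if l_eq: "\<And>v. v \<in> \<O> \<Longrightarrow> letter_map l v = Some (\<phi> k v)" and k: "k \<in> carrier G"
        and deg: "letter_degree l = 0" for k
    proof -
      obtain h v where h: "h \<in> carrier G" "length v = length u\<^sub>1" "\<And>a. \<phi> k (u\<^sub>1 \<frown> a) = v \<frown> \<phi> h a"
        using self_similar_word[OF k, of u\<^sub>1] by metis
      have "word_map (l # u) = word_map (mono_word v (h \<otimes>\<^bsub>G\<^esub> g) u\<^sub>2)"
        using 2(1) h by (intro conv) (simp_all add: l_eq, simp add: f_def act_mult)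
      then show ?thesis using 2(1,2) h deg
        by (intro disjI2 exI[of _ v] exI[of _ u\<^sub>2] bexI[of _ "h \<otimes>\<^bsub>G\<^esub> g"]) simp_all
    qed
    show ?thesis
    proof (cases l)
      case (Grp k)
      then show ?thesis using l by (intro grp[of k]) auto
    next
      case (Grp_adj k)
      then show ?thesis using l by (intro grp[of "inv\<^bsub>G\<^esub> k"]) auto
    next
      case (Iso x)
      have "word_map (l # u) = word_map (mono_word (x # u\<^sub>1) g u\<^sub>2)"
        using 2(1) by (intro conv) (simp_all add: Iso f_def)
      then show ?thesis using 2(1,2) Iso
        by (intro disjI2 exI[of _ "x # u\<^sub>1"] exI[of _ u\<^sub>2] bexI[of _ g]) simp_all
    next
      case (Iso_adj x)
      show ?thesis
      proof (cases u\<^sub>1)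
        case (Cons y u')
        have hd: "f z 0 = y" "suffix (Suc 0) (f z) = u' \<frown> \<phi> g z" for z
        proof -
          have "f z = [y] \<frown> u' \<frown> \<phi> g z" by (simp add: f_def Cons)
          then show "f z 0 = y" "suffix (Suc 0) (f z) = u' \<frown> \<phi> g z"
            by (simp_all del: conc_conc)
        qed
        show ?thesis
        proof (cases "x = y")
          case True
          have "word_map (l # u) = word_map (mono_word u' g u\<^sub>2)"
            using 2(1) by (intro conv) (simp_all add: Iso_adj True hd)
          then show ?thesis using 2(1,2) Iso_adj Cons
            by (intro disjI2 exI[of _ u'] exI[of _ u\<^sub>2] bexI[of _ g]) simp_all
        next
          case False
          have "word_map (l # u) v = None" for v
            by (cases "T_star u\<^sub>2 v")
              (use False in \<open>auto simp: word_map_Cons map_comp_def wm Iso_adj hd\<close>)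
          then show ?thesis by blast
        qed
      next
        case Nil
        \<comment> \<open>The inverse of \<open>g\<close> shows which letter \<open>y\<close> is mapped to \<open>x\<close>.\<close>
        obtain h y where h: "h \<in> carrier G" "\<And>a. \<phi> (inv\<^bsub>G\<^esub> g) ([x] \<frown> a) = [y] \<frown> \<phi> h a"
          using self_similar_letter[of "inv\<^bsub>G\<^esub> g" x] 2(1) by auto
        have gy: "\<phi> g ([y] \<frown> a) = [x] \<frown> \<phi> (inv\<^bsub>G\<^esub> h) a" for a
          using h(2)[of "\<phi> (inv\<^bsub>G\<^esub> h) a"] h(1) 2(1) by (metis act_inv(1))
        have 3: "f z = [x] \<frown> b \<longleftrightarrow> z = [y] \<frown> \<phi> h b" for z b
          using gy[of "\<phi> h b"] h(1) 2(1) by (simp add: f_def Nil) (metis act_inv(2))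
        have "word_map (l # u) v = Some c \<longleftrightarrow> word_map (mono_word [] (inv\<^bsub>G\<^esub> h) (u\<^sub>2 @ [y])) v = Some c"
          for v c
        proof -
          have "word_map (l # u) v = Some c \<longleftrightarrow>
              (\<exists>z. v \<in> \<O> \<and> v = u\<^sub>2 \<frown> z \<and> f z 0 = x \<and> c = suffix (Suc 0) (f z))"
            by (auto simp: word_map_Cons map_comp_Some_iff wm T_star_Some_iff Iso_adj fO split: if_splits)
          also have "\<dots> \<longleftrightarrow> (\<exists>z. v \<in> \<O> \<and> v = u\<^sub>2 \<frown> z \<and> f z = [x] \<frown> c)"
            by (metis hd_conc_suffix conc_fst length_Cons list.size(3) nth_Cons_0 suffix_conc zero_less_Suc)
          also have "\<dots> \<longleftrightarrow> v \<in> \<O> \<and> v = u\<^sub>2 \<frown> [y] \<frown> \<phi> h c" unfolding 3 by auto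
          also have "\<dots> \<longleftrightarrow> word_map (mono_word [] (inv\<^bsub>G\<^esub> h) (u\<^sub>2 @ [y])) v = Some c"
            using h(1) by (auto simp: word_map_mono_word T_star_Some_iff)
          finally show ?thesis .
        qed
        then have "word_map (l # u) = word_map (mono_word [] (inv\<^bsub>G\<^esub> h) (u\<^sub>2 @ [y]))"
          by (intro ext option_eqI)
        then show ?thesis using 2(1,2) Iso_adj Nil h(1)
          by (intro disjI2 exI[of _ "[]"] exI[of _ "u\<^sub>2 @ [y]"] bexI[of _ "inv\<^bsub>G\<^esub> h"]) simp_all
      qed
    qed
  qed
qed

end


section \<open>The free *-algebra\<close>

definition word_adj :: "('g, 'x) letter list \<Rightarrow> ('g, 'x) letter list"
  where "word_adj u = rev (map letter_adj u)"

lemma letter_adj_letter_adj [simp]: "letter_adj (letter_adj l) = l"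
  by (cases l) auto

lemma word_adj_word_adj [simp]: "word_adj (word_adj u) = u"
  by (simp add: word_adj_def rev_map comp_def)

lemma inj_word_adj: "inj word_adj"
  by (metis injI word_adj_word_adj)

lemma fp_adj_fp_adj [simp]: "fp_adj (fp_adj p) = p"
  unfolding fp_adj_def word_adj_def[symmetric] by simp

lemma fp_adj_apply: "fp_adj p u = cnj (p (word_adj u))"
  by (simp add: fp_adj_def word_adj_def)

lemma in_word_adj_image: "u \<in> word_adj ` A \<longleftrightarrow> word_adj u \<in> A"
  by (auto intro: image_eqI[of u word_adj "word_adj u"])

lemma support_fp_adj: "{u. fp_adj p u \<noteq> 0} = word_adj ` {u. p u \<noteq> 0}"
  by (auto simp: fp_adj_apply in_word_adj_image simp del: image_iff image_Collect)

lemma fp_adj_word: "fp_adj (fp_word u) = fp_word (word_adj u)"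
proof
  fix v show "fp_adj (fp_word u) v = fp_word (word_adj u) v"
    using word_adj_word_adj[of u] word_adj_word_adj[of v] by (auto simp: fp_adj_apply fp_word_def)
qed

text \<open>
  The convolution product runs over all ways to cut \<open>u\<close> in two; only cuts into words of the
  supports contribute, which turns products of polynomials into double sums over the supports.
\<close>

lemma fp_mult_eq:
  assumes "finite A" "finite B" "{u. p u \<noteq> 0} \<subseteq> A" "{u. q u \<noteq> 0} \<subseteq> B"
  shows "fp_mult p q u = (\<Sum>(a, b)\<in>{ab \<in> A \<times> B. fst ab @ snd ab = u}. p a * q b)"
proof -
  have S: "{ab. fst ab @ snd ab = u} = (\<lambda>k. (take k u, drop k u)) ` {..length u}"
  proof (intro equalityI subsetI)
    fix ab assume "ab \<in> {ab. fst ab @ snd ab = u}"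
    then show "ab \<in> (\<lambda>k. (take k u, drop k u)) ` {..length u}"
      by (intro image_eqI[of _ _ "length (fst ab)"]) auto
  qed auto
  have inj: "inj_on (\<lambda>k. (take k u, drop k u)) {..length u}"
    by (rule inj_onI) (auto dest: arg_cong[where f = length])
  have "fp_mult p q u = (\<Sum>(a, b)\<in>{ab. fst ab @ snd ab = u}. p a * q b)"
    unfolding S by (subst sum.reindex[OF inj]) (simp add: fp_mult_def)
  also have "\<dots> = (\<Sum>(a, b)\<in>{ab \<in> A \<times> B. fst ab @ snd ab = u}. p a * q b)"
  proof (rule sum.mono_neutral_right)
    show "finite {ab. fst ab @ snd ab = u}" unfolding S by simp
  qed (use assms(3,4) in auto)
  finally show ?thesis .
qed

lemma support_fp_mult:
  "{u. fp_mult p q u \<noteq> 0} \<subseteq> (\<lambda>(a, b). a @ b) ` ({u. p u \<noteq> 0} \<times> {u. q u \<noteq> 0})"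
proof
  fix u assume "u \<in> {u. fp_mult p q u \<noteq> 0}"
  then obtain k where "p (take k u) * q (drop k u) \<noteq> 0"
    unfolding fp_mult_def by (metis (mono_tags, lifting) mem_Collect_eq sum.neutral)
  then show "u \<in> (\<lambda>(a, b). a @ b) ` ({u. p u \<noteq> 0} \<times> {u. q u \<noteq> 0})"
    by (intro image_eqI[of _ _ "(take k u, drop k u)"]) auto
qed

lemma fp_mult_word: "fp_mult (fp_word a) (fp_word b) = fp_word (a @ b)"
proof
  fix u
  have "{ab \<in> {a} \<times> {b}. fst ab @ snd ab = u} = (if u = a @ b then {(a, b)} else {})" by auto
  then show "fp_mult (fp_word a) (fp_word b) u = fp_word (a @ b) u"
    by (subst fp_mult_eq[of "{a}" "{b}"]) (auto simp: fp_word_def)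
qed

lemma fp_mult_diff:
  "fp_diff (fp_mult p q) (fp_mult p' q') = fp_add (fp_mult p (fp_diff q q')) (fp_mult (fp_diff p p') q')"
  by (auto simp: fp_diff_def fp_mult_def fp_add_def sum.distrib[symmetric] sum_subtractf[symmetric]
      algebra_simps intro!: sum.cong)

lemma fp_diff_self: "fp_diff p p = fp_scale 0 p"
  by (simp add: fp_diff_def fp_scale_def)

lemma fp_adj_diff: "fp_diff (fp_adj p) (fp_adj q) = fp_adj (fp_diff p q)"
  by (simp add: fp_diff_def fp_adj_def)

lemma fp_scale_diff: "fp_diff (fp_scale c p) (fp_scale c q) = fp_scale c (fp_diff p q)"
  by (simp add: fp_diff_def fp_scale_def algebra_simps)

lemma fp_add_diff: "fp_diff (fp_add p q) (fp_add p' q') = fp_add (fp_diff p p') (fp_diff q q')"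
  by (simp add: fp_diff_def fp_add_def algebra_simps)

context orbit_representation
begin

abbreviation free_algebra :: "('g, 'x) free_poly set" (\<open>\<F>\<close>)
  where "\<F> \<equiv> free_star_algebra G"

lemma free_star_algebra_iff:
  "p \<in> \<F> \<longleftrightarrow> finite {u. p u \<noteq> 0} \<and> {u. p u \<noteq> 0} \<subseteq> gen_words"
  unfolding free_star_algebra_def gen_words_def lists_eq_set gens_def by blast

lemma free_star_algebra_subsetI:
  "{u. p u \<noteq> 0} \<subseteq> U \<Longrightarrow> finite U \<Longrightarrow> U \<subseteq> gen_words \<Longrightarrow> p \<in> \<F>"
  unfolding free_star_algebra_iff by (auto intro: finite_subset)

lemma word_adj_in_gen_words [simp]: "word_adj u \<in> gen_words \<longleftrightarrow> u \<in> gen_words"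
  by (simp add: word_adj_def)

lemma fp_word_closed: "u \<in> gen_words \<Longrightarrow> fp_word u \<in> \<F>"
  by (rule free_star_algebra_subsetI[of _ "{u}"]) (auto simp: fp_word_def)

lemma fp_add_closed:
  "p \<in> \<F> \<Longrightarrow> q \<in> \<F> \<Longrightarrow> fp_add p q \<in> \<F>"
  by (rule free_star_algebra_subsetI[of _ "{u. p u \<noteq> 0} \<union> {u. q u \<noteq> 0}"])
    (auto simp: fp_add_def free_star_algebra_iff)

lemma fp_diff_closed:
  "p \<in> \<F> \<Longrightarrow> q \<in> \<F> \<Longrightarrow> fp_diff p q \<in> \<F>"
  by (rule free_star_algebra_subsetI[of _ "{u. p u \<noteq> 0} \<union> {u. q u \<noteq> 0}"])
    (auto simp: fp_diff_def free_star_algebra_iff)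

lemma fp_scale_closed: "p \<in> \<F> \<Longrightarrow> fp_scale c p \<in> \<F>"
  by (rule free_star_algebra_subsetI[of _ "{u. p u \<noteq> 0}"])
    (auto simp: fp_scale_def free_star_algebra_iff)

lemma fp_mult_closed:
  "p \<in> \<F> \<Longrightarrow> q \<in> \<F> \<Longrightarrow> fp_mult p q \<in> \<F>"
  using support_fp_mult[of p q]
  by (rule free_star_algebra_subsetI) (auto simp: free_star_algebra_iff)

lemma fp_adj_closed: "p \<in> \<F> \<Longrightarrow> fp_adj p \<in> \<F>"
  by (rule free_star_algebra_subsetI[OF equalityD1[OF support_fp_adj]]) (auto simp: free_star_algebra_iff)

lemmas fp_closed = fp_word_closed fp_add_closed fp_diff_closed fp_scale_closed fp_mult_closed fp_adj_closed

section \<open>The representation is a *-homomorphism\<close>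

lemma rep_poly_superset:
  assumes "finite U" "{u. p u \<noteq> 0} \<subseteq> U"
  shows "\<R> p = (\<Sum>u\<in>U. p u \<cdot>\<^sub>\<complex> \<W> u)"
  unfolding rep_poly_def using assms by (intro sum.mono_neutral_left) auto

lemma rep_poly_word: "\<R> (fp_word u) = \<W> u"
  by (subst rep_poly_superset[of "{u}"]) (auto simp: fp_word_def)

lemma rep_poly_add:
  assumes "p \<in> \<F>" "q \<in> \<F>"
  shows "\<R> (fp_add p q) = \<R> p + \<R> q"
proof -
  let ?U = "{u. p u \<noteq> 0} \<union> {u. q u \<noteq> 0}"
  have U: "finite ?U" using assms by (simp add: free_star_algebra_iff)
  have "{u. fp_add p q u \<noteq> 0} \<subseteq> ?U" by (auto simp: fp_add_def)
  then show ?thesis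
    using rep_poly_superset[OF U, of "fp_add p q"] rep_poly_superset[OF U, of p]
      rep_poly_superset[OF U, of q]
    by (auto simp: fp_add_def op_scale_add_left sum.distrib)
qed

lemma rep_poly_scale:
  assumes "p \<in> \<F>"
  shows "\<R> (fp_scale c p) = c \<cdot>\<^sub>\<complex> \<R> p"
  by (subst rep_poly_superset[of "{u. p u \<noteq> 0}"])
    (use assms in \<open>auto simp: free_star_algebra_iff fp_scale_def rep_poly_def op_scale_sum_right op_scale_op_scale\<close>)

lemma rep_poly_diff:
  assumes "p \<in> \<F>" "q \<in> \<F>"
  shows "\<R> (fp_diff p q) = \<R> p - \<R> q"
proof -
  have "fp_diff p q = fp_add p (fp_scale (-1) q)" by (simp add: fp_diff_def fp_add_def fp_scale_def)
  then show ?thesis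
    using assms by (simp add: rep_poly_add rep_poly_scale fp_closed op_scale_minus_one)
qed

lemma complex_linear_rep_poly: "p \<in> \<F> \<Longrightarrow> complex_linear (\<R> p)"
  unfolding rep_poly_def
  by (intro complex_linear_sum complex_linear_scale complex_linear_rep_word)
    (auto simp: free_star_algebra_iff)

lemma rep_poly_mult:
  assumes "p \<in> \<F>" "q \<in> \<F>"
  shows "\<R> (fp_mult p q) = \<R> p o\<^sub>L \<R> q"
proof -
  let ?A = "{u. p u \<noteq> 0}" and ?B = "{u. q u \<noteq> 0}"
  let ?m = "\<lambda>ab :: ('g, 'x) letter list \<times> ('g, 'x) letter list. fst ab @ snd ab"
  have fin: "finite ?A" "finite ?B" and gen: "?A \<subseteq> gen_words" "?B \<subseteq> gen_words"
    using assms by (auto simp: free_star_algebra_iff)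
  have "\<R> (fp_mult p q) = (\<Sum>u\<in>?m ` (?A \<times> ?B). fp_mult p q u \<cdot>\<^sub>\<complex> \<W> u)"
    by (rule rep_poly_superset) (use fin support_fp_mult[of p q] in \<open>auto simp: case_prod_unfold\<close>)
  also have "\<dots> = (\<Sum>u\<in>?m ` (?A \<times> ?B). \<Sum>ab\<in>{ab \<in> ?A \<times> ?B. ?m ab = u}.
      (p (fst ab) * q (snd ab)) \<cdot>\<^sub>\<complex> \<W> (?m ab))"
  proof (rule sum.cong[OF refl])
    fix u
    have "(\<Sum>ab\<in>C. f ab) \<cdot>\<^sub>\<complex> T = (\<Sum>ab\<in>C. f ab \<cdot>\<^sub>\<complex> T)" for C and f :: "_ \<Rightarrow> complex" and T :: "'x word ell2_op"
      by (induction C rule: infinite_finite_induct) (auto simp: op_scale_add_left)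
    then show "fp_mult p q u \<cdot>\<^sub>\<complex> \<W> u = (\<Sum>ab\<in>{ab \<in> ?A \<times> ?B. ?m ab = u}.
      (p (fst ab) * q (snd ab)) \<cdot>\<^sub>\<complex> \<W> (?m ab))"
      by (subst fp_mult_eq[OF fin]) (auto simp: case_prod_unfold)
  qed
  also have "\<dots> = (\<Sum>ab\<in>?A \<times> ?B. (p (fst ab) * q (snd ab)) \<cdot>\<^sub>\<complex> \<W> (?m ab))"
    by (rule sum.group) (use fin in auto)
  also have "\<dots> = (\<Sum>a\<in>?A. \<Sum>b\<in>?B. (p a \<cdot>\<^sub>\<complex> \<W> a) o\<^sub>L (q b \<cdot>\<^sub>\<complex> \<W> b))"
    unfolding sum.cartesian_product case_prod_unfold using gen
    by (intro sum.cong refl)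
      (auto simp: rep_word_append subset_iff op_scale_compose_left op_scale_compose_right
        complex_linear_rep_word op_scale_op_scale)
  also have "\<dots> = \<R> p o\<^sub>L \<R> q"
    unfolding rep_poly_def compose_sum_left unfolding compose_sum_right ..
  finally show ?thesis .
qed

lemma rep_poly_adj:
  assumes "p \<in> \<F>"
  shows "\<R> (fp_adj p) = op_adj (\<R> p)"
proof -
  have gen: "{u. p u \<noteq> 0} \<subseteq> gen_words" using assms by (simp add: free_star_algebra_iff)
  have "\<R> (fp_adj p) = (\<Sum>u | p u \<noteq> 0. cnj (p u) \<cdot>\<^sub>\<complex> \<W> (word_adj u))"
    unfolding rep_poly_def support_fp_adj
    by (subst sum.reindex) (auto intro: inj_on_subset[OF inj_word_adj] simp: fp_adj_def word_adj_def[symmetric])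
  also have "\<dots> = op_adj (\<R> p)"
    unfolding rep_poly_def using gen
    by (subst op_adj_sum) (auto intro!: complex_linear_scale complex_linear_rep_word sum.cong
        simp: subset_iff op_adj_scale op_adj_rep_word complex_linear_rep_word word_adj_def)
  finally show ?thesis .
qed

text \<open>
  Each relation is checked on the partial maps of its two sides. Only the relation
  \<open>\<Sum>\<^sub>x S\<^sub>x S\<^sub>x\<^sup>* = 1\<close> involves a sum, of which a single term, given by the first letter of the
  basis point, is nonzero.
\<close>

lemma rep_poly_relator:
  assumes "r \<in> relators G \<phi>"
  shows "\<R> r = 0 \<and> r \<in> \<F>"
proof -
  have *: "\<R> (fp_diff p q) = 0 \<and> fp_diff p q \<in> \<F>"
    if "p \<in> \<F>" "q \<in> \<F>" "\<R> p = \<R> q" for p q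
    using that by (simp add: rep_poly_diff fp_closed)
  have ww: "\<R> (fp_diff (fp_word a) (fp_word b)) = 0 \<and>
      fp_diff (fp_word a) (fp_word b) \<in> \<F>"
    if "a \<in> gen_words" "b \<in> gen_words" "\<And>v. v \<in> \<O> \<Longrightarrow> word_map a v = word_map b v" for a b
    using that by (intro *) (auto simp: fp_closed rep_poly_word intro: rep_word_eqI)
  note wm = word_map_Cons word_map_Nil map_comp_def
  show ?thesis
    using assms unfolding relators_def
  proof (elim UnE CollectE exE conjE singletonE)
    fix g h assume "r = fp_diff (fp_word [Grp g, Grp h]) (fp_word [Grp (g \<otimes>\<^bsub>G\<^esub> h)])"
      and "g \<in> carrier G" "h \<in> carrier G"
    then show ?thesis by (simp only:) (rule ww, auto simp: wm act_in_orbit act_mult)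
  next
    fix g assume "r = fp_diff (fp_word [Grp_adj g, Grp g]) (fp_word [])" "g \<in> carrier G"
    then show ?thesis by (simp only:) (rule ww, auto simp: wm act_in_orbit)
  next
    fix g assume "r = fp_diff (fp_word [Grp g, Grp_adj g]) (fp_word [])" "g \<in> carrier G"
    then show ?thesis by (simp only:) (rule ww, auto simp: wm act_in_orbit)
  next
    fix x y
    assume 4: "r = fp_diff (fp_word [Iso_adj x, Iso y]) (fp_scale (if x = y then 1 else 0) (fp_word []))"
    show ?thesis
    proof (cases "x = y")
      case True
      have "fp_scale 1 (fp_word []) = (fp_word [] :: ('g, 'x) free_poly)" by (simp add: fp_scale_def)
      then show ?thesis unfolding 4 True by (simp only: if_True refl) (rule ww, auto simp: wm conc_in_orbit)
    next
      case False
      have "word_map [Iso_adj x, Iso y] = Map.empty"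
        using False by (auto simp: wm conc_in_orbit fun_eq_iff)
      then have "\<W> [Iso_adj x, Iso y] = 0" by (simp add: rep_word_eq pm_op_empty)
      then show ?thesis unfolding 4 using False
        by (intro *) (auto simp: fp_closed rep_poly_scale rep_poly_word)
    qed
  next
    assume 5: "r = fp_diff (\<lambda>u. \<Sum>x\<in>UNIV. fp_word [Iso x, Iso_adj x] u) (fp_word [])"
    let ?s = "\<lambda>A u. \<Sum>x\<in>A. fp_word [Iso x :: ('g, 'x) letter, Iso_adj x] u"
    have s: "?s A \<in> \<F> \<and> \<R> (?s A) = (\<Sum>x\<in>A. \<W> [Iso x, Iso_adj x])"
      if "finite A" for A using that
    proof (induction A)
      case empty
      have "?s {} = fp_scale 0 (fp_word [])" by (simp add: fp_scale_def)
      then show ?case by (simp add: fp_closed rep_poly_scale)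
    next
      case (insert x A)
      then have "?s (insert x A) = fp_add (fp_word [Iso x, Iso_adj x]) (?s A)"
        by (simp add: fp_add_def)
      with insert show ?case by (simp only:) (simp add: fp_closed rep_poly_add rep_poly_word)
    qed
    have "(\<Sum>x\<in>UNIV. \<W> [Iso x, Iso_adj x]) = \<W> []"
    proof (rule ell2_op_eqI)
      fix v
      have "blinfun_apply (\<W> [Iso x, Iso_adj x]) (\<delta> v) =
          (if x = v 0 then blinfun_apply (\<W> []) (\<delta> v) else 0)" for x
        by (auto simp: rep_word_basis wm suffix_in_orbit hd_conc_suffix)
      then show "blinfun_apply (\<Sum>x\<in>UNIV. \<W> [Iso x, Iso_adj x]) (\<delta> v) =
          blinfun_apply (\<W> []) (\<delta> v)"
        by (simp add: blinfun.sum_left)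
    qed (auto intro!: complex_linear_sum complex_linear_rep_word)
    then show ?thesis unfolding 5 using s[of UNIV] by (intro *) (auto simp: fp_closed rep_poly_word)
  next
    fix g x v h
    assume "r = fp_diff (fp_word [Grp g, Iso x]) (fp_word [Iso v, Grp h])"
      and "g \<in> carrier G" "h \<in> carrier G" "\<forall>a. \<phi> g ([x] \<frown> a) = [v] \<frown> \<phi> h a"
    then show ?thesis by (simp only:) (rule ww, auto simp: wm act_in_orbit conc_in_orbit)
  qed
qed

section \<open>The maximal norm\<close>

text \<open>
  The representation therefore contributes one of the seminorms in the supremum \<open>\<N>\<close>, which makes it
  contractive for \<open>\<N>\<close>.
\<close>

lemma cstar_seminorm_rep: "cstar_seminorm G \<phi> (\<lambda>p. norm (\<R> p))"
  unfolding cstar_seminorm_def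
  by (auto simp: rep_poly_mult rep_poly_adj fp_closed norm_op_adj_compose complex_linear_rep_poly
      rep_poly_scale norm_op_scale rep_poly_add norm_triangle_ineq norm_blinfun_compose rep_poly_relator)

context
  fixes N assumes N: "cstar_seminorm G \<phi> N"
begin

lemma seminorm_nonneg: "p \<in> \<F> \<Longrightarrow> 0 \<le> N p"
  and seminorm_square: "p \<in> \<F> \<Longrightarrow> N (fp_mult (fp_adj p) p) = (N p)\<^sup>2"
  and seminorm_scale: "p \<in> \<F> \<Longrightarrow> N (fp_scale c p) = cmod c * N p"
  and seminorm_add: "p \<in> \<F> \<Longrightarrow> q \<in> \<F> \<Longrightarrow> N (fp_add p q) \<le> N p + N q"
  and seminorm_mult: "p \<in> \<F> \<Longrightarrow> q \<in> \<F> \<Longrightarrow> N (fp_mult p q) \<le> N p * N q"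
  and seminorm_relator: "r \<in> relators G \<phi> \<Longrightarrow> N r = 0"
  using N by (auto simp: cstar_seminorm_def)

lemma seminorm_adj:
  assumes p: "p \<in> \<F>"
  shows "N (fp_adj p) = N p"
proof -
  have le: "N q \<le> N (fp_adj q)" if q: "q \<in> \<F>" for q
  proof -
    have "(N q)\<^sup>2 \<le> N (fp_adj q) * N q"
      using seminorm_square[OF q] seminorm_mult[OF fp_adj_closed[OF q] q] by simp
    then show ?thesis
      using seminorm_nonneg[OF q] seminorm_nonneg[OF fp_adj_closed[OF q]]
      by (cases "N q = 0") (auto simp: power2_eq_square)
  qed
  show ?thesis using le[OF p] le[OF fp_adj_closed[OF p]] by simp
qed

lemma seminorm_relation:
  assumes "fp_diff p q \<in> relators G \<phi>" "q \<in> \<F>"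
  shows "N p \<le> N q"
proof -
  have "p = fp_add (fp_diff p q) q" by (simp add: fp_add_def fp_diff_def)
  then have "N p \<le> N (fp_diff p q) + N q"
    using seminorm_add[of "fp_diff p q" q] rep_poly_relator[OF assms(1)] assms(2) by simp
  then show ?thesis using seminorm_relator[OF assms(1)] by simp
qed

lemma seminorm_one_le: "N (fp_word []) \<le> 1"
proof -
  have "N (fp_word []) = (N (fp_word []))\<^sup>2"
    using seminorm_square[of "fp_word []"]
    by (simp add: fp_closed fp_adj_word fp_mult_word word_adj_def)
  then have "N (fp_word []) = 0 \<or> N (fp_word []) = 1" by (auto simp: power2_eq_square)
  then show ?thesis by auto
qed

text \<open>
  By the C*-identity the square of the seminorm of a letter is the seminorm of \<open>l\<^sup>* l\<close>, which a relator identifies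
  with \<open>1\<close>; for \<open>S\<^sub>x\<^sup>*\<close> the bound follows from the one for \<open>S\<^sub>x\<close>.
\<close>

lemma seminorm_letter_le:
  assumes "l \<in> gens"
  shows "N (fp_word [l]) \<le> 1"
proof -
  have sq: "(N (fp_word [l]))\<^sup>2 = N (fp_word [letter_adj l, l])" if "l \<in> gens" for l
    using seminorm_square[of "fp_word [l]"] that
    by (simp add: fp_closed fp_adj_word fp_mult_word word_adj_def)
  have one: "N (fp_word [l]) \<le> 1" if "l \<in> gens" "N (fp_word [letter_adj l, l]) \<le> N (fp_word [])" for l
  proof -
    have "(N (fp_word [l]))\<^sup>2 \<le> 1" using sq[OF that(1)] that(2) seminorm_one_le by linarith
    then show ?thesis unfolding abs_square_le_1 by linarith
  qed
  have iso: "N (fp_word [Iso x]) \<le> 1" for x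
  proof (rule one)
    have "fp_diff (fp_word [Iso_adj x, Iso x]) (fp_scale (if x = x then 1 else 0) (fp_word [])) \<in> relators G \<phi>"
      unfolding relators_def by blast
    moreover have "fp_scale (if x = x then 1 else 0) (fp_word []) = (fp_word [] :: ('g, 'x) free_poly)"
      by (simp add: fp_scale_def)
    ultimately show "N (fp_word [letter_adj (Iso x), Iso x]) \<le> N (fp_word [])"
      using seminorm_relation by (simp add: fp_closed)
  qed simp
  show ?thesis
  proof (cases l)
    case (Grp g)
    then have "g \<in> carrier G" using assms by simp
    then have "fp_diff (fp_word [Grp_adj g, Grp g]) (fp_word []) \<in> relators G \<phi>"
      unfolding relators_def by blast
    then show ?thesis using seminorm_relation[of "fp_word [Grp_adj g, Grp g]" "fp_word []"] Grp assms
      by (intro one) (simp_all add: fp_closed)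
  next
    case (Grp_adj g)
    then have "g \<in> carrier G" using assms by simp
    then have "fp_diff (fp_word [Grp g, Grp_adj g]) (fp_word []) \<in> relators G \<phi>"
      unfolding relators_def by blast
    then show ?thesis using seminorm_relation[of "fp_word [Grp g, Grp_adj g]" "fp_word []"] Grp_adj assms
      by (intro one) (simp_all add: fp_closed)
  next
    case (Iso x)
    then show ?thesis using iso by simp
  next
    case (Iso_adj x)
    have "fp_adj (fp_word [Iso x]) = fp_word [l]"
      by (simp add: fp_adj_word word_adj_def Iso_adj)
    then show ?thesis using iso[of x] seminorm_adj[of "fp_word [Iso x]"] by (simp add: fp_closed)
  qed
qed

lemma seminorm_word_le: "u \<in> gen_words \<Longrightarrow> N (fp_word u) \<le> 1"
proof (induction u)
  case (Cons l u)
  then have lu: "l \<in> gens" "u \<in> gen_words" by auto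
  have "N (fp_word (l # u)) \<le> N (fp_word [l]) * N (fp_word u)"
    using seminorm_mult[of "fp_word [l]" "fp_word u"] lu by (simp add: fp_closed fp_mult_word)
  also have "\<dots> \<le> 1 * 1"
    using Cons.IH[OF lu(2)] seminorm_letter_le[OF lu(1)] lu
    by (intro mult_mono seminorm_nonneg) (auto simp: fp_closed)
  finally show ?case by simp
qed (rule seminorm_one_le)

text \<open>
  The bound by the sum of the absolute values of the coefficients holds for all seminorms at once, so the
  supremum that defines \<open>\<N>\<close> is finite.
\<close>

lemma seminorm_le:
  assumes "p \<in> \<F>"
  shows "N p \<le> (\<Sum>u | p u \<noteq> 0. cmod (p u))"
proof -
  have "N p \<le> (\<Sum>u\<in>F. cmod (p u))" if "finite F" "F \<subseteq> gen_words" "{u. p u \<noteq> 0} \<subseteq> F" for F p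
    using that
  proof (induction F arbitrary: p rule: finite_induct)
    case empty
    then have "p = fp_scale 0 (fp_word [])" by (auto simp: fp_scale_def)
    then show ?case using seminorm_scale[of "fp_word []" 0] by (simp add: fp_closed)
  next
    case (insert a F)
    let ?q = "p(a := 0)"
    have a: "fp_word a \<in> \<F>" using insert by (simp add: fp_closed)
    have q: "?q \<in> \<F>"
      by (rule free_star_algebra_subsetI[of _ F]) (use insert in auto)
    have "p = fp_add (fp_scale (p a) (fp_word a)) ?q"
      by (auto simp: fp_add_def fp_scale_def fp_word_def)
    then have "N p \<le> N (fp_scale (p a) (fp_word a)) + N ?q"
      using seminorm_add[OF fp_scale_closed[OF a, of "p a"] q] by simp
    also have "N (fp_scale (p a) (fp_word a)) \<le> cmod (p a) * 1"
      using seminorm_word_le[of a] insert.prems by (simp add: seminorm_scale[OF a] mult_left_le)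
    also have "N ?q \<le> (\<Sum>u\<in>F. cmod (?q u))" using insert.prems by (intro insert.IH) auto
    also have "\<dots> = (\<Sum>u\<in>F. cmod (p u))" using insert.hyps by (intro sum.cong) auto
    finally show ?case using insert.hyps by simp
  qed
  then show ?thesis using assms by (auto simp: free_star_algebra_iff)
qed

end

lemma max_norm_upper:
  assumes "cstar_seminorm G \<phi> N" "p \<in> \<F>"
  shows "N p \<le> \<N> p"
  unfolding max_norm_def
  by (rule cSUP_upper) (use assms seminorm_le[OF _ assms(2)] in \<open>auto intro!: bdd_aboveI2\<close>)

lemma max_norm_least:
  assumes "\<And>N. cstar_seminorm G \<phi> N \<Longrightarrow> N p \<le> B"
  shows "\<N> p \<le> B"
  unfolding max_norm_def by (rule cSUP_least) (use assms cstar_seminorm_rep in auto)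

lemma norm_rep_poly_le: "p \<in> \<F> \<Longrightarrow> norm (\<R> p) \<le> \<N> p"
  by (rule max_norm_upper[OF cstar_seminorm_rep])

lemma max_norm_nonneg: "p \<in> \<F> \<Longrightarrow> 0 \<le> \<N> p"
  using norm_rep_poly_le[of p] norm_ge_zero order_trans by blast

lemma max_norm_add:
  "p \<in> \<F> \<Longrightarrow> q \<in> \<F> \<Longrightarrow>
    \<N> (fp_add p q) \<le> \<N> p + \<N> q"
  by (rule max_norm_least) (meson add_mono max_norm_upper order_trans seminorm_add)

lemma max_norm_mult:
  "p \<in> \<F> \<Longrightarrow> q \<in> \<F> \<Longrightarrow>
    \<N> (fp_mult p q) \<le> \<N> p * \<N> q"
  by (rule max_norm_least) (meson max_norm_nonneg max_norm_upper mult_mono order_trans seminorm_mult seminorm_nonneg)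

lemma max_norm_scale_le:
  "p \<in> \<F> \<Longrightarrow> \<N> (fp_scale c p) \<le> cmod c * \<N> p"
  by (rule max_norm_least) (simp add: seminorm_scale max_norm_upper mult_left_mono)

lemma max_norm_adj_le: "p \<in> \<F> \<Longrightarrow> \<N> (fp_adj p) \<le> \<N> p"
  by (rule max_norm_least) (simp add: seminorm_adj max_norm_upper)

lemma max_norm_diff_self: "p \<in> \<F> \<Longrightarrow> \<N> (fp_diff p p) = 0"
  using max_norm_scale_le[of p 0] max_norm_nonneg[OF fp_scale_closed, of p 0] by (simp add: fp_diff_self)

section \<open>The reduced algebra as limits of polynomials\<close>

lemma max_CauchyI:
  assumes "\<And>n. p n \<in> \<F>"
    and "\<And>e. e > 0 \<Longrightarrow> \<exists>M. \<forall>m\<ge>M. \<forall>n\<ge>M. \<N> (fp_diff (p m) (p n)) < e"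
  shows "p \<in> max_Cauchy G \<phi>"
  using assms by (auto simp: max_Cauchy_def)

lemma max_Cauchy_closed: "p \<in> max_Cauchy G \<phi> \<Longrightarrow> p n \<in> \<F>"
  by (auto simp: max_Cauchy_def)

lemma max_CauchyD:
  "p \<in> max_Cauchy G \<phi> \<Longrightarrow> e > 0 \<Longrightarrow> \<exists>M. \<forall>m\<ge>M. \<forall>n\<ge>M. \<N> (fp_diff (p m) (p n)) < e"
  by (auto simp: max_Cauchy_def)

lemma rep_poly_convergent:
  assumes p: "p \<in> max_Cauchy G \<phi>"
  obtains T where "(\<lambda>n. \<R> (p n)) \<longlonglongrightarrow> T"
proof -
  have "Cauchy (\<lambda>n. \<R> (p n))"
  proof (rule CauchyI)
    fix e :: real assume "e > 0"
    then obtain M where M: "\<forall>m\<ge>M. \<forall>n\<ge>M. \<N> (fp_diff (p m) (p n)) < e"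
      using max_CauchyD[OF p] by blast
    have "norm (\<R> (p m) - \<R> (p n)) \<le> \<N> (fp_diff (p m) (p n))" for m n
      using norm_rep_poly_le[of "fp_diff (p m) (p n)"] max_Cauchy_closed[OF p]
      by (simp add: fp_closed rep_poly_diff)
    then show "\<exists>M. \<forall>m\<ge>M. \<forall>n\<ge>M. norm (\<R> (p m) - \<R> (p n)) < e"
      using M by (meson order_le_less_trans)
  qed
  then show ?thesis using that by (auto simp: Cauchy_convergent_iff convergent_def)
qed

text \<open>
  All representatives of a class have the same limit, because the representation is contractive
  for \<open>\<N>\<close>. This replaces the quotient and the description operator by explicit limits.
\<close>

lemma O_min_eq:
  "\<B> = {T. \<exists>p\<in>max_Cauchy G \<phi>. (\<lambda>n. \<R> (p n)) \<longlonglongrightarrow> T}"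
proof -
  define r where "r = {(p, q) \<in> max_Cauchy G \<phi> \<times> max_Cauchy G \<phi>.
    (\<lambda>n. \<N> (fp_diff (p n) (q n))) \<longlonglongrightarrow> 0}"
  have rep: "rep G \<phi> w (r `` {p}) = T"
    if p: "p \<in> max_Cauchy G \<phi>" and T: "(\<lambda>n. \<R> (p n)) \<longlonglongrightarrow> T" for p T
    unfolding rep_def
  proof (rule the_equality)
    show "\<forall>q\<in>r `` {p}. (\<lambda>n. \<R> (q n)) \<longlonglongrightarrow> T"
    proof
      fix q assume "q \<in> r `` {p}"
      then have q: "q \<in> max_Cauchy G \<phi>" and lim: "(\<lambda>n. \<N> (fp_diff (p n) (q n))) \<longlonglongrightarrow> 0"
        by (auto simp: r_def)
      have "(\<lambda>n. \<R> (p n) - \<R> (q n)) \<longlonglongrightarrow> 0"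
      proof (rule Lim_null_comparison[OF _ lim], rule always_eventually, rule allI)
        fix n show "norm (\<R> (p n) - \<R> (q n)) \<le> \<N> (fp_diff (p n) (q n))"
          using norm_rep_poly_le[of "fp_diff (p n) (q n)"] max_Cauchy_closed[OF p] max_Cauchy_closed[OF q]
          by (simp add: fp_closed rep_poly_diff)
      qed
      from tendsto_diff[OF T this] show "(\<lambda>n. \<R> (q n)) \<longlonglongrightarrow> T" by simp
    qed
    fix T' assume "\<forall>q\<in>r `` {p}. (\<lambda>n. \<R> (q n)) \<longlonglongrightarrow> T'"
    moreover have "p \<in> r `` {p}"
      using p by (simp add: r_def max_norm_diff_self max_Cauchy_closed)
    ultimately show "T' = T" using T LIMSEQ_unique by blast
  qed
  have "\<B> = (\<lambda>p. rep G \<phi> w (r `` {p})) ` max_Cauchy G \<phi>"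
    unfolding O_min_def O_max_def r_def[symmetric] quotient_def by blast
  also have "\<dots> = {T. \<exists>p\<in>max_Cauchy G \<phi>. (\<lambda>n. \<R> (p n)) \<longlonglongrightarrow> T}"
  proof (intro equalityI subsetI)
    fix T assume "T \<in> (\<lambda>p. rep G \<phi> w (r `` {p})) ` max_Cauchy G \<phi>"
    then obtain p where p: "p \<in> max_Cauchy G \<phi>" "T = rep G \<phi> w (r `` {p})" by blast
    obtain S where "(\<lambda>n. \<R> (p n)) \<longlonglongrightarrow> S" using rep_poly_convergent[OF p(1)] by blast
    then show "T \<in> {T. \<exists>p\<in>max_Cauchy G \<phi>. (\<lambda>n. \<R> (p n)) \<longlonglongrightarrow> T}"
      using p rep by auto
  next
    fix T assume "T \<in> {T. \<exists>p\<in>max_Cauchy G \<phi>. (\<lambda>n. \<R> (p n)) \<longlonglongrightarrow> T}"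
    then show "T \<in> (\<lambda>p. rep G \<phi> w (r `` {p})) ` max_Cauchy G \<phi>" using rep by (auto simp: image_iff)
  qed
  finally show ?thesis .
qed

lemma O_minE:
  assumes "T \<in> \<B>"
  obtains p where "p \<in> max_Cauchy G \<phi>" "\<And>n. p n \<in> \<F>" "(\<lambda>n. \<R> (p n)) \<longlonglongrightarrow> T"
  using assms max_Cauchy_closed unfolding O_min_eq by blast

lemma O_minI: "p \<in> max_Cauchy G \<phi> \<Longrightarrow> (\<lambda>n. \<R> (p n)) \<longlonglongrightarrow> T \<Longrightarrow> T \<in> \<B>"
  unfolding O_min_eq by blast

lemma max_Cauchy_contraction:
  assumes p: "p \<in> max_Cauchy G \<phi>" and q: "\<And>n. q n \<in> \<F>"
    and le: "\<And>m n. \<N> (fp_diff (q m) (q n)) \<le> c * \<N> (fp_diff (p m) (p n))"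
  shows "q \<in> max_Cauchy G \<phi>"
proof (rule max_CauchyI[OF q])
  fix e :: real assume e: "e > 0"
  have c: "0 < \<bar>c\<bar> + 1" by simp
  then obtain M where M: "\<forall>m\<ge>M. \<forall>n\<ge>M. \<N> (fp_diff (p m) (p n)) < e / (\<bar>c\<bar> + 1)"
    using max_CauchyD[OF p] e by (meson divide_pos_pos)
  have "\<N> (fp_diff (q m) (q n)) < e" if "m \<ge> M" "n \<ge> M" for m n
  proof -
    have "\<N> (fp_diff (q m) (q n)) \<le> (\<bar>c\<bar> + 1) * \<N> (fp_diff (p m) (p n))"
      using le[of m n] max_norm_nonneg[of "fp_diff (p m) (p n)"] max_Cauchy_closed[OF p]
      by (smt (verit) fp_diff_closed mult_right_mono)
    also have "\<dots> < (\<bar>c\<bar> + 1) * (e / (\<bar>c\<bar> + 1))"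
      using M that c by (intro mult_strict_left_mono) auto
    finally show ?thesis using c by simp
  qed
  then show "\<exists>M. \<forall>m\<ge>M. \<forall>n\<ge>M. \<N> (fp_diff (q m) (q n)) < e" by blast
qed

lemma O_min_scale: "S \<in> \<B> \<Longrightarrow> c \<cdot>\<^sub>\<complex> S \<in> \<B>"
proof (elim O_minE)
  fix p assume p: "p \<in> max_Cauchy G \<phi>" "\<And>n. p n \<in> \<F>" "(\<lambda>n. \<R> (p n)) \<longlonglongrightarrow> S"
  show ?thesis
  proof (rule O_minI)
    show "(\<lambda>n. fp_scale c (p n)) \<in> max_Cauchy G \<phi>"
      by (rule max_Cauchy_contraction[OF p(1), of _ "cmod c"])
        (auto simp: fp_closed p(2) fp_scale_diff max_norm_scale_le)
    show "(\<lambda>n. \<R> (fp_scale c (p n))) \<longlonglongrightarrow> c \<cdot>\<^sub>\<complex> S"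
      using tendsto_op_scale[OF p(3), of c] p(2) by (simp add: rep_poly_scale)
  qed
qed

lemma complex_linear_O_min: "S \<in> \<B> \<Longrightarrow> complex_linear S"
  by (elim O_minE) (auto intro: complex_linear_limit complex_linear_rep_poly)

lemma O_min_adj: "S \<in> \<B> \<Longrightarrow> op_adj S \<in> \<B>"
proof (elim O_minE)
  fix p assume p: "p \<in> max_Cauchy G \<phi>" "\<And>n. p n \<in> \<F>" "(\<lambda>n. \<R> (p n)) \<longlonglongrightarrow> S"
  show ?thesis
  proof (rule O_minI)
    show "(\<lambda>n. fp_adj (p n)) \<in> max_Cauchy G \<phi>"
      by (rule max_Cauchy_contraction[OF p(1), of _ 1])
        (auto simp: fp_closed p(2) fp_adj_diff max_norm_adj_le)
    show "(\<lambda>n. \<R> (fp_adj (p n))) \<longlonglongrightarrow> op_adj S"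
      using tendsto_op_adj[OF p(3)] p(2) by (simp add: rep_poly_adj complex_linear_rep_poly)
  qed
qed

lemma O_min_add:
  assumes "S \<in> \<B>" "T \<in> \<B>"
  shows "S + T \<in> \<B>"
proof -
  obtain p where p: "p \<in> max_Cauchy G \<phi>" "\<And>n. p n \<in> \<F>" "(\<lambda>n. \<R> (p n)) \<longlonglongrightarrow> S"
    using O_minE[OF assms(1)] by blast
  obtain q where q: "q \<in> max_Cauchy G \<phi>" "\<And>n. q n \<in> \<F>" "(\<lambda>n. \<R> (q n)) \<longlonglongrightarrow> T"
    using O_minE[OF assms(2)] by blast
  show ?thesis
  proof (rule O_minI)
    show "(\<lambda>n. fp_add (p n) (q n)) \<in> max_Cauchy G \<phi>"
    proof (rule max_CauchyI)
      fix e :: real assume "e > 0"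
      then have "e / 2 > 0" by simp
      with max_CauchyD[OF p(1)] max_CauchyD[OF q(1)] obtain M M' where
        M: "\<forall>m\<ge>M. \<forall>n\<ge>M. \<N> (fp_diff (p m) (p n)) < e / 2"
           "\<forall>m\<ge>M'. \<forall>n\<ge>M'. \<N> (fp_diff (q m) (q n)) < e / 2" by meson
      have "\<N> (fp_diff (fp_add (p m) (q m)) (fp_add (p n) (q n))) < e"
        if "m \<ge> max M M'" "n \<ge> max M M'" for m n
      proof -
        have "\<N> (fp_diff (p m) (p n)) < e / 2" "\<N> (fp_diff (q m) (q n)) < e / 2"
          using M that by auto
        then show ?thesis unfolding fp_add_diff
          using max_norm_add[of "fp_diff (p m) (p n)" "fp_diff (q m) (q n)"] p(2) q(2)
          by (simp add: fp_closed)
      qed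
      then show "\<exists>M. \<forall>m\<ge>M. \<forall>n\<ge>M. \<N> (fp_diff (fp_add (p m) (q m)) (fp_add (p n) (q n))) < e"
        by blast
    qed (simp add: fp_closed p q)
    show "(\<lambda>n. \<R> (fp_add (p n) (q n))) \<longlonglongrightarrow> S + T"
      using tendsto_add[OF p(3) q(3)] p(2) q(2) by (simp add: rep_poly_add)
  qed
qed

lemma max_Cauchy_bounded:
  assumes p: "p \<in> max_Cauchy G \<phi>"
  obtains B where "B > 0" "\<And>n. \<N> (p n) \<le> B"
proof -
  note pc = max_Cauchy_closed[OF p]
  obtain M where M: "\<forall>m\<ge>M. \<forall>n\<ge>M. \<N> (fp_diff (p m) (p n)) < 1"
    using max_CauchyD[OF p, of 1] by auto
  define B where "B = 1 + (\<Sum>n\<le>M. \<N> (p n))"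
  have pos: "0 \<le> \<N> (p n)" for n by (rule max_norm_nonneg[OF pc])
  have le: "\<N> (p n) \<le> (\<Sum>n\<le>M. \<N> (p n))" if "n \<le> M" for n
    by (rule member_le_sum) (use that pos in auto)
  have "\<N> (p n) \<le> B" for n
  proof (cases "n \<le> M")
    case False
    have "p n = fp_add (fp_diff (p n) (p M)) (p M)" by (simp add: fp_add_def fp_diff_def)
    then have "\<N> (p n) \<le> \<N> (fp_diff (p n) (p M)) + \<N> (p M)"
      using max_norm_add[OF fp_diff_closed[OF pc pc] pc] by metis
    moreover have "\<N> (fp_diff (p n) (p M)) < 1" using M False by simp
    ultimately show ?thesis using le[of M] by (simp add: B_def)
  qed (use le in \<open>simp add: B_def add_increasing\<close>)
  moreover have "B > 0" using sum_nonneg[of "{..M}" "\<lambda>n. \<N> (p n)"] pos by (simp add: B_def)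
  ultimately show ?thesis using that by blast
qed

lemma O_min_compose:
  assumes "S \<in> \<B>" "T \<in> \<B>"
  shows "S o\<^sub>L T \<in> \<B>"
proof -
  obtain p where p: "p \<in> max_Cauchy G \<phi>" "\<And>n. p n \<in> \<F>" "(\<lambda>n. \<R> (p n)) \<longlonglongrightarrow> S"
    using O_minE[OF assms(1)] by blast
  obtain q where q: "q \<in> max_Cauchy G \<phi>" "\<And>n. q n \<in> \<F>" "(\<lambda>n. \<R> (q n)) \<longlonglongrightarrow> T"
    using O_minE[OF assms(2)] by blast
  obtain B where B: "B > 0" "\<And>n. \<N> (p n) \<le> B" using max_Cauchy_bounded[OF p(1)] by blast
  obtain C where C: "C > 0" "\<And>n. \<N> (q n) \<le> C" using max_Cauchy_bounded[OF q(1)] by blast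
  show ?thesis
  proof (rule O_minI)
    show "(\<lambda>n. fp_mult (p n) (q n)) \<in> max_Cauchy G \<phi>"
    proof (rule max_CauchyI)
      fix e :: real assume "e > 0"
      then have "e / (2 * C) > 0" "e / (2 * B) > 0" using B C by auto
      with max_CauchyD[OF p(1)] max_CauchyD[OF q(1)] obtain M M' where
        M: "\<forall>m\<ge>M. \<forall>n\<ge>M. \<N> (fp_diff (p m) (p n)) < e / (2 * C)"
           "\<forall>m\<ge>M'. \<forall>n\<ge>M'. \<N> (fp_diff (q m) (q n)) < e / (2 * B)" by meson
      have "\<N> (fp_diff (fp_mult (p m) (q m)) (fp_mult (p n) (q n))) < e"
        if "m \<ge> max M M'" "n \<ge> max M M'" for m n
      proof -
        have lt: "\<N> (fp_diff (p m) (p n)) < e / (2 * C)"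
          "\<N> (fp_diff (q m) (q n)) < e / (2 * B)"
          using M that by auto
        have "\<N> (fp_diff (fp_mult (p m) (q m)) (fp_mult (p n) (q n))) \<le>
          \<N> (fp_mult (p m) (fp_diff (q m) (q n))) + \<N> (fp_mult (fp_diff (p m) (p n)) (q n))"
          unfolding fp_mult_diff by (rule max_norm_add) (simp_all add: fp_closed p(2) q(2))
        also have "\<N> (fp_mult (p m) (fp_diff (q m) (q n))) \<le> B * \<N> (fp_diff (q m) (q n))"
          using B(2)[of m] p(2) q(2)
          by (meson fp_diff_closed max_norm_mult max_norm_nonneg mult_right_mono order_trans)
        also have "B * \<N> (fp_diff (q m) (q n)) < e / 2"
          using mult_strict_left_mono[OF lt(2) B(1)] B(1) by simp
        also have "\<N> (fp_mult (fp_diff (p m) (p n)) (q n)) \<le> \<N> (fp_diff (p m) (p n)) * C"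
          using C(2)[of n] p(2) q(2)
          by (meson fp_diff_closed max_norm_mult max_norm_nonneg mult_left_mono order_trans)
        also have "\<N> (fp_diff (p m) (p n)) * C < e / 2"
          using mult_strict_right_mono[OF lt(1) C(1)] C(1) by simp
        finally show ?thesis by simp
      qed
      then show "\<exists>M. \<forall>m\<ge>M. \<forall>n\<ge>M. \<N> (fp_diff (fp_mult (p m) (q m)) (fp_mult (p n) (q n))) < e"
        by blast
    qed (simp add: fp_closed p q)
    show "(\<lambda>n. \<R> (fp_mult (p n) (q n))) \<longlonglongrightarrow> (S o\<^sub>L T)"
      using tendsto_compose[OF p(3) q(3)] p(2) q(2) by (simp add: rep_poly_mult)
  qed
qed

lemma rep_poly_in_O_min: "p \<in> \<F> \<Longrightarrow> \<R> p \<in> \<B>"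
  by (rule O_minI[of "\<lambda>_. p"]) (auto intro: max_CauchyI simp: max_norm_diff_self)

lemma generated_subset_O_min: "generated_star_algebra G \<phi> w \<subseteq> \<B>"
  by (auto simp: generated_star_algebra_def rep_poly_in_O_min)

lemma rep_word_in_generated: "u \<in> gen_words \<Longrightarrow> \<W> u \<in> generated_star_algebra G \<phi> w"
  unfolding generated_star_algebra_def by (metis fp_word_closed image_eqI rep_poly_word)

lemma rep_word_in_O_min: "u \<in> gen_words \<Longrightarrow> \<W> u \<in> \<B>"
  using rep_word_in_generated generated_subset_O_min by blast

lemma O_min_diff: "S \<in> \<B> \<Longrightarrow> T \<in> \<B> \<Longrightarrow> S - T \<in> \<B>"
  using O_min_add[of S "(-1) \<cdot>\<^sub>\<complex> T"] O_min_scale[of T "-1"] by (simp add: op_scale_minus_one)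

end


section \<open>The degree on the orbit\<close>

lemma prefix_conc_eq_iff:
  "prefix m (u \<frown> a) = prefix m (u \<frown> b) \<longleftrightarrow> prefix (m - length u) a = prefix (m - length u) b"
proof (cases "m \<le> length u")
  case True
  then show ?thesis by (auto simp: prefix_eq_iff)
next
  case False
  then obtain k where "m = length u + k" using le_Suc_ex nat_le_linear by blast
  then show ?thesis by (simp add: prefix_add_eq_iff)
qed

locale generic_representation = orbit_representation G \<phi> w
  for G :: "('g, 'b) monoid_scheme" and \<phi> :: "'g \<Rightarrow> ('x::finite) word \<Rightarrow> 'x word" and w +
  assumes two_letters: "CARD('x) \<ge> 2"
    and strictly_generic: "strictly_generic G \<phi> w"
begin

text \<open>
  Suppose the partial map \<open>u\<^sub>2 z \<mapsto> u\<^sub>1 g(z)\<close> fixes \<open>w\<close>, hence all points near \<open>w\<close>. Change \<open>z\<close> in a single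
  place \<open>n\<close> far out. Since \<open>g\<close> is an isometry, the first difference is at place \<open>|u\<^sub>2| + n\<close> before the
  map is applied and at place \<open>|u\<^sub>1| + n\<close> after it; as both points are fixed, these places agree.
\<close>

lemma generic_length:
  assumes g: "g \<in> carrier G" and w: "w = u\<^sub>2 \<frown> z" "w = u\<^sub>1 \<frown> \<phi> g z"
  shows "length u\<^sub>1 = length u\<^sub>2"
proof -
  define f where "f = (\<lambda>a. map_option (\<lambda>v. u\<^sub>1 \<frown> \<phi> g v) (T_star u\<^sub>2 a))"
  have f: "f (u\<^sub>2 \<frown> a) = Some (u\<^sub>1 \<frown> \<phi> g a)" for a by (simp add: f_def)
  have "f \<in> partial_maps G \<phi>" unfolding f_def partial_maps_def using g by blast
  moreover have "f w = Some w" using f[of z] w by simp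
  ultimately obtain U where "openin word_topology U" "w \<in> U" and U: "\<And>v. v \<in> U \<Longrightarrow> f v = Some v"
    using strictly_generic unfolding strictly_generic_def by fastforce
  then obtain n where n: "\<And>b. prefix n b = prefix n w \<Longrightarrow> b \<in> U"
    using openin_word_topologyD by metis
  obtain y where y: "y \<noteq> z n"
  proof (rule ccontr)
    assume "\<not> thesis"
    then have "UNIV = {z n}" using that by blast
    then have "CARD('x) = 1" by (metis card_1_singleton_iff One_nat_def)
    then show False using two_letters by simp
  qed
  define z' where "z' = z(n := y)"
  have z': "prefix m z = prefix m z' \<longleftrightarrow> m \<le> n" for m
    using y by (auto simp: prefix_eq_iff z'_def not_less)
  have "prefix n (u\<^sub>2 \<frown> z) = prefix n (u\<^sub>2 \<frown> z')" by (simp add: prefix_conc_eq_iff z')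
  then have "u\<^sub>2 \<frown> z' \<in> U" using w by (intro n) simp
  then have eq: "u\<^sub>1 \<frown> \<phi> g z' = u\<^sub>2 \<frown> z'" using U f[of z'] by simp
  have "m \<le> n + length u\<^sub>1 \<longleftrightarrow> m \<le> n + length u\<^sub>2" for m
  proof -
    have "prefix m (u\<^sub>1 \<frown> \<phi> g z) = prefix m (u\<^sub>1 \<frown> \<phi> g z') \<longleftrightarrow>
        prefix m (u\<^sub>2 \<frown> z) = prefix m (u\<^sub>2 \<frown> z')"
      using w eq by simp
    then show ?thesis
      by (simp add: prefix_conc_eq_iff prefix_act_eq_iff[OF g] z' le_diff_conv add.commute)
  qed
  from this[of "n + length u\<^sub>1"] this[of "n + length u\<^sub>2"] show ?thesis by simp
qed

text \<open>
  The degree of a point of the orbit is the change of length along a partial map that leads from \<open>w\<close>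
  to it; it is a relation first, since the partial map is not unique.
\<close>

definition degree_at :: "'x word \<Rightarrow> int \<Rightarrow> bool"
  where "degree_at v k \<longleftrightarrow> (\<exists>u\<^sub>1 g u\<^sub>2 z. g \<in> carrier G \<and> w = u\<^sub>2 \<frown> z \<and> v = u\<^sub>1 \<frown> \<phi> g z \<and>
    k = int (length u\<^sub>1) - int (length u\<^sub>2))"

lemma lengthen:
  assumes "g \<in> carrier G" "w = u\<^sub>2 \<frown> z" "v = u\<^sub>1 \<frown> \<phi> g z"
  obtains u\<^sub>1' g' u\<^sub>2' z' where "g' \<in> carrier G" "w = u\<^sub>2' \<frown> z'" "v = u\<^sub>1' \<frown> \<phi> g' z'"
    "length u\<^sub>1' = length u\<^sub>1 + j" "length u\<^sub>2' = length u\<^sub>2 + j"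
proof -
  obtain h y where h: "h \<in> carrier G" "length y = j" "\<And>a. \<phi> g (prefix j z \<frown> a) = y \<frown> \<phi> h a"
    using self_similar_word[OF assms(1), of "prefix j z"] unfolding length_prefix by blast
  show ?thesis
  proof (rule that[OF h(1)])
    show "w = (u\<^sub>2 @ prefix j z) \<frown> suffix j z"
      by (simp add: conc_conc[symmetric] prefix_conc_suffix assms(2) del: conc_conc)
    show "v = (u\<^sub>1 @ y) \<frown> \<phi> h (suffix j z)"
      using h(3)[of "suffix j z"] by (simp add: assms(3) prefix_conc_suffix)
  qed (simp_all add: h(2))
qed

text \<open>
  Two descriptions of a point are lengthened until they start with words of the same length; their
  quotient is then an element of the partial monoid that fixes the point \<open>w\<close>.
\<close>

lemma degree_at_unique:
  assumes "degree_at v k" "degree_at v l"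
  shows "k = l"
proof -
  obtain u\<^sub>1 g u\<^sub>2 z where g: "g \<in> carrier G" "w = u\<^sub>2 \<frown> z" "v = u\<^sub>1 \<frown> \<phi> g z"
    and k: "k = int (length u\<^sub>1) - int (length u\<^sub>2)"
    using assms(1) unfolding degree_at_def by blast
  obtain v\<^sub>1 h v\<^sub>2 y where h: "h \<in> carrier G" "w = v\<^sub>2 \<frown> y" "v = v\<^sub>1 \<frown> \<phi> h y"
    and l: "l = int (length v\<^sub>1) - int (length v\<^sub>2)"
    using assms(2) unfolding degree_at_def by blast
  \<comment> \<open>Lengthening each description by the length of the other one makes the first words equally long.\<close>
  obtain u\<^sub>1' g' u\<^sub>2' z' where g': "g' \<in> carrier G" "w = u\<^sub>2' \<frown> z'" "v = u\<^sub>1' \<frown> \<phi> g' z'"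
    "length u\<^sub>1' = length u\<^sub>1 + length v\<^sub>1" "length u\<^sub>2' = length u\<^sub>2 + length v\<^sub>1"
    by (rule lengthen[OF g])
  obtain v\<^sub>1' h' v\<^sub>2' y' where h': "h' \<in> carrier G" "w = v\<^sub>2' \<frown> y'" "v = v\<^sub>1' \<frown> \<phi> h' y'"
    "length v\<^sub>1' = length v\<^sub>1 + length u\<^sub>1" "length v\<^sub>2' = length v\<^sub>2 + length u\<^sub>1"
    by (rule lengthen[OF h])
  have "\<phi> g' z' = \<phi> h' y'"
    using conc_eq_conc_iff[of u\<^sub>1' v\<^sub>1' "\<phi> g' z'" "\<phi> h' y'"] g'(3,4) h'(3,4) by simp
  then have "y' = \<phi> (inv\<^bsub>G\<^esub> h' \<otimes>\<^bsub>G\<^esub> g') z'" using g'(1) h'(1) by (simp only: act_mult inv_closed act_inv)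
  then have "w = v\<^sub>2' \<frown> \<phi> (inv\<^bsub>G\<^esub> h' \<otimes>\<^bsub>G\<^esub> g') z'" using h'(2) by (simp only:)
  then have "length v\<^sub>2' = length u\<^sub>2'" using g' h' by (intro generic_length[OF _ g'(2)]) simp_all
  then show ?thesis unfolding k l using g'(5) h'(5) by simp
qed

definition orbit_degree :: "'x word \<Rightarrow> int"
  where "orbit_degree v = (THE k. degree_at v k)"

lemma orbit_degree_eq: "degree_at v k \<Longrightarrow> orbit_degree v = k"
  unfolding orbit_degree_def using degree_at_unique by blast

lemma degree_at_orbit: "v \<in> \<O> \<Longrightarrow> degree_at v (orbit_degree v)"
  using orbit_degree_eq unfolding degree_at_def orbit_iff by metis

lemma degree_at_conc:
  assumes "degree_at v k"
  shows "degree_at (u \<frown> v) (int (length u) + k)"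
proof -
  obtain u\<^sub>1 g u\<^sub>2 z where g: "g \<in> carrier G" "w = u\<^sub>2 \<frown> z" "v = u\<^sub>1 \<frown> \<phi> g z"
    and k: "k = int (length u\<^sub>1) - int (length u\<^sub>2)"
    using assms unfolding degree_at_def by blast
  show ?thesis unfolding degree_at_def
    by (rule exI[of _ "u @ u\<^sub>1"], rule exI[of _ g], rule exI[of _ u\<^sub>2], rule exI[of _ z])
      (use g k in simp)
qed

lemma degree_at_act:
  assumes "degree_at v k" and h: "h \<in> carrier G"
  shows "degree_at (\<phi> h v) k"
proof -
  obtain u\<^sub>1 g u\<^sub>2 z where g: "g \<in> carrier G" "w = u\<^sub>2 \<frown> z" "v = u\<^sub>1 \<frown> \<phi> g z"
    and k: "k = int (length u\<^sub>1) - int (length u\<^sub>2)"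
    using assms(1) unfolding degree_at_def by blast
  obtain h' y where h': "h' \<in> carrier G" "length y = length u\<^sub>1" "\<And>a. \<phi> h (u\<^sub>1 \<frown> a) = y \<frown> \<phi> h' a"
    using self_similar_word[OF h, of u\<^sub>1] by blast
  show ?thesis unfolding degree_at_def
    by (rule exI[of _ y], rule exI[of _ "h' \<otimes>\<^bsub>G\<^esub> g"], rule exI[of _ u\<^sub>2], rule exI[of _ z])
      (use g h' k in \<open>simp add: act_mult\<close>)
qed

lemma orbit_degree_conc: "v \<in> \<O> \<Longrightarrow> orbit_degree (u \<frown> v) = int (length u) + orbit_degree v"
  by (intro orbit_degree_eq degree_at_conc degree_at_orbit)

lemma orbit_degree_act: "v \<in> \<O> \<Longrightarrow> g \<in> carrier G \<Longrightarrow> orbit_degree (\<phi> g v) = orbit_degree v"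
  by (intro orbit_degree_eq degree_at_act degree_at_orbit)

lemma orbit_degree_letter_map:
  assumes "l \<in> gens" "letter_map l v = Some v'"
  shows "orbit_degree v' = letter_degree l + orbit_degree v"
proof (cases l)
  case (Iso_adj x)
  then have v: "v \<in> \<O>" "v' = suffix (Suc 0) v" using assms by (auto split: if_splits)
  then have "v = [v 0] \<frown> v'" by (simp add: hd_conc_suffix)
  moreover have "v' \<in> \<O>" using v suffix_in_orbit by simp
  ultimately have "orbit_degree v = 1 + orbit_degree v'" using orbit_degree_conc[of v' "[v 0]"] by simp
  then show ?thesis using Iso_adj by simp
qed (use assms orbit_degree_conc[of v "[_]"] in \<open>auto split: if_splits simp: orbit_degree_act\<close>)

lemma orbit_degree_word_map:
  "u \<in> gen_words \<Longrightarrow> word_map u v = Some v' \<Longrightarrow> orbit_degree v' = word_degree u + orbit_degree v"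
proof (induction u arbitrary: v')
  case Nil
  then show ?case by (auto simp: word_map_Nil split: if_splits)
next
  case (Cons l u)
  then show ?case by (auto simp: word_map_Cons map_comp_Some_iff dest: orbit_degree_letter_map)
qed

text \<open>
  This is where strict genericity enters the computation of the state: words of nonzero degree have zero
  diagonal.
\<close>

lemma word_map_fixed_point: "u \<in> gen_words \<Longrightarrow> word_map u v = Some v \<Longrightarrow> word_degree u = 0"
  using orbit_degree_word_map by fastforce

section \<open>The gauge action is spatially implemented\<close>

definition gauge_aut :: "real \<Rightarrow> 'x word ell2_op \<Rightarrow> 'x word ell2_op"
  where "gauge_aut t = phase_conj (\<lambda>v. t * of_int (orbit_degree v))"

lemma gauge_add: "gauge_aut t (S + T) = gauge_aut t S + gauge_aut t T"
  and gauge_compose: "gauge_aut t (S o\<^sub>L T) = gauge_aut t S o\<^sub>L gauge_aut t T"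
  and gauge_scale: "gauge_aut t (c \<cdot>\<^sub>\<complex> S) = c \<cdot>\<^sub>\<complex> gauge_aut t S"
  and gauge_adj: "complex_linear S \<Longrightarrow> gauge_aut t (op_adj S) = op_adj (gauge_aut t S)"
  and norm_gauge: "norm (gauge_aut t S) = norm S"
  and gauge_minus: "gauge_aut (- t) (gauge_aut t S) = S"
  and tendsto_gauge: "(X \<longlongrightarrow> S) F \<Longrightarrow> ((\<lambda>n. gauge_aut t (X n)) \<longlongrightarrow> gauge_aut t S) F"
  unfolding gauge_aut_def
  using phase_conj_inverse[of "\<lambda>v. t * of_int (orbit_degree v)"]
  by (simp_all add: phase_conj_add phase_conj_compose phase_conj_scale phase_conj_adj norm_phase_conj
     tendsto_phase_conj)

lemma gauge_rep_word:
  assumes u: "u \<in> gen_words"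
  shows "gauge_aut t (\<W> u) = cis (t * of_int (word_degree u)) \<cdot>\<^sub>\<complex> \<W> u"
proof (rule ell2_op_eqI)
  note lin = complex_linear_rep_word[OF u] complex_linear_phase_op
  show "complex_linear (gauge_aut t (\<W> u))"
    unfolding gauge_aut_def phase_conj_def by (intro complex_linear_compose lin)
  show "complex_linear (cis (t * of_int (word_degree u)) \<cdot>\<^sub>\<complex> \<W> u)"
    by (intro complex_linear_scale lin)
  fix v
  show "blinfun_apply (gauge_aut t (\<W> u)) (\<delta> v) =
    blinfun_apply (cis (t * of_int (word_degree u)) \<cdot>\<^sub>\<complex> \<W> u) (\<delta> v)"
  proof (cases "word_map u v")
    case None
    then show ?thesis
      by (simp add: gauge_aut_def phase_conj_def phase_op_basis complex_linearD[OF lin(1)]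
          complex_linearD[OF lin(2)] rep_word_basis[OF u] op_scale_apply)
  next
    case (Some v')
    have "orbit_degree v' = word_degree u + orbit_degree v"
      by (rule orbit_degree_word_map[OF u Some])
    then show ?thesis using Some
      by (simp add: gauge_aut_def phase_conj_def phase_op_basis complex_linearD[OF lin(1)]
          complex_linearD[OF lin(2)] rep_word_basis[OF u] op_scale_apply cscale_cscale cis_mult algebra_simps)
  qed
qed

text \<open>
  The gauge action on the free *-algebra. It preserves \<open>\<N>\<close>, and this carries it over to limits of
  \<open>\<N>\<close>-Cauchy sequences.
\<close>

definition fp_rotate :: "real \<Rightarrow> ('g, 'x) free_poly \<Rightarrow> ('g, 'x) free_poly"
  where "fp_rotate t p = (\<lambda>u. cis (t * of_int (word_degree u)) * p u)"

lemma fp_rotate_closed: "p \<in> \<F> \<Longrightarrow> fp_rotate t p \<in> \<F>"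
  by (rule free_star_algebra_subsetI[of _ "{u. p u \<noteq> 0}"])
    (auto simp: fp_rotate_def free_star_algebra_iff)

lemma gauge_sum: "gauge_aut t (\<Sum>i\<in>I. X i) = (\<Sum>i\<in>I. gauge_aut t (X i))"
proof (induction I rule: infinite_finite_induct)
  case (insert i I)
  then show ?case by (simp add: gauge_add)
qed (use gauge_add[of t 0 0] in auto)

lemma gauge_rep_poly:
  assumes "p \<in> \<F>"
  shows "gauge_aut t (\<R> p) = \<R> (fp_rotate t p)"
proof -
  have "\<R> (fp_rotate t p) = (\<Sum>u | p u \<noteq> 0. fp_rotate t p u \<cdot>\<^sub>\<complex> \<W> u)"
    by (rule rep_poly_superset) (use assms in \<open>auto simp: free_star_algebra_iff fp_rotate_def\<close>)
  also have "\<dots> = gauge_aut t (\<R> p)"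
    unfolding rep_poly_def gauge_sum
    by (rule sum.cong) (use assms in \<open>auto simp: free_star_algebra_iff subset_iff fp_rotate_def gauge_scale
      gauge_rep_word op_scale_op_scale mult.commute\<close>)
  finally show ?thesis ..
qed

lemma fp_rotate_add: "fp_rotate t (fp_add p q) = fp_add (fp_rotate t p) (fp_rotate t q)"
  and fp_rotate_diff: "fp_rotate t (fp_diff p q) = fp_diff (fp_rotate t p) (fp_rotate t q)"
  and fp_rotate_scale: "fp_rotate t (fp_scale c p) = fp_scale c (fp_rotate t p)"
  by (auto simp: fp_rotate_def fp_add_def fp_diff_def fp_scale_def algebra_simps)

lemma fp_rotate_adj: "fp_rotate t (fp_adj p) = fp_adj (fp_rotate t p)"
  by (auto simp: fp_rotate_def fp_adj_def cis_cnj)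

lemma fp_rotate_mult: "fp_rotate t (fp_mult p q) = fp_mult (fp_rotate t p) (fp_rotate t q)"
proof
  fix u
  have "cis (t * of_int (word_degree u)) =
      cis (t * of_int (word_degree (take k u))) * cis (t * of_int (word_degree (drop k u)))" for k
    using word_degree_simps(3)[of "take k u" "drop k u"] by (simp add: cis_mult algebra_simps)
  then show "fp_rotate t (fp_mult p q) u = fp_mult (fp_rotate t p) (fp_rotate t q) u"
    unfolding fp_rotate_def fp_mult_def sum_distrib_left
    by (intro sum.cong refl) (simp add: algebra_simps)
qed

lemma fp_rotate_homogeneous:
  "(\<And>u. p u \<noteq> 0 \<Longrightarrow> word_degree u = k) \<Longrightarrow> fp_rotate t p = fp_scale (cis (t * of_int k)) p"
proof
  fix u assume "\<And>u. p u \<noteq> 0 \<Longrightarrow> word_degree u = k"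
  then show "fp_rotate t p u = fp_scale (cis (t * of_int k)) p u"
    by (cases "p u = 0") (simp_all add: fp_rotate_def fp_scale_def)
qed

text \<open>
  All relators are homogeneous, so rotation multiplies them by scalars, and a seminorm that vanishes on the
  relators still does so after rotation.
\<close>

lemma fp_rotate_relator:
  assumes "r \<in> relators G \<phi>"
  obtains c where "fp_rotate t r = fp_scale c r"
proof -
  have "\<exists>k. \<forall>u. r u \<noteq> 0 \<longrightarrow> word_degree u = k"
    using assms unfolding relators_def
  proof (elim UnE CollectE exE conjE singletonE)
    fix g x v h assume "r = fp_diff (fp_word [Grp g, Iso x]) (fp_word [Iso v, Grp h])"
    then show ?thesis by (intro exI[of _ 1]) (auto simp: fp_diff_def fp_word_def split: if_splits)
  next
    assume r: "r = fp_diff (\<lambda>u. \<Sum>x\<in>UNIV. fp_word [Iso x, Iso_adj x] u) (fp_word [])"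
    have "word_degree u = 0" if u: "r u \<noteq> 0" for u
    proof (rule ccontr)
      assume "word_degree u \<noteq> 0"
      then have "u \<noteq> []" "\<And>x. u \<noteq> [Iso x, Iso_adj x]" by auto
      then have "r u = 0" by (simp add: r fp_diff_def fp_word_def)
      then show False using u by simp
    qed
    then show ?thesis by blast
  qed (intro exI[of _ 0], auto simp: fp_diff_def fp_word_def fp_scale_def split: if_splits)+
  then show ?thesis using fp_rotate_homogeneous that by blast
qed

lemma cstar_seminorm_rotate:
  assumes N: "cstar_seminorm G \<phi> N"
  shows "cstar_seminorm G \<phi> (\<lambda>p. N (fp_rotate t p))"
proof -
  have "N (fp_rotate t r) = 0" if r: "r \<in> relators G \<phi>" for r
  proof -
    obtain c where "fp_rotate t r = fp_scale c r" using fp_rotate_relator[OF r] by blast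
    then show ?thesis using rep_poly_relator[OF r] seminorm_relator[OF N r] by (simp add: seminorm_scale[OF N])
  qed
  then show ?thesis
    unfolding cstar_seminorm_def
    by (auto simp: fp_rotate_closed fp_rotate_mult fp_rotate_adj fp_rotate_scale fp_rotate_add
        seminorm_nonneg[OF N] seminorm_square[OF N] seminorm_scale[OF N] seminorm_add[OF N] seminorm_mult[OF N])
qed

lemma max_norm_rotate_le: "p \<in> \<F> \<Longrightarrow> \<N> (fp_rotate t p) \<le> \<N> p"
  by (rule max_norm_least) (rule max_norm_upper[OF cstar_seminorm_rotate])

text \<open>
  Conjugation by the diagonal unitary preserves the reduced algebra, because the Cauchy sequences
  that define it can be rotated.
\<close>

lemma gauge_O_min: "S \<in> \<B> \<Longrightarrow> gauge_aut t S \<in> \<B>"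
proof (elim O_minE)
  fix p assume p: "p \<in> max_Cauchy G \<phi>" "\<And>n. p n \<in> \<F>" "(\<lambda>n. \<R> (p n)) \<longlonglongrightarrow> S"
  show ?thesis
  proof (rule O_minI)
    show "(\<lambda>n. fp_rotate t (p n)) \<in> max_Cauchy G \<phi>"
      by (rule max_Cauchy_contraction[OF p(1), of _ 1])
        (auto simp: fp_rotate_closed p(2) fp_rotate_diff[symmetric] max_norm_rotate_le fp_closed)
    show "(\<lambda>n. \<R> (fp_rotate t (p n))) \<longlonglongrightarrow> gauge_aut t S"
      using tendsto_gauge[OF p(3), of t] p(2) by (simp add: gauge_rep_poly)
  qed
qed

lemma star_automorphism_gauge:
  "star_automorphism (\<B>) (restrict (gauge_aut t) (\<B>))"
proof -
  have "bij_betw (gauge_aut t) (\<B>) (\<B>)"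
    using gauge_minus[of t] gauge_minus[of "- t"]
    by (intro bij_betw_byWitness[where f' = "gauge_aut (- t)"]) (auto simp: gauge_O_min)
  then have "bij_betw (restrict (gauge_aut t) (\<B>)) (\<B>) (\<B>)"
    by (simp cong: bij_betw_cong)
  then show ?thesis
    unfolding star_automorphism_def
    by (simp add: O_min_add O_min_compose O_min_scale O_min_adj gauge_add gauge_compose gauge_scale
        gauge_adj complex_linear_O_min norm_gauge)
qed

lemma rep_word_Cons:
  "l \<in> gens \<Longrightarrow> u \<in> gen_words \<Longrightarrow>
    \<W> (l # u) = \<W> [l] o\<^sub>L \<W> u"
  using rep_word_append[of "[l]" u] by simp

text \<open>
  The prescribed values determine the automorphism on letters and their adjoints, hence on words and
  polynomials, and isometry determines it on limits.
\<close>

lemma star_automorphism_eq_gauge: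
  assumes \<alpha>: "star_automorphism (\<B>) \<alpha>"
    and grp: "\<And>g. g \<in> carrier G \<Longrightarrow> \<alpha> (grp_op G \<phi> w g) = grp_op G \<phi> w g"
    and iso: "\<And>x. \<alpha> (S_op G \<phi> w [x]) = cis t \<cdot>\<^sub>\<complex> S_op G \<phi> w [x]"
    and a: "a \<in> \<B>"
  shows "\<alpha> a = gauge_aut t a"
proof -
  have add: "\<alpha> (a + b) = \<alpha> a + \<alpha> b" and comp: "\<alpha> (a o\<^sub>L b) = \<alpha> a o\<^sub>L \<alpha> b"
    and scale: "\<alpha> (c \<cdot>\<^sub>\<complex> a) = c \<cdot>\<^sub>\<complex> \<alpha> a" and adj: "\<alpha> (op_adj a) = op_adj (\<alpha> a)"
    and norm: "norm (\<alpha> a) = norm a"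
    if "a \<in> \<B>" "b \<in> \<B>" for a b c
    using \<alpha> that by (auto simp: star_automorphism_def)
  note W = rep_word_in_O_min
  have letter: "\<alpha> (\<W> [l]) = gauge_aut t (\<W> [l])" if l: "l \<in> gens" for l
  proof -
    have pos: "\<alpha> (\<W> [k]) = gauge_aut t (\<W> [k])"
      if "k \<in> gens" "k \<in> range Grp \<union> range Iso" for k
      using that grp iso by (auto simp: gauge_rep_word grp_op_def S_op_def)
    show ?thesis
    proof (cases "l \<in> range Grp \<union> range Iso")
      case False
      then have k: "letter_adj l \<in> gens" "letter_adj l \<in> range Grp \<union> range Iso"
        using l by (cases l; auto)+
      have "\<W> [l] = op_adj (\<W> [letter_adj l])"
        using l by (simp add: op_adj_rep_word)
      then show ?thesis
        using pos[OF k] adj[OF W W, of "[letter_adj l]" "[]"] k(1) by (simp add: gauge_adj complex_linear_rep_word)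
    qed (use pos l in blast)
  qed
  have word: "\<alpha> (\<W> u) = gauge_aut t (\<W> u)" if "u \<in> gen_words" for u
    using that
  proof (induction u)
    case Nil
    have "\<W> [] = grp_op G \<phi> w \<one>\<^bsub>G\<^esub>"
      unfolding grp_op_def by (rule rep_word_eqI) (simp_all add: word_map_Nil word_map_Cons)
    then show ?case using grp[of "\<one>\<^bsub>G\<^esub>"] gauge_rep_word[of "[]" t] by simp
  next
    case (Cons l u)
    then have lu: "l \<in> gens" "u \<in> gen_words" by auto
    then show ?case
      using Cons.IH letter[OF lu(1)] comp[OF W W, of "[l]" u]
      by (simp add: rep_word_Cons[of l u] gauge_compose)
  qed
  have sum: "(\<Sum>u\<in>U. p u \<cdot>\<^sub>\<complex> \<W> u) \<in> \<B> \<and>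
      \<alpha> (\<Sum>u\<in>U. p u \<cdot>\<^sub>\<complex> \<W> u) = gauge_aut t (\<Sum>u\<in>U. p u \<cdot>\<^sub>\<complex> \<W> u)"
    if "finite U" "U \<subseteq> gen_words" for p U
    using that
  proof (induction U)
    case empty
    have "0 \<in> \<B>" using O_min_scale[OF W[of "[]"], of 0] by simp
    then show ?case using scale[of 0 0 0] gauge_scale[of t 0 0] by simp
  next
    case (insert u U)
    then show ?case
      using add[of "p u \<cdot>\<^sub>\<complex> \<W> u" "\<Sum>u\<in>U. p u \<cdot>\<^sub>\<complex> \<W> u"]
        scale[OF W[of u] W[of u], of "p u"]
      by (simp add: O_min_add O_min_scale W gauge_add gauge_scale word)
  qed
  have poly: "\<alpha> (\<R> p) = gauge_aut t (\<R> p)" if "p \<in> \<F>" for p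
    using sum[of "{u. p u \<noteq> 0}" p] that by (simp add: free_star_algebra_iff rep_poly_def)
  obtain p where p: "\<And>n. p n \<in> \<F>" "(\<lambda>n. \<R> (p n)) \<longlonglongrightarrow> a"
    using O_minE[OF a] by blast
  have "norm (gauge_aut t (\<R> (p n)) - \<alpha> a) = norm (\<R> (p n) - a)" for n
  proof -
    let ?b = "\<R> (p n)"
    have b: "?b \<in> \<B>" by (rule rep_poly_in_O_min[OF p(1)])
    have "gauge_aut t ?b = \<alpha> ((?b - a) + a)" by (simp add: poly[OF p(1)])
    also have "\<dots> = \<alpha> (?b - a) + \<alpha> a" by (rule add[OF O_min_diff[OF b a] a])
    finally show ?thesis using norm[OF O_min_diff[OF b a] a] by simp
  qed
  then have "(\<lambda>n. gauge_aut t (\<R> (p n))) \<longlonglongrightarrow> \<alpha> a"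
    using p(2) by (simp add: tendsto_iff dist_norm)
  then show ?thesis using tendsto_gauge[OF p(2)] LIMSEQ_unique by blast
qed

lemma gauge_action_eq:
  assumes "a \<in> \<B>"
  shows "gauge_action G \<phi> w t a = gauge_aut t a"
proof -
  let ?\<alpha> = "restrict (gauge_aut t) (\<B>)"
  have "gauge_action G \<phi> w t = ?\<alpha>"
    unfolding gauge_action_def
  proof (rule the_equality)
    show "star_automorphism (\<B>) ?\<alpha> \<and>
      (\<forall>g\<in>carrier G. ?\<alpha> (grp_op G \<phi> w g) = grp_op G \<phi> w g) \<and>
      (\<forall>x. ?\<alpha> (S_op G \<phi> w [x]) = cis t \<cdot>\<^sub>\<complex> S_op G \<phi> w [x])"
      using star_automorphism_gauge
      by (simp add: grp_op_def S_op_def rep_word_in_O_min gauge_rep_word)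
  next
    fix \<alpha>
    assume \<alpha>: "star_automorphism (\<B>) \<alpha> \<and>
      (\<forall>g\<in>carrier G. \<alpha> (grp_op G \<phi> w g) = grp_op G \<phi> w g) \<and>
      (\<forall>x. \<alpha> (S_op G \<phi> w [x]) = cis t \<cdot>\<^sub>\<complex> S_op G \<phi> w [x])"
    then have "\<alpha> \<in> extensional (\<B>)" by (simp add: star_automorphism_def)
    then show "\<alpha> = ?\<alpha>"
      using \<alpha> star_automorphism_eq_gauge by (intro extensionalityI[of _ "\<B>"]) auto
  qed
  then show ?thesis using assms by simp
qed

end


section \<open>Fixed points and the Bernoulli measure\<close>


lemma prob_space_uniform_count_measure_UNIV: "prob_space (uniform_count_measure (UNIV :: 'x::finite set))"
  by (rule prob_space_uniform_count_measure) auto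

lemma product_prob_space_letters:
  "product_prob_space (\<lambda>_ :: nat. uniform_count_measure (UNIV :: 'x::finite set))"
proof -
  interpret prob_space "uniform_count_measure (UNIV :: 'x set)"
    by (rule prob_space_uniform_count_measure_UNIV)
  show ?thesis by unfold_locales
qed

lemma prob_space_bernoulli: "prob_space (bernoulli_measure :: ('x::finite) word measure)"
  unfolding bernoulli_measure_def by (intro prob_space_PiM prob_space_uniform_count_measure_UNIV)

lemma space_bernoulli [simp]: "space (bernoulli_measure :: ('x::finite) word measure) = UNIV"
  by (simp add: bernoulli_measure_def space_PiM space_uniform_count_measure PiE_UNIV_domain)

lemma cylinder_measure:
  fixes a :: "('x::finite) word"
  shows "{b. prefix n b = prefix n a} \<in> sets bernoulli_measure"
    and "measure bernoulli_measure {b. prefix n b = prefix n a} = 1 / real CARD('x) ^ n"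
proof -
  let ?M = "\<lambda>_ :: nat. uniform_count_measure (UNIV :: 'x set)"
  interpret product_prob_space ?M UNIV by (rule product_prob_space_letters)
  have eq: "{b. prefix n b = prefix n a} = prod_emb UNIV ?M {..<n} (Pi\<^sub>E {..<n} (\<lambda>i. {a i}))"
    by (intro Set.set_eqI) (simp add: prod_emb_iff space_uniform_count_measure prefix_eq_iff PiE_iff Ball_def)
  show "{b. prefix n b = prefix n a} \<in> sets bernoulli_measure"
    unfolding eq bernoulli_measure_def by (intro sets_PiM_I) (auto simp: sets_uniform_count_measure)
  have "measure bernoulli_measure {b. prefix n b = prefix n a} = (\<Prod>i<n. measure (?M i) {a i})"
    unfolding eq bernoulli_measure_def
    by (rule measure_PiM_emb) (auto simp: sets_uniform_count_measure)
  then show "measure bernoulli_measure {b. prefix n b = prefix n a} = 1 / real CARD('x) ^ n"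
    by (simp add: measure_uniform_count_measure power_divide)
qed

text \<open>
  One point in each cylinder of level \<open>n\<close>: a finite model of the Bernoulli measure for sets that are
  unions of such cylinders.
\<close>

definition transversal :: "nat \<Rightarrow> ('x::finite) word set \<Rightarrow> bool"
  where "transversal n V \<longleftrightarrow> bij_betw (prefix n) V {u. length u = n}"

text \<open>
  Unions of cylinders of level \<open>n\<close>.
\<close>

definition saturated :: "nat \<Rightarrow> 'x word set \<Rightarrow> bool"
  where "saturated n C \<longleftrightarrow> (\<forall>a b. a \<in> C \<longrightarrow> prefix n b = prefix n a \<longrightarrow> b \<in> C)"

lemma words_of_length:
  "finite {u :: ('x::finite) list. length u = n}" "card {u :: 'x list. length u = n} = CARD('x) ^ n"
  using finite_lists_length_eq[of "UNIV :: 'x set" n] card_lists_length_eq[of "UNIV :: 'x set" n] by auto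

lemma transversal_card:
  fixes V :: "('x::finite) word set"
  assumes "transversal n V"
  shows "finite V" "card V = CARD('x) ^ n"
  using assms words_of_length[where 'x = 'x and n = n]
  by (auto simp: transversal_def bij_betw_finite dest: bij_betw_same_card)

lemma transversal_inj: "transversal n V \<Longrightarrow> a \<in> V \<Longrightarrow> b \<in> V \<Longrightarrow> prefix n a = prefix n b \<Longrightarrow> a = b"
  by (auto simp: transversal_def bij_betw_def dest: inj_onD)

lemma transversal_ex:
  assumes "transversal n V" "length u = n"
  obtains a where "a \<in> V" "prefix n a = u"
  using assms unfolding transversal_def bij_betw_def by (metis (mono_tags, lifting) image_iff mem_Collect_eq)

lemma saturated_measure:
  fixes C :: "('x::finite) word set"
  assumes C: "saturated n C" and V: "transversal n V"
  shows "C \<in> sets bernoulli_measure"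
    and "measure bernoulli_measure C = real (card (V \<inter> C)) / real CARD('x) ^ n"
proof -
  interpret prob_space "bernoulli_measure :: 'x word measure" by (rule prob_space_bernoulli)
  let ?Z = "\<lambda>a :: 'x word. {b. prefix n b = prefix n a}"
  have fin: "finite (V \<inter> C)" using transversal_card(1)[OF V] by simp
  have eq: "C = (\<Union>a\<in>V \<inter> C. ?Z a)"
  proof (intro equalityI subsetI)
    fix b assume b: "b \<in> C"
    obtain a where a: "a \<in> V" "prefix n a = prefix n b"
      by (rule transversal_ex[OF V length_prefix[of b n]])
    moreover from this b have "a \<in> C" using C unfolding saturated_def by blast
    ultimately have "a \<in> V \<inter> C" "b \<in> ?Z a" by auto
    then show "b \<in> (\<Union>a\<in>V \<inter> C. ?Z a)" by blast
  next
    fix b assume "b \<in> (\<Union>a\<in>V \<inter> C. ?Z a)"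
    then show "b \<in> C" using C unfolding saturated_def by auto
  qed
  have "(\<Union>a\<in>V \<inter> C. ?Z a) \<in> sets bernoulli_measure"
    using cylinder_measure(1) by (intro sets.finite_UN fin)
  then show "C \<in> sets bernoulli_measure" using eq by simp
  have "measure bernoulli_measure (\<Union>a\<in>V \<inter> C. ?Z a) = (\<Sum>a\<in>V \<inter> C. measure bernoulli_measure (?Z a))"
  proof (rule finite_measure_finite_Union[OF fin])
    show "disjoint_family_on ?Z (V \<inter> C)"
      using transversal_inj[OF V] unfolding disjoint_family_on_def by auto
  qed (auto simp: cylinder_measure(1))
  then show "measure bernoulli_measure C = real (card (V \<inter> C)) / real CARD('x) ^ n"
    using eq by (simp add: cylinder_measure(2))
qed

lemma transversal_conc: "transversal n ((\<lambda>u. u \<frown> a) ` {u :: ('x::finite) list. length u = n})"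
  unfolding transversal_def by (rule bij_betw_byWitness[where f' = "\<lambda>u. u \<frown> a"]) auto

text \<open>
  Points with the same first \<open>k\<close> letters are told apart by the next \<open>m\<close>. This reduces counting the fixed points
  of \<open>S\<^sub>u g S\<^sub>u\<^sup>*\<close> to counting those of \<open>g\<close>.
\<close>

lemma transversal_suffix:
  assumes V: "transversal (k + m) V" and u: "length u = k"
  shows "transversal m (suffix k ` {v \<in> V. prefix k v = u})"
    and "inj_on (suffix k) {v \<in> V. prefix k v = u}"
proof -
  have inj: "a = b" if "a \<in> V" "b \<in> V" "prefix k a = u" "prefix k b = u"
    "prefix m (suffix k a) = prefix m (suffix k b)" for a b
    using that by (intro transversal_inj[OF V]) (auto simp: prefix_add_eq_iff)
  then show "inj_on (suffix k) {v \<in> V. prefix k v = u}" by (auto intro!: inj_onI)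
  show "transversal m (suffix k ` {v \<in> V. prefix k v = u})"
    unfolding transversal_def bij_betw_def
  proof (intro conjI equalityI subsetI)
    show "inj_on (prefix m) (suffix k ` {v \<in> V. prefix k v = u})"
      using inj by (auto intro!: inj_onI)
    fix v :: "'a list" assume "v \<in> {v. length v = m}"
    then have len: "length (u @ v) = k + m" using u by simp
    then obtain a where a: "a \<in> V" "prefix (k + m) a = u @ v" by (rule transversal_ex[OF V])
    define b where "b = u \<frown> v \<frown> a"
    have "prefix (k + m) a = prefix (k + m) b" using a len by (simp add: b_def)
    moreover have "prefix k b = u" "prefix m (suffix k b) = v"
      using u len by (simp_all add: b_def del: conc_conc)
    ultimately have "prefix k a = u" "prefix m (suffix k a) = v" by (simp_all add: prefix_add_eq_iff)
    then show "v \<in> prefix m ` suffix k ` {v \<in> V. prefix k v = u}" using a(1) by auto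
  qed auto
qed

context self_similar
begin

lemma transversal_act:
  assumes "transversal n V" and g: "g \<in> carrier G"
  shows "transversal n (\<phi> g ` V)"
proof -
  have inj: "inj_on (prefix n) (\<phi> g ` V)"
    using transversal_inj[OF assms(1)] by (auto simp: inj_on_def prefix_act_eq_iff[OF g])
  have "inj_on (\<phi> g) V" by (auto simp: inj_on_def act_inject[OF g])
  then have "card (prefix n ` \<phi> g ` V) = CARD('x) ^ n"
    using transversal_card[OF assms(1)] by (simp add: card_image inj)
  then have "prefix n ` \<phi> g ` V = {u. length u = n}"
    using words_of_length[where 'x = 'x and n = n] by (intro card_subset_eq) auto
  then show ?thesis using inj by (simp add: transversal_def bij_betw_def)
qed

text \<open>
  The sets \<open>moved g n\<close> increase to the complement of the fixed-point set of \<open>g\<close>, and the sets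
  \<open>fixed_nbhd g n\<close> increase to its interior. The points in neither union are exactly those that are
  not \<open>g\<close>-generic.
\<close>

definition moved :: "'g \<Rightarrow> nat \<Rightarrow> 'x word set"
  where "moved g n = {a. prefix n (\<phi> g a) \<noteq> prefix n a}"

definition fixed_nbhd :: "'g \<Rightarrow> nat \<Rightarrow> 'x word set"
  where "fixed_nbhd g n = {a. \<forall>b. prefix n b = prefix n a \<longrightarrow> \<phi> g b = b}"

lemma saturated_moved: "g \<in> carrier G \<Longrightarrow> saturated n (moved g n)"
  unfolding saturated_def moved_def by (metis (mono_tags, lifting) mem_Collect_eq prefix_act_eq_iff)

lemma saturated_fixed_nbhd: "saturated n (fixed_nbhd g n)"
  by (auto simp: saturated_def fixed_nbhd_def)

lemma sets_moved: "g \<in> carrier G \<Longrightarrow> moved g n \<in> sets bernoulli_measure"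
  using saturated_measure(1)[OF saturated_moved transversal_conc] .

lemma sets_fixed_nbhd: "fixed_nbhd g n \<in> sets bernoulli_measure"
  using saturated_measure(1)[OF saturated_fixed_nbhd transversal_conc] .

lemma incseq_moved: "incseq (moved g)"
  unfolding incseq_def moved_def using prefix_mono by blast

lemma incseq_fixed_nbhd: "incseq (fixed_nbhd g)"
  unfolding incseq_def fixed_nbhd_def using prefix_mono by blast

lemma invariants_eq: "invariants UNIV \<phi> g = - (\<Union>n. moved g n)"
proof -
  have "\<phi> g a = a \<longleftrightarrow> (\<forall>n. prefix n (\<phi> g a) = prefix n a)" for a
    by (metis ext lessI prefix_eq_iff)
  then show ?thesis by (auto simp: invariants_def moved_def)
qed

lemma moved_limit:
  assumes g: "g \<in> carrier G"
  shows "(\<lambda>n. measure bernoulli_measure (moved g n)) \<longlonglongrightarrow> 1 - measure bernoulli_measure (invariants UNIV \<phi> g)"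
proof -
  interpret prob_space "bernoulli_measure :: 'x word measure" by (rule prob_space_bernoulli)
  have "measure bernoulli_measure (invariants UNIV \<phi> g) = 1 - measure bernoulli_measure (\<Union>n. moved g n)"
    unfolding invariants_eq using prob_compl[of "\<Union>n. moved g n"] sets_moved[OF g] by (simp add: Compl_eq_Diff_UNIV)
  then show ?thesis
    using finite_Lim_measure_incseq[of "moved g"] incseq_moved sets_moved[OF g] by auto
qed

text \<open>
  Generic points lie in the interior of the fixed-point set or outside of it. So the boundary of the
  fixed-point set is a null set.
\<close>

lemma fixed_nbhd_limit:
  assumes g: "g \<in> carrier G" and generic: "measure bernoulli_measure (generic_points G \<phi>) = 1"
  shows "(\<lambda>n. measure bernoulli_measure (fixed_nbhd g n)) \<longlonglongrightarrow> measure bernoulli_measure (invariants UNIV \<phi> g)"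
proof -
  interpret prob_space "bernoulli_measure :: 'x word measure" by (rule prob_space_bernoulli)
  let ?F = "\<Union>n. fixed_nbhd g n" and ?M = "\<Union>n. moved g n"
  have sets: "?F \<in> sets bernoulli_measure" "?M \<in> sets bernoulli_measure"
    using sets_moved[OF g] sets_fixed_nbhd by auto
  have "generic_points G \<phi> \<subseteq> ?F \<union> ?M"
  proof
    fix a assume a: "a \<in> generic_points G \<phi>"
    show "a \<in> ?F \<union> ?M"
    proof (cases "\<phi> g a = a")
      case True
      then obtain U where "openin word_topology U" "a \<in> U" "\<forall>v\<in>U. \<phi> g v = v"
        using a g unfolding generic_points_def by blast
      then obtain n where "\<And>b. prefix n b = prefix n a \<Longrightarrow> \<phi> g b = b"
        using openin_word_topologyD by metis
      then have "a \<in> fixed_nbhd g n" by (auto simp: fixed_nbhd_def)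
      then show ?thesis by blast
    next
      case False
      then have "a \<notin> invariants UNIV \<phi> g" by (simp add: invariants_def)
      then show ?thesis by (simp add: invariants_eq)
    qed
  qed
  then have "measure bernoulli_measure (?F \<union> ?M) \<ge> 1"
    using generic finite_measure_mono[of "generic_points G \<phi>" "?F \<union> ?M"] sets by auto
  then have one: "measure bernoulli_measure (?F \<union> ?M) = 1" using prob_le_1 by (rule antisym[rotated])
  have "?F \<inter> ?M = {}"
    unfolding invariants_eq[of g, symmetric, THEN arg_cong[where f = uminus], simplified]
    by (auto simp: fixed_nbhd_def invariants_def)
  then have "measure bernoulli_measure ?F + measure bernoulli_measure ?M = 1"
    using finite_measure_Union[OF sets] one by simp
  moreover have "measure bernoulli_measure ?M = 1 - measure bernoulli_measure (invariants UNIV \<phi> g)"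
    using moved_limit[OF g] finite_Lim_measure_incseq[of "moved g"] incseq_moved sets_moved[OF g]
    by (intro LIMSEQ_unique) auto
  ultimately have "measure bernoulli_measure ?F = measure bernoulli_measure (invariants UNIV \<phi> g)" by simp
  then show ?thesis
    using finite_Lim_measure_incseq[of "fixed_nbhd g"] incseq_fixed_nbhd sets_fixed_nbhd by auto
qed

text \<open>
  In a transversal of level \<open>n\<close>, the points in cylinders that are fixed pointwise are fixed points,
  and the points in cylinders that are moved are not. The bounds from both sides have the same limit.
\<close>

lemma fixed_point_frequency:
  assumes g: "g \<in> carrier G" and generic: "measure bernoulli_measure (generic_points G \<phi>) = 1"
    and V: "\<And>n. transversal n (V n)"
  shows "(\<lambda>n. real (card {v \<in> V n. \<phi> g v = v}) / real CARD('x) ^ n) \<longlonglongrightarrow>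
    measure bernoulli_measure (invariants UNIV \<phi> g)"
proof (rule tendsto_sandwich)
  show "\<forall>\<^sub>F n in sequentially. measure bernoulli_measure (fixed_nbhd g n) \<le>
      real (card {v \<in> V n. \<phi> g v = v}) / real CARD('x) ^ n"
  proof (intro always_eventually allI)
    fix n
    have "card (V n \<inter> fixed_nbhd g n) \<le> card {v \<in> V n. \<phi> g v = v}"
      using transversal_card(1)[OF V] by (intro card_mono) (auto simp: fixed_nbhd_def)
    then show "measure bernoulli_measure (fixed_nbhd g n) \<le>
        real (card {v \<in> V n. \<phi> g v = v}) / real CARD('x) ^ n"
      unfolding saturated_measure(2)[OF saturated_fixed_nbhd V] by (intro divide_right_mono) auto
  qed
  show "\<forall>\<^sub>F n in sequentially. real (card {v \<in> V n. \<phi> g v = v}) / real CARD('x) ^ n \<le>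
      1 - measure bernoulli_measure (moved g n)"
  proof (intro always_eventually allI)
    fix n
    have "card {v \<in> V n. \<phi> g v = v} + card (V n \<inter> moved g n) = card ({v \<in> V n. \<phi> g v = v} \<union> (V n \<inter> moved g n))"
      using transversal_card(1)[OF V, of n] by (intro card_Un_disjoint[symmetric]) (auto simp: moved_def)
    also have "\<dots> \<le> card (V n)" using transversal_card(1)[OF V, of n] by (intro card_mono) auto
    finally have "card {v \<in> V n. \<phi> g v = v} + card (V n \<inter> moved g n) \<le> CARD('x) ^ n"
      by (simp add: transversal_card(2)[OF V])
    then have "real (card {v \<in> V n. \<phi> g v = v}) + real (card (V n \<inter> moved g n)) \<le> real CARD('x) ^ n"
      by (simp only: of_nat_add[symmetric] of_nat_power[symmetric] of_nat_le_iff)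
    then show "real (card {v \<in> V n. \<phi> g v = v}) / real CARD('x) ^ n \<le> 1 - measure bernoulli_measure (moved g n)"
      unfolding saturated_measure(2)[OF saturated_moved[OF g] V] by (simp add: field_simps)
  qed
  show "(\<lambda>n. measure bernoulli_measure (fixed_nbhd g n)) \<longlonglongrightarrow> measure bernoulli_measure (invariants UNIV \<phi> g)"
    by (rule fixed_nbhd_limit[OF g generic])
  show "(\<lambda>n. 1 - measure bernoulli_measure (moved g n)) \<longlonglongrightarrow> measure bernoulli_measure (invariants UNIV \<phi> g)"
    using tendsto_diff[OF tendsto_const moved_limit[OF g], of 1] by simp
qed

end

section \<open>The state as a limit of averages over the orbit\<close>


locale measured_representation = generic_representation G \<phi> w
  for G :: "('g, 'b) monoid_scheme" and \<phi> :: "'g \<Rightarrow> ('x::finite) word \<Rightarrow> 'x word" and w +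
  assumes generic: "measure bernoulli_measure (generic_points G \<phi>) = 1"
begin

lemma card_gt_1: "real CARD('x) > 1" using two_letters by simp

text \<open>
  The normalized partial trace \<open>\<psi>\<^sub>n\<close> over the basis vectors of \<open>V\<close>: the coordinate at \<open>v\<close> of \<open>a \<delta>\<^sub>v\<close> is the
  diagonal matrix entry.
\<close>

definition average :: "nat \<Rightarrow> 'x word set \<Rightarrow> 'x word ell2_op \<Rightarrow> complex"
  where "average n V a = (\<Sum>v\<in>V. Rep_ell2 (blinfun_apply a (\<delta> v)) v) / of_real (real CARD('x) ^ n)"

definition sampling :: "(nat \<Rightarrow> 'x word set) \<Rightarrow> bool"
  where "sampling V \<longleftrightarrow> (\<forall>n. transversal n (V n) \<and> V n \<subseteq> \<O>)"

definition sample :: "nat \<Rightarrow> 'x word set"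
  where "sample n = (\<lambda>u. u \<frown> w) ` {u. length u = n}"

lemma sampling_sample: "sampling sample"
  by (auto simp: sampling_def sample_def transversal_conc intro: conc_in_orbit point_in_orbit)

lemma average_add: "average n V (a + b) = average n V a + average n V b"
  by (simp add: average_def blinfun.add_left plus_ell2.rep_eq sum.distrib add_divide_distrib)

lemma average_diff: "average n V (a - b) = average n V a - average n V b"
  by (simp add: average_def blinfun.diff_left minus_ell2.rep_eq sum_subtractf diff_divide_distrib)

lemma average_scale: "average n V (c \<cdot>\<^sub>\<complex> a) = c * average n V a"
  by (simp add: average_def op_scale_apply cscale.rep_eq sum_distrib_left)

lemma norm_average_le:
  assumes "transversal n V"
  shows "cmod (average n V a) \<le> norm a"
proof -
  have "cmod (Rep_ell2 (blinfun_apply a (\<delta> v)) v) \<le> norm a" for v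
    using cmod_Rep_ell2_le[of "blinfun_apply a (\<delta> v)" v] norm_blinfun[of a "\<delta> v"] by simp
  then have "cmod (\<Sum>v\<in>V. Rep_ell2 (blinfun_apply a (\<delta> v)) v) \<le> (\<Sum>v\<in>V. norm a)"
    by (intro sum_norm_le) auto
  also have "\<dots> = real CARD('x) ^ n * norm a" by (simp add: transversal_card[OF assms])
  finally show ?thesis
    using card_gt_1 by (simp add: average_def norm_divide norm_power divide_le_eq mult.commute)
qed

lemma average_adj_self_nonneg:
  assumes "complex_linear a"
  shows "average n V (op_adj a o\<^sub>L a) \<in> \<real>\<^sub>\<ge>\<^sub>0"
proof -
  have "Rep_ell2 (blinfun_apply (op_adj a o\<^sub>L a) (\<delta> v)) v = of_real ((norm (blinfun_apply a (\<delta> v)))\<^sup>2)" for v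
    using cinner_op_adj[OF assms, of "\<delta> v" "blinfun_apply a (\<delta> v)"]
    by (simp add: cinner_self cinner_basis_left)
  then have "average n V (op_adj a o\<^sub>L a) = of_real ((\<Sum>v\<in>V. (norm (blinfun_apply a (\<delta> v)))\<^sup>2) / real CARD('x) ^ n)"
    by (simp add: average_def)
  then show ?thesis using card_gt_1 by (simp only: nonneg_Reals_of_real_iff) (simp add: sum_nonneg)
qed

lemma average_rep_word:
  "u \<in> gen_words \<Longrightarrow> finite V \<Longrightarrow>
    average n V (\<W> u) = of_real (real (card {v \<in> V. word_map u v = Some v}) / real CARD('x) ^ n)"
proof -
  assume u: "u \<in> gen_words" and V: "finite V"
  have "Rep_ell2 (blinfun_apply (\<W> u) (\<delta> v)) v = (if word_map u v = Some v then 1 else 0)" for v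
    by (auto simp: rep_word_basis[OF u] zero_ell2.rep_eq ell2_basis.rep_eq split: option.split)
  then show ?thesis using V by (simp add: average_def sum.If_cases Int_def)
qed

text \<open>
  If \<open>u\<^sub>1 = u\<^sub>2\<close>, a fixed point of \<open>S\<^sub>u g S\<^sub>u\<^sup>*\<close> is \<open>u z\<close> with \<open>z\<close> a fixed point of \<open>g\<close>, so the count at level
  \<open>k + m\<close> reduces to the count for \<open>g\<close> on a transversal of level \<open>m\<close>.
\<close>

lemma average_mono_word_limit:
  assumes V: "sampling V" and g: "g \<in> carrier G"
  shows "(\<lambda>n. average n (V n) (\<W> (mono_word u\<^sub>1 g u\<^sub>2))) \<longlonglongrightarrow>
    (if u\<^sub>1 = u\<^sub>2 then of_real (1 / real CARD('x) ^ length u\<^sub>1 * measure bernoulli_measure (invariants UNIV \<phi> g)) else 0)"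
proof -
  let ?u = "mono_word u\<^sub>1 g u\<^sub>2"
  have Vt: "transversal n (V n)" and VO: "V n \<subseteq> \<O>" for n using V by (auto simp: sampling_def)
  have u: "?u \<in> gen_words" using g by simp
  have avg: "average n (V n) (\<W> ?u) =
      of_real (real (card {v \<in> V n. word_map ?u v = Some v}) / real CARD('x) ^ n)" for n
    by (rule average_rep_word[OF u transversal_card(1)[OF Vt]])
  show ?thesis
  proof (cases "u\<^sub>1 = u\<^sub>2")
    case False
    have "word_map ?u v \<noteq> Some v" for v
    proof
      assume fx: "word_map ?u v = Some v"
      then have "length u\<^sub>1 = length u\<^sub>2" using word_map_fixed_point[OF u] by simp
      moreover obtain z where "v = u\<^sub>2 \<frown> z" "v = u\<^sub>1 \<frown> \<phi> g z"
        using fx g by (auto simp: word_map_mono_word T_star_Some_iff split: if_splits)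
      ultimately show False using False by (metis conc_eq_conc_iff)
    qed
    then show ?thesis using False by (simp add: avg)
  next
    case True
    define k where "k = length u\<^sub>1"
    define W where "W m = suffix k ` {v \<in> V (k + m). prefix k v = u\<^sub>1}" for m
    have W: "transversal m (W m)" for m
      unfolding W_def by (rule transversal_suffix(1)[OF Vt]) (simp add: k_def)
    have "card {v \<in> V (k + m). word_map ?u v = Some v} = card {z \<in> W m. \<phi> g z = z}" for m
    proof (rule bij_betw_same_card[of "suffix k"])
      have fixed: "word_map ?u v = Some v \<longleftrightarrow> prefix k v = u\<^sub>1 \<and> \<phi> g (suffix k v) = suffix k v"
        if "v \<in> V (k + m)" for v
      proof -
        have "v \<in> \<O>" using that VO by blast
        then have "word_map ?u v = Some v \<longleftrightarrow> (\<exists>z. v = u\<^sub>1 \<frown> z \<and> v = u\<^sub>1 \<frown> \<phi> g z)"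
          using g True by (auto simp: word_map_mono_word T_star_Some_iff)
        also have "\<dots> \<longleftrightarrow> prefix k v = u\<^sub>1 \<and> \<phi> g (suffix k v) = suffix k v"
        proof (intro iffI)
          assume "\<exists>z. v = u\<^sub>1 \<frown> z \<and> v = u\<^sub>1 \<frown> \<phi> g z"
          then obtain z where "v = u\<^sub>1 \<frown> z" "\<phi> g z = z" by auto
          then show "prefix k v = u\<^sub>1 \<and> \<phi> g (suffix k v) = suffix k v" by (simp add: k_def)
        next
          assume "prefix k v = u\<^sub>1 \<and> \<phi> g (suffix k v) = suffix k v"
          then show "\<exists>z. v = u\<^sub>1 \<frown> z \<and> v = u\<^sub>1 \<frown> \<phi> g z"
            by (intro exI[of _ "suffix k v"]) (metis prefix_conc_suffix)
        qed
        finally show ?thesis .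
      qed
      have "inj_on (suffix k) {v \<in> V (k + m). prefix k v = u\<^sub>1}"
        by (rule transversal_suffix(2)[OF Vt]) (simp add: k_def)
      then show "bij_betw (suffix k) {v \<in> V (k + m). word_map ?u v = Some v} {z \<in> W m. \<phi> g z = z}"
        unfolding bij_betw_def
      proof (intro conjI)
        have eq: "{v \<in> V (k + m). word_map ?u v = Some v} =
            {v \<in> V (k + m). prefix k v = u\<^sub>1 \<and> \<phi> g (suffix k v) = suffix k v}"
          using fixed by blast
        assume "inj_on (suffix k) {v \<in> V (k + m). prefix k v = u\<^sub>1}"
        then show "inj_on (suffix k) {v \<in> V (k + m). word_map ?u v = Some v}"
          unfolding eq by (rule inj_on_subset) blast
        show "suffix k ` {v \<in> V (k + m). word_map ?u v = Some v} = {z \<in> W m. \<phi> g z = z}"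
          unfolding eq W_def by blast
      qed
    qed
    then have "average (m + k) (V (m + k)) (\<W> ?u) =
        of_real (1 / real CARD('x) ^ k * (real (card {z \<in> W m. \<phi> g z = z}) / real CARD('x) ^ m))" for m
      by (simp add: avg add.commute[of m k] power_add)
    moreover have "(\<lambda>m. of_real (1 / real CARD('x) ^ k * (real (card {z \<in> W m. \<phi> g z = z}) / real CARD('x) ^ m)) :: complex) \<longlonglongrightarrow>
        of_real (1 / real CARD('x) ^ k * measure bernoulli_measure (invariants UNIV \<phi> g))"
      by (intro tendsto_of_real tendsto_mult_left fixed_point_frequency g generic W)
    ultimately have "(\<lambda>m. average (m + k) (V (m + k)) (\<W> ?u)) \<longlonglongrightarrow>
        of_real (1 / real CARD('x) ^ k * measure bernoulli_measure (invariants UNIV \<phi> g))" by (simp only:)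
    then show ?thesis using True unfolding k_def[symmetric] by (simp add: LIMSEQ_offset)
  qed
qed

text \<open>
  The limit is required to be the same for all samplings. This uniformity survives norm limits, and
  the KMS condition for group elements rests on it.
\<close>

definition averages_to :: "'x word ell2_op \<Rightarrow> complex \<Rightarrow> bool"
  where "averages_to a L \<longleftrightarrow> (\<forall>V. sampling V \<longrightarrow> (\<lambda>n. average n (V n) a) \<longlonglongrightarrow> L)"

lemma averages_to_add: "averages_to a L \<Longrightarrow> averages_to b M \<Longrightarrow> averages_to (a + b) (L + M)"
  unfolding averages_to_def by (auto simp: average_add intro: tendsto_add)

lemma averages_to_diff: "averages_to a L \<Longrightarrow> averages_to b M \<Longrightarrow> averages_to (a - b) (L - M)"
  unfolding averages_to_def by (auto simp: average_diff intro: tendsto_diff)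

lemma averages_to_scale: "averages_to a L \<Longrightarrow> averages_to (c \<cdot>\<^sub>\<complex> a) (c * L)"
  unfolding averages_to_def by (auto simp: average_scale intro: tendsto_mult_left)

lemma averages_to_zero: "averages_to 0 0"
  by (simp add: averages_to_def average_def zero_ell2.rep_eq)

lemma averages_to_norm: "averages_to a L \<Longrightarrow> cmod L \<le> norm a"
  using sampling_sample unfolding averages_to_def
  by (auto intro!: tendsto_norm[THEN LIMSEQ_le_const2] norm_average_le simp: sampling_def)

lemma averages_to_mono_word:
  "g \<in> carrier G \<Longrightarrow> averages_to (\<W> (mono_word u\<^sub>1 g u\<^sub>2))
    (if u\<^sub>1 = u\<^sub>2 then of_real (1 / real CARD('x) ^ length u\<^sub>1 * measure bernoulli_measure (invariants UNIV \<phi> g)) else 0)"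
  unfolding averages_to_def using average_mono_word_limit by blast

lemma rep_word_normal_form:
  assumes "u \<in> gen_words"
  obtains "\<W> u = 0"
  | u\<^sub>1 g u\<^sub>2 where "g \<in> carrier G" "word_degree (mono_word u\<^sub>1 g u\<^sub>2) = word_degree u"
      "\<W> u = \<W> (mono_word u\<^sub>1 g u\<^sub>2)"
  using word_map_normal_form[OF assms]
proof (elim disjE exE bexE conjE)
  assume "word_map u = Map.empty"
  then show thesis using assms by (intro that(1)) (simp add: rep_word_eq pm_op_empty)
next
  fix u\<^sub>1 u\<^sub>2 g assume "g \<in> carrier G" "word_degree (mono_word u\<^sub>1 g u\<^sub>2) = word_degree u"
    "word_map u = word_map (mono_word u\<^sub>1 g u\<^sub>2)"
  then show thesis
    using rep_word_eq[OF assms] rep_word_eq[of "mono_word u\<^sub>1 g u\<^sub>2"] by (intro that(2)[of g u\<^sub>1 u\<^sub>2]) simp_all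
qed

lemma averages_to_word: "u \<in> gen_words \<Longrightarrow> \<exists>L. averages_to (\<W> u) L"
  by (erule rep_word_normal_form) (use averages_to_zero averages_to_mono_word in metis)+

lemma averages_to_poly: "p \<in> \<F> \<Longrightarrow> \<exists>L. averages_to (\<R> p) L"
proof -
  have "\<exists>L. averages_to (\<Sum>u\<in>U. p u \<cdot>\<^sub>\<complex> \<W> u) L" if "finite U" "U \<subseteq> gen_words" for U
    using that
  proof (induction U)
    case empty
    then show ?case using averages_to_zero by auto
  next
    case (insert u U)
    then show ?case using averages_to_word[of u] by simp (meson averages_to_add averages_to_scale)
  qed
  then show "p \<in> \<F> \<Longrightarrow> ?thesis" by (simp add: free_star_algebra_iff rep_poly_def)
qed

lemma averages_to_limit:
  assumes x: "x \<longlonglongrightarrow> a" and L: "\<And>k. averages_to (x k) (L k)"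
  obtains M where "averages_to a M"
proof -
  have diff: "cmod (L j - L k) \<le> norm (x j - x k)" for j k
    by (rule averages_to_norm[OF averages_to_diff[OF L L]])
  have "Cauchy L"
  proof (rule CauchyI)
    fix e :: real assume "e > 0"
    then obtain N where "\<forall>j\<ge>N. \<forall>k\<ge>N. norm (x j - x k) < e"
      using CauchyD[OF LIMSEQ_imp_Cauchy[OF x]] by blast
    then show "\<exists>N. \<forall>j\<ge>N. \<forall>k\<ge>N. norm (L j - L k) < e" using diff by (meson order_le_less_trans)
  qed
  then obtain M where M: "L \<longlonglongrightarrow> M" using Cauchy_convergent convergent_def by blast
  have "averages_to a M"
    unfolding averages_to_def
  proof (intro allI impI LIMSEQ_I)
    fix V and e :: real assume V: "sampling V" and e: "e > 0"
    have "\<forall>\<^sub>F k in sequentially. norm (x k - a) < e / 3 \<and> cmod (L k - M) < e / 3"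
      using tendstoD[OF x, of "e / 3"] tendstoD[OF M, of "e / 3"] e
      by (simp add: dist_norm eventually_conj)
    then obtain k where k: "norm (x k - a) < e / 3" "cmod (L k - M) < e / 3"
      by (metis (mono_tags, lifting) eventually_sequentially order_refl)
    obtain N where N: "\<forall>n\<ge>N. cmod (average n (V n) (x k) - L k) < e / 3"
      using L[of k] V e LIMSEQ_D[of "\<lambda>n. average n (V n) (x k)" "L k" "e / 3"]
      unfolding averages_to_def by (metis divide_pos_pos zero_less_numeral)
    have "cmod (average n (V n) a - M) < e" if "n \<ge> N" for n
    proof -
      have "average n (V n) a - M = (average n (V n) (x k) - L k) - average n (V n) (x k - a) + (L k - M)"
        by (simp add: average_diff)
      also have "cmod \<dots> \<le> cmod (average n (V n) (x k) - L k) + cmod (average n (V n) (x k - a)) + cmod (L k - M)"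
        by (meson add_mono norm_triangle_ineq norm_triangle_ineq4 order_refl order_trans)
      also have "cmod (average n (V n) (x k - a)) \<le> norm (x k - a)"
        using V by (intro norm_average_le) (simp add: sampling_def)
      finally show ?thesis using N that k by fastforce
    qed
    then show "\<exists>N. \<forall>n\<ge>N. norm (average n (V n) a - M) < e" by blast
  qed
  then show ?thesis by (rule that)
qed

text \<open>
  The state is constructed on the norm closure of the generated *-algebra, a closed algebra that contains
  \<open>\<B>\<close>: it also contains the derivatives of entire functions with values in \<open>\<B>\<close>.
\<close>

definition A_red :: "'x word ell2_op set" (\<open>\<A>\<close>)
  where "\<A> = closure (generated_star_algebra G \<phi> w)"

lemma A_redI:
  assumes "\<And>n. p n \<in> \<F>" "(\<lambda>n. \<R> (p n)) \<longlonglongrightarrow> a"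
  shows "a \<in> \<A>"
  unfolding A_red_def closure_sequential generated_star_algebra_def
  by (rule exI[of _ "\<lambda>n. \<R> (p n)"]) (use assms in simp)

lemma A_redE:
  assumes "a \<in> \<A>"
  obtains p where "\<And>n. p n \<in> \<F>" "(\<lambda>n. \<R> (p n)) \<longlonglongrightarrow> a"
proof -
  obtain x where x: "\<And>n. x n \<in> \<R> ` \<F>" "x \<longlonglongrightarrow> a"
    using assms unfolding A_red_def closure_sequential generated_star_algebra_def by blast
  from x(1) have "\<exists>p. p \<in> \<F> \<and> x n = \<R> p" for n by auto
  then obtain p where "\<And>n. p n \<in> \<F>" "\<And>n. x n = \<R> (p n)" by metis
  moreover from this(2) have "x = (\<lambda>n. \<R> (p n))" by auto
  ultimately show ?thesis using x(2) that by blast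
qed

lemma O_min_subset_A_red: "\<B> \<subseteq> \<A>"
  by (auto elim!: O_minE intro: A_redI)

lemma generated_subset_A_red: "generated_star_algebra G \<phi> w \<subseteq> \<A>"
  unfolding A_red_def by (rule closure_subset)

lemma rep_word_in_A_red: "u \<in> gen_words \<Longrightarrow> \<W> u \<in> \<A>"
  using rep_word_in_generated generated_subset_A_red by blast

lemma complex_linear_A_red: "a \<in> \<A> \<Longrightarrow> complex_linear a"
  by (elim A_redE) (auto intro: complex_linear_limit complex_linear_rep_poly)

lemma A_red_add:
  assumes "a \<in> \<A>" "b \<in> \<A>"
  shows "a + b \<in> \<A>"
proof -
  obtain p where p: "\<And>n. p n \<in> \<F>" "(\<lambda>n. \<R> (p n)) \<longlonglongrightarrow> a"
    using A_redE[OF assms(1)] by blast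
  obtain q where q: "\<And>n. q n \<in> \<F>" "(\<lambda>n. \<R> (q n)) \<longlonglongrightarrow> b"
    using A_redE[OF assms(2)] by blast
  show ?thesis
    by (rule A_redI[of "\<lambda>n. fp_add (p n) (q n)"])
      (simp_all add: fp_closed rep_poly_add p q tendsto_add)
qed

lemma A_red_compose:
  assumes "a \<in> \<A>" "b \<in> \<A>"
  shows "a o\<^sub>L b \<in> \<A>"
proof -
  obtain p where p: "\<And>n. p n \<in> \<F>" "(\<lambda>n. \<R> (p n)) \<longlonglongrightarrow> a"
    using A_redE[OF assms(1)] by blast
  obtain q where q: "\<And>n. q n \<in> \<F>" "(\<lambda>n. \<R> (q n)) \<longlonglongrightarrow> b"
    using A_redE[OF assms(2)] by blast
  show ?thesis
    by (rule A_redI[of "\<lambda>n. fp_mult (p n) (q n)"])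
      (simp_all add: fp_closed rep_poly_mult p q tendsto_compose)
qed

lemma A_red_scale:
  assumes "a \<in> \<A>"
  shows "c \<cdot>\<^sub>\<complex> a \<in> \<A>"
proof -
  obtain p where p: "\<And>n. p n \<in> \<F>" "(\<lambda>n. \<R> (p n)) \<longlonglongrightarrow> a"
    using A_redE[OF assms] by blast
  show ?thesis
    by (rule A_redI[of "\<lambda>n. fp_scale c (p n)"])
      (simp_all add: fp_closed rep_poly_scale p tendsto_op_scale)
qed

lemma A_red_diff: "a \<in> \<A> \<Longrightarrow> b \<in> \<A> \<Longrightarrow> a - b \<in> \<A>"
  using A_red_add[of a "(-1) \<cdot>\<^sub>\<complex> b"] A_red_scale[of b "-1"] by (simp add: op_scale_minus_one)

lemma closed_A_red: "closed \<A>"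
  by (simp add: A_red_def)

definition orbit_state :: "'x word ell2_op \<Rightarrow> complex" (\<open>\<Psi>\<close>)
  where "\<Psi> a = lim (\<lambda>n. average n (sample n) a)"

lemma averages_to_orbit_state: "averages_to a L \<Longrightarrow> \<Psi> a = L"
  using sampling_sample unfolding averages_to_def orbit_state_def by (auto intro: limI)

lemma averages_to_Psi:
  assumes "a \<in> \<A>"
  shows "averages_to a (\<Psi> a)"
proof -
  obtain p where p: "\<And>n. p n \<in> \<F>" "(\<lambda>n. \<R> (p n)) \<longlonglongrightarrow> a" using A_redE[OF assms] by blast
  have "\<exists>L. \<forall>k. averages_to (\<R> (p k)) (L k)"
    using averages_to_poly[OF p(1)] by (intro choice) blast
  then obtain L where "\<And>k. averages_to (\<R> (p k)) (L k)" by blast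
  then obtain M where "averages_to a M" using averages_to_limit[OF p(2)] by blast
  then show ?thesis using averages_to_orbit_state by blast
qed

lemma Psi_add: "a \<in> \<A> \<Longrightarrow> b \<in> \<A> \<Longrightarrow> \<Psi> (a + b) = \<Psi> a + \<Psi> b"
  by (intro averages_to_orbit_state averages_to_add averages_to_Psi)

lemma Psi_diff: "a \<in> \<A> \<Longrightarrow> b \<in> \<A> \<Longrightarrow> \<Psi> (a - b) = \<Psi> a - \<Psi> b"
  by (intro averages_to_orbit_state averages_to_diff averages_to_Psi)

lemma Psi_scale: "a \<in> \<A> \<Longrightarrow> \<Psi> (c \<cdot>\<^sub>\<complex> a) = c * \<Psi> a"
  by (intro averages_to_orbit_state averages_to_scale averages_to_Psi)

lemma norm_Psi_le: "a \<in> \<A> \<Longrightarrow> cmod (\<Psi> a) \<le> norm a"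
  by (intro averages_to_norm averages_to_Psi)

lemma tendsto_Psi:
  assumes "(x \<longlongrightarrow> a) F" "a \<in> \<A>" "\<forall>\<^sub>F n in F. x n \<in> \<A>"
  shows "((\<lambda>n. \<Psi> (x n)) \<longlongrightarrow> \<Psi> a) F"
proof (rule Lim_transform[OF tendsto_const])
  have "((\<lambda>n. norm (x n - a)) \<longlongrightarrow> 0) F" using assms(1) by (simp add: LIM_zero_iff tendsto_norm_zero)
  then show "((\<lambda>n. \<Psi> (x n) - \<Psi> a) \<longlongrightarrow> 0) F"
  proof (rule Lim_null_comparison[rotated])
    show "\<forall>\<^sub>F n in F. norm (\<Psi> (x n) - \<Psi> a) \<le> norm (x n - a)"
      using assms(3) by eventually_elim (metis A_red_diff Psi_diff assms(2) norm_Psi_le)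
  qed
qed

lemma Psi_mono_word:
  "g \<in> carrier G \<Longrightarrow> \<Psi> (\<W> (mono_word u\<^sub>1 g u\<^sub>2)) =
    (if u\<^sub>1 = u\<^sub>2 then of_real (1 / real CARD('x) ^ length u\<^sub>1 * measure bernoulli_measure (invariants UNIV \<phi> g)) else 0)"
  by (intro averages_to_orbit_state averages_to_mono_word)

lemma Psi_one: "\<Psi> (rep_one G \<phi> w) = 1"
proof (rule averages_to_orbit_state, unfold averages_to_def, intro allI impI)
  fix V assume V: "sampling V"
  have "average n (V n) (rep_one G \<phi> w) = 1" for n
  proof -
    have "{v \<in> V n. word_map [] v = Some v} = V n" using V by (auto simp: sampling_def word_map_Nil)
    then show ?thesis
      using average_rep_word[of "[]" "V n" n] transversal_card[of n "V n"] V card_gt_1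
      by (simp add: sampling_def rep_word_Nil)
  qed
  then show "(\<lambda>n. average n (V n) (rep_one G \<phi> w)) \<longlonglongrightarrow> 1" by simp
qed

lemma Psi_nonneg:
  assumes "a \<in> \<A>" "op_adj a o\<^sub>L a \<in> \<A>"
  shows "\<Psi> (op_adj a o\<^sub>L a) \<in> \<real>\<^sub>\<ge>\<^sub>0"
proof -
  have "(\<lambda>n. average n (sample n) (op_adj a o\<^sub>L a)) \<longlonglongrightarrow> \<Psi> (op_adj a o\<^sub>L a)"
    using averages_to_Psi[OF assms(2)] sampling_sample by (auto simp: averages_to_def)
  then show ?thesis
    by (rule closed_sequentially[OF closed_nonneg_Reals_complex, rotated])
      (rule average_adj_self_nonneg[OF complex_linear_A_red[OF assms(1)]])
qed

end


section \<open>The KMS condition\<close>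

lemma complex_zero_islimpt_Reals: "(0 :: complex) islimpt \<real>"
  unfolding islimpt_approachable
proof (intro allI impI)
  fix e :: real assume "e > 0"
  then show "\<exists>x\<in>\<real>. x \<noteq> (0 :: complex) \<and> dist x 0 < e"
    by (intro bexI[of _ "of_real (e / 2)"]) (auto simp: norm_divide)
qed

lemma bounded_linear_op_scale_left: "bounded_linear (\<lambda>c. c \<cdot>\<^sub>\<complex> (T :: 'a ell2_op))"
  by (rule bounded_linear_intro[where K = "norm T"])
    (auto simp: op_scale_add_left norm_op_scale op_scale_of_real[symmetric] op_scale_op_scale scaleR_conv_of_real)

lemma entire_difference_quotient:
  assumes "(F has_derivative (\<lambda>h. h \<cdot>\<^sub>\<complex> D)) (at z)"
  shows "((\<lambda>h. inverse h \<cdot>\<^sub>\<complex> (F (z + h) - F z)) \<longlongrightarrow> (D :: 'a ell2_op)) (at 0)"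
proof -
  have "((\<lambda>h. norm (F (z + h) - F z - h \<cdot>\<^sub>\<complex> D) / norm h) \<longlongrightarrow> 0) (at 0)"
    using assms by (simp add: has_derivative_at)
  moreover have "\<forall>\<^sub>F h in at 0. norm (inverse h \<cdot>\<^sub>\<complex> (F (z + h) - F z) - D) \<le>
      norm (F (z + h) - F z - h \<cdot>\<^sub>\<complex> D) / norm h"
  proof (rule eventually_mono[OF eventually_neq_at_within[of 0]])
    fix h :: complex assume "h \<noteq> 0"
    then have "inverse h \<cdot>\<^sub>\<complex> (F (z + h) - F z) - D = inverse h \<cdot>\<^sub>\<complex> (F (z + h) - F z - h \<cdot>\<^sub>\<complex> D)"
      by (simp add: op_scale_diff_right op_scale_op_scale)
    then show "norm (inverse h \<cdot>\<^sub>\<complex> (F (z + h) - F z) - D) \<le> norm (F (z + h) - F z - h \<cdot>\<^sub>\<complex> D) / norm h"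
      by (simp add: norm_op_scale norm_inverse divide_inverse mult.commute)
  qed
  ultimately have "((\<lambda>h. inverse h \<cdot>\<^sub>\<complex> (F (z + h) - F z) - D) \<longlongrightarrow> 0) (at 0)"
    by (rule Lim_null_comparison[rotated])
  then show ?thesis by (simp add: LIM_zero_iff)
qed

lemma norm_compose_le: "norm (S o\<^sub>L T) \<le> norm T * norm (S :: 'a ell2_op)"
  by (metis mult.commute norm_blinfun_compose)

context measured_representation
begin

lemma Rep_rep_letter:
  assumes l: "l \<in> gens"
  shows "Rep_ell2 (blinfun_apply (\<W> [l]) x) v =
    (case letter_map (letter_adj l) v of None \<Rightarrow> 0 | Some v' \<Rightarrow> Rep_ell2 x v')"
proof -
  have "Rep_ell2 (blinfun_apply (\<W> [l]) x) v =
      cinner (blinfun_apply (\<W> [letter_adj l]) (\<delta> v)) x"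
    using l cinner_op_adj[of "\<W> [letter_adj l]" "\<delta> v" x]
    by (simp add: op_adj_rep_word complex_linear_rep_word cinner_basis_left)
  then show ?thesis
    using l by (simp add: rep_word_basis word_map_single cinner_basis_left split: option.split)
qed

text \<open>
  Multiplication by a letter shifts matrix entries: the diagonal of \<open>l b\<close> consists of entries of \<open>b\<close>
  along the graph of the adjoint of \<open>l\<close>, and the diagonal of \<open>b l\<close> of entries along the graph of \<open>l\<close>.
\<close>

lemma average_letter_left:
  "l \<in> gens \<Longrightarrow> average n V (\<W> [l] o\<^sub>L b) =
    (\<Sum>v\<in>V. case letter_map (letter_adj l) v of None \<Rightarrow> 0 | Some v' \<Rightarrow> Rep_ell2 (blinfun_apply b (\<delta> v)) v') /
      of_real (real CARD('x) ^ n)"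
  by (simp add: average_def Rep_rep_letter)

lemma average_letter_right:
  "l \<in> gens \<Longrightarrow> average n V (b o\<^sub>L \<W> [l]) =
    (\<Sum>v\<in>V. case letter_map l v of None \<Rightarrow> 0 | Some v' \<Rightarrow> Rep_ell2 (blinfun_apply b (\<delta> v')) v) /
      of_real (real CARD('x) ^ n)"
proof -
  assume l: "l \<in> gens"
  have "Rep_ell2 (blinfun_apply (b o\<^sub>L \<W> [l]) (\<delta> v)) v =
      (case letter_map l v of None \<Rightarrow> 0 | Some v' \<Rightarrow> Rep_ell2 (blinfun_apply b (\<delta> v')) v)" for v
    using l by (simp add: rep_word_basis word_map_single zero_ell2.rep_eq split: option.split)
  then show ?thesis by (simp add: average_def)
qed

lemma Psi_limit: "a \<in> \<A> \<Longrightarrow> sampling V \<Longrightarrow> (\<lambda>n. average n (V n) a) \<longlonglongrightarrow> \<Psi> a"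
  using averages_to_Psi by (auto simp: averages_to_def)

text \<open>
  The average of \<open>l b\<close> over a sample is exactly the average of \<open>b l\<close> over its image under \<open>k\<^sup>-\<^sup>1\<close>, which
  is again a sample.
\<close>

lemma Psi_group_letter:
  assumes l: "l \<in> gens" and k: "k \<in> carrier G"
    and map: "\<And>v. v \<in> \<O> \<Longrightarrow> letter_map l v = Some (\<phi> k v)"
      "\<And>v. v \<in> \<O> \<Longrightarrow> letter_map (letter_adj l) v = Some (\<phi> (inv\<^bsub>G\<^esub> k) v)"
    and b: "b \<in> \<A>"
  shows "\<Psi> (b o\<^sub>L \<W> [l]) = \<Psi> (\<W> [l] o\<^sub>L b)"
proof -
  define V where "V n = \<phi> (inv\<^bsub>G\<^esub> k) ` sample n" for n
  have sO: "sample n \<subseteq> \<O>" for n using sampling_sample by (simp add: sampling_def)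
  have V: "sampling V"
    unfolding sampling_def
  proof (intro allI conjI)
    fix n
    show "transversal n (V n)"
      unfolding V_def by (rule transversal_act) (use sampling_sample k in \<open>auto simp: sampling_def\<close>)
    show "V n \<subseteq> \<O>" unfolding V_def using sO k act_in_orbit by blast
  qed
  have "average n (V n) (b o\<^sub>L \<W> [l]) = average n (sample n) (\<W> [l] o\<^sub>L b)" for n
  proof -
    have inj: "inj_on (\<phi> (inv\<^bsub>G\<^esub> k)) (sample n)" using k by (auto simp: inj_on_def act_inject)
    have "(\<Sum>v\<in>V n. case letter_map l v of None \<Rightarrow> 0 | Some v' \<Rightarrow> Rep_ell2 (blinfun_apply b (\<delta> v')) v) =
      (\<Sum>v\<in>sample n. Rep_ell2 (blinfun_apply b (\<delta> v)) (\<phi> (inv\<^bsub>G\<^esub> k) v))"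
      unfolding V_def sum.reindex[OF inj] using sO k act_in_orbit
      by (intro sum.cong refl) (auto simp: map(1) subset_iff)
    also have "\<dots> = (\<Sum>v\<in>sample n. case letter_map (letter_adj l) v of None \<Rightarrow> 0
        | Some v' \<Rightarrow> Rep_ell2 (blinfun_apply b (\<delta> v)) v')"
      using sO by (intro sum.cong refl) (auto simp: map(2) subset_iff)
    finally show ?thesis using l by (simp add: average_letter_left average_letter_right)
  qed
  then have "(\<lambda>n. average n (sample n) (\<W> [l] o\<^sub>L b)) \<longlonglongrightarrow> \<Psi> (b o\<^sub>L \<W> [l])"
    using Psi_limit[OF A_red_compose[OF b rep_word_in_A_red] V, of "[l]"] l by simp
  then show ?thesis
    using Psi_limit[OF A_red_compose[OF rep_word_in_A_red b] sampling_sample, of "[l]"] l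
    by (auto intro: LIMSEQ_unique)
qed

lemma sum_sample_Suc:
  "(\<Sum>v\<in>sample (Suc n). if v 0 = x then f v else 0) = (\<Sum>v\<in>sample n. f ([x] \<frown> v))"
proof -
  have fin: "finite (sample (Suc n))"
    using transversal_card(1) sampling_sample by (auto simp: sampling_def)
  have eq: "{v \<in> sample (Suc n). v 0 = x} = conc [x] ` sample n"
  proof (intro equalityI subsetI)
    fix v assume "v \<in> {v \<in> sample (Suc n). v 0 = x}"
    then obtain u where u: "v = u \<frown> w" "length u = Suc n" "v 0 = x" by (auto simp: sample_def)
    then obtain y u' where "u = y # u'" by (cases u) auto
    with u have "v = [x] \<frown> u' \<frown> w" "length u' = n" by auto
    then show "v \<in> conc [x] ` sample n" unfolding sample_def by blast
  qed (auto simp: sample_def)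
  have inj: "inj_on (conc [x]) (sample n)" by (simp add: inj_on_def)
  have "(\<Sum>v\<in>sample (Suc n). if v 0 = x then f v else 0) = (\<Sum>v | v \<in> sample (Suc n) \<and> v 0 = x. f v)"
    using fin by (simp add: sum.inter_filter)
  then show ?thesis by (simp only: eq sum.reindex[OF inj] comp_def)
qed

text \<open>
  Removing the first letter maps the sample of level \<open>n + 1\<close> in the cylinder of \<open>x\<close> onto the sample
  of level \<open>n\<close>, whose points have \<open>|X|\<close> times the weight.
\<close>

lemma Psi_iso_letter:
  assumes b: "b \<in> \<A>"
  shows "\<Psi> (b o\<^sub>L \<W> [Iso x]) = of_real (real CARD('x)) * \<Psi> (\<W> [Iso x] o\<^sub>L b)"
    and "\<Psi> (\<W> [Iso_adj x] o\<^sub>L b) = of_real (real CARD('x)) * \<Psi> (b o\<^sub>L \<W> [Iso_adj x])"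
proof -
  have sO: "sample n \<subseteq> \<O>" for n using sampling_sample by (simp add: sampling_def)
  have lim: "\<Psi> c = of_real (real CARD('x)) * \<Psi> a"
    if "a \<in> \<A>" "c \<in> \<A>" "\<And>n. average n (sample n) c = of_real (real CARD('x)) * average (Suc n) (sample (Suc n)) a"
    for a c
  proof -
    have "(\<lambda>n. average n (sample n) c) \<longlonglongrightarrow> of_real (real CARD('x)) * \<Psi> a"
      unfolding that(3)
      by (intro tendsto_mult_left LIMSEQ_Suc[of "\<lambda>n. average n (sample n) a"] Psi_limit that(1) sampling_sample)
    then show ?thesis using Psi_limit[OF that(2) sampling_sample] LIMSEQ_unique by blast
  qed
  show "\<Psi> (b o\<^sub>L \<W> [Iso x]) = of_real (real CARD('x)) * \<Psi> (\<W> [Iso x] o\<^sub>L b)"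
  proof (rule lim)
    fix n
    have "(\<Sum>v\<in>sample (Suc n). case letter_map (Iso_adj x) v of None \<Rightarrow> 0
          | Some v' \<Rightarrow> Rep_ell2 (blinfun_apply b (\<delta> v)) v') =
        (\<Sum>v\<in>sample (Suc n). if v 0 = x then Rep_ell2 (blinfun_apply b (\<delta> v)) (suffix (Suc 0) v) else 0)"
      using sO by (intro sum.cong refl) auto
    also have "\<dots> = (\<Sum>v\<in>sample n. Rep_ell2 (blinfun_apply b (\<delta> ([x] \<frown> v))) v)"
      unfolding sum_sample_Suc by simp
    also have "\<dots> = (\<Sum>v\<in>sample n. case letter_map (Iso x) v of None \<Rightarrow> 0
          | Some v' \<Rightarrow> Rep_ell2 (blinfun_apply b (\<delta> v')) v)"
      using sO by (intro sum.cong refl) auto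
    finally show "average n (sample n) (b o\<^sub>L \<W> [Iso x]) =
        of_real (real CARD('x)) * average (Suc n) (sample (Suc n)) (\<W> [Iso x] o\<^sub>L b)"
      by (simp add: average_letter_left average_letter_right del: letter_map.simps)
  qed (simp_all add: A_red_compose rep_word_in_A_red b)
  show "\<Psi> (\<W> [Iso_adj x] o\<^sub>L b) = of_real (real CARD('x)) * \<Psi> (b o\<^sub>L \<W> [Iso_adj x])"
  proof (rule lim)
    fix n
    have "(\<Sum>v\<in>sample (Suc n). case letter_map (Iso_adj x) v of None \<Rightarrow> 0
          | Some v' \<Rightarrow> Rep_ell2 (blinfun_apply b (\<delta> v')) v) =
        (\<Sum>v\<in>sample (Suc n). if v 0 = x then Rep_ell2 (blinfun_apply b (\<delta> (suffix (Suc 0) v))) v else 0)"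
      using sO by (intro sum.cong refl) auto
    also have "\<dots> = (\<Sum>v\<in>sample n. Rep_ell2 (blinfun_apply b (\<delta> v)) ([x] \<frown> v))"
      unfolding sum_sample_Suc by simp
    also have "\<dots> = (\<Sum>v\<in>sample n. case letter_map (Iso x) v of None \<Rightarrow> 0
          | Some v' \<Rightarrow> Rep_ell2 (blinfun_apply b (\<delta> v)) v')"
      using sO by (intro sum.cong refl) auto
    finally show "average n (sample n) (\<W> [Iso_adj x] o\<^sub>L b) =
        of_real (real CARD('x)) * average (Suc n) (sample (Suc n)) (b o\<^sub>L \<W> [Iso_adj x])"
      by (simp add: average_letter_left average_letter_right del: letter_map.simps)
  qed (simp_all add: A_red_compose rep_word_in_A_red b)
qed

lemma Psi_letter:
  assumes l: "l \<in> gens" and b: "b \<in> \<A>"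
  shows "\<Psi> (b o\<^sub>L \<W> [l]) =
    of_real (real CARD('x) powi letter_degree l) * \<Psi> (\<W> [l] o\<^sub>L b)"
proof (cases l)
  case (Grp g)
  then show ?thesis using Psi_group_letter[OF l, of g b] l b by simp
next
  case (Grp_adj g)
  then show ?thesis using Psi_group_letter[OF l, of "inv\<^bsub>G\<^esub> g" b] l b by simp
next
  case (Iso x)
  then show ?thesis using Psi_iso_letter(1)[OF b] by simp
next
  case (Iso_adj x)
  then show ?thesis using Psi_iso_letter(2)[OF b, of x] card_gt_1 by (simp add: power_int_minus)
qed

lemma rep_one_unit: "a \<in> \<A> \<Longrightarrow> a o\<^sub>L rep_one G \<phi> w = a" "a \<in> \<A> \<Longrightarrow> rep_one G \<phi> w o\<^sub>L a = a"
proof -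
  assume "a \<in> \<A>"
  then obtain p where p: "\<And>n. p n \<in> \<F>" "(\<lambda>n. \<R> (p n)) \<longlonglongrightarrow> a" using A_redE by blast
  let ?e = "rep_one G \<phi> w"
  have word: "\<W> u o\<^sub>L ?e = \<W> u" "?e o\<^sub>L \<W> u = \<W> u"
    if "u \<in> gen_words" for u
    using rep_word_append[of u "[]"] rep_word_append[of "[]" u] that by (simp_all add: rep_word_Nil)
  have e: "complex_linear ?e" using complex_linear_rep_word[of "[]"] by (simp add: rep_word_Nil)
  have "\<R> (p n) o\<^sub>L ?e = \<R> (p n)" for n
    unfolding rep_poly_def compose_sum_left using p(1)[of n]
    by (intro sum.cong refl) (auto simp: op_scale_compose_left word free_star_algebra_iff subset_iff)
  then show "a o\<^sub>L ?e = a"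
    using tendsto_compose[OF p(2) tendsto_const[of ?e]] p(2) LIMSEQ_unique by simp blast
  have "?e o\<^sub>L \<R> (p n) = \<R> (p n)" for n
    unfolding rep_poly_def compose_sum_right using p(1)[of n]
    by (intro sum.cong refl) (auto simp: op_scale_compose_right[OF e] word free_star_algebra_iff subset_iff)
  then show "?e o\<^sub>L a = a"
    using tendsto_compose[OF tendsto_const[of ?e] p(2)] p(2) LIMSEQ_unique by simp blast
qed

text \<open>
  The letters of the word are moved one by one from the right end of the product to the left.
\<close>

lemma Psi_word:
  "u \<in> gen_words \<Longrightarrow> b \<in> \<A> \<Longrightarrow> \<Psi> (b o\<^sub>L \<W> u) =
    of_real (real CARD('x) powi word_degree u) * \<Psi> (\<W> u o\<^sub>L b)"
proof (induction u arbitrary: b)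
  case Nil
  then show ?case by (simp add: rep_word_Nil rep_one_unit)
next
  case (Cons l u)
  then have lu: "l \<in> gens" "u \<in> gen_words" by auto
  let ?L = "\<W> [l]" and ?U = "\<W> u"
  have A: "?L \<in> \<A>" "?U \<in> \<A>" using lu by (auto intro: rep_word_in_A_red)
  have "\<Psi> (b o\<^sub>L \<W> (l # u)) = \<Psi> ((b o\<^sub>L ?L) o\<^sub>L ?U)"
    by (simp add: rep_word_Cons[OF lu] op_compose_assoc)
  also have "\<dots> = of_real (real CARD('x) powi word_degree u) * \<Psi> ((?U o\<^sub>L b) o\<^sub>L ?L)"
    using Cons.IH[OF lu(2) A_red_compose[OF Cons.prems(2) A(1)]] by (simp add: op_compose_assoc)
  also have "\<dots> = of_real (real CARD('x) powi word_degree u) *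
      (of_real (real CARD('x) powi letter_degree l) * \<Psi> (\<W> (l # u) o\<^sub>L b))"
    using Psi_letter[OF lu(1) A_red_compose[OF A(2) Cons.prems(2)]]
    by (simp add: rep_word_Cons[OF lu] op_compose_assoc)
  finally show ?case using card_gt_1 by (simp add: power_int_add)
qed

lemma Psi_gauge:
  assumes a: "a \<in> \<A>"
  shows "\<Psi> (gauge_aut t a) = \<Psi> a"
proof (rule averages_to_orbit_state)
  have "Rep_ell2 (blinfun_apply (gauge_aut t a) (\<delta> v)) v = Rep_ell2 (blinfun_apply a (\<delta> v)) v" for v
    by (simp add: gauge_aut_def phase_conj_def phase_op_basis Rep_phase_op cscale.rep_eq
        complex_linearD[OF complex_linear_A_red[OF a]] mult.assoc[symmetric] cis_mult)
  then show "averages_to (gauge_aut t a) (\<Psi> a)"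
    using averages_to_Psi[OF a] by (simp add: averages_to_def average_def)
qed

text \<open>
  Linear combinations of words are dense in \<open>\<A>\<close>. The domain \<open>B\<close> is \<open>\<A>\<close> when the KMS condition is
  extended from words, and \<open>\<B>\<close> when KMS states are compared.
\<close>

lemma functional_eq_on_words:
  assumes B: "generated_star_algebra G \<phi> w \<subseteq> B" "B \<subseteq> \<A>"
    and lin: "clinear_functional_on B L" "clinear_functional_on B M"
    and closed: "\<And>a b. a \<in> B \<Longrightarrow> b \<in> B \<Longrightarrow> a + b \<in> B" "\<And>c a. a \<in> B \<Longrightarrow> c \<cdot>\<^sub>\<complex> a \<in> B"
    and bound: "\<And>a. a \<in> B \<Longrightarrow> cmod (L a) \<le> K * norm a" "\<And>a. a \<in> B \<Longrightarrow> cmod (M a) \<le> K * norm a"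
    and words: "\<And>u. u \<in> gen_words \<Longrightarrow> L (\<W> u) = M (\<W> u)"
    and a: "a \<in> B"
  shows "L a = M a"
proof -
  have W: "\<W> u \<in> B" if "u \<in> gen_words" for u using rep_word_in_generated that B(1) by blast
  have add: "N (x + y) = N x + N y" and scale: "N (c \<cdot>\<^sub>\<complex> x) = c * N x"
    if "N = L \<or> N = M" "x \<in> B" "y \<in> B" for N x y c
    using that lin by (auto simp: clinear_functional_on_def)
  have zero: "0 \<in> B" using closed(2)[OF W[of "[]"], of 0] by simp
  have sum: "(\<Sum>u\<in>U. p u \<cdot>\<^sub>\<complex> \<W> u) \<in> B \<and>
      L (\<Sum>u\<in>U. p u \<cdot>\<^sub>\<complex> \<W> u) = M (\<Sum>u\<in>U. p u \<cdot>\<^sub>\<complex> \<W> u)"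
    if "finite U" "U \<subseteq> gen_words" for p U
    using that
  proof (induction U)
    case empty
    show ?case using zero scale[of L 0 0 0] scale[of M 0 0 0] by simp
  next
    case (insert u U)
    then show ?case using W[of u] by (simp add: closed add scale words)
  qed
  obtain p where p: "\<And>n. p n \<in> \<F>" "(\<lambda>n. \<R> (p n)) \<longlonglongrightarrow> a"
    using a B(2) A_redE by blast
  let ?b = "\<lambda>n. \<R> (p n)"
  have b: "?b n \<in> B" "L (?b n) = M (?b n)" for n
    using sum[of "{u. p n u \<noteq> 0}" "p n"] p(1)[of n] by (auto simp: free_star_algebra_iff rep_poly_def)
  have minus: "a - ?b n = a + (-1) \<cdot>\<^sub>\<complex> ?b n" for n by (simp add: op_scale_minus_one)
  have diff_in: "a - ?b n \<in> B" for n unfolding minus by (intro closed a b)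
  have diff: "N (a - ?b n) = N a - N (?b n)" if "N = L \<or> N = M" for N n
    unfolding minus using add[OF that a closed(2)[OF b(1)]] scale[OF that b(1) b(1)] by simp
  have le: "cmod (L a - M a) \<le> 2 * K * norm (a - ?b n)" for n
  proof -
    have "L a - M a = L (a - ?b n) - M (a - ?b n)" using b(2)[of n] by (simp add: diff)
    also have "cmod \<dots> \<le> cmod (L (a - ?b n)) + cmod (M (a - ?b n))" by (rule norm_triangle_ineq4)
    also have "\<dots> \<le> K * norm (a - ?b n) + K * norm (a - ?b n)"
      by (intro add_mono bound diff_in)
    finally show ?thesis by simp
  qed
  have "(\<lambda>n. 2 * K * norm (a - ?b n)) \<longlonglongrightarrow> 2 * K * norm (a - a)"
    by (intro tendsto_intros p(2))
  then have "cmod (L a - M a) \<le> 2 * K * norm (a - a)"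
    by (rule LIMSEQ_le_const) (use le in blast)
  then show ?thesis by simp
qed

text \<open>
  The derivative \<open>D\<close> is a limit of difference quotients, so it lies in \<open>\<A>\<close>, where \<open>\<Psi>\<close> is continuous.
\<close>

lemma Psi_compose_holomorphic:
  assumes F: "\<And>z. F z \<in> \<A>" "\<And>z. \<exists>D. (F has_derivative (\<lambda>h. h \<cdot>\<^sub>\<complex> D)) (at z)" and a: "a \<in> \<A>"
  shows "(\<lambda>z. \<Psi> (a o\<^sub>L F z)) holomorphic_on UNIV"
proof -
  have "\<exists>d. ((\<lambda>z. \<Psi> (a o\<^sub>L F z)) has_field_derivative d) (at z)" for z
  proof -
    obtain D where D: "(F has_derivative (\<lambda>h. h \<cdot>\<^sub>\<complex> D)) (at z)" using F(2) by blast
    define Q where "Q h = inverse h \<cdot>\<^sub>\<complex> (F (z + h) - F z)" for h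
    have Q: "(Q \<longlongrightarrow> D) (at 0)" unfolding Q_def by (rule entire_difference_quotient[OF D])
    have QA: "Q h \<in> \<A>" for h unfolding Q_def by (intro A_red_scale A_red_diff F(1))
    have DA: "D \<in> \<A>"
      by (rule Lim_in_closed_set[OF closed_A_red _ _ Q]) (simp_all add: QA)
    have "((\<lambda>h. \<Psi> (a o\<^sub>L Q h)) \<longlongrightarrow> \<Psi> (a o\<^sub>L D)) (at 0)"
      by (intro tendsto_Psi tendsto_compose tendsto_const Q A_red_compose a DA always_eventually allI QA)
    moreover have "\<Psi> (a o\<^sub>L Q h) = (\<Psi> (a o\<^sub>L F (z + h)) - \<Psi> (a o\<^sub>L F z)) / h" for h
    proof -
      have "a o\<^sub>L Q h = inverse h \<cdot>\<^sub>\<complex> ((a o\<^sub>L F (z + h)) - (a o\<^sub>L F z))"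
        by (simp add: Q_def op_scale_compose_right complex_linear_A_red[OF a] compose_diff_right)
      then show ?thesis
        by (simp add: Psi_scale Psi_diff A_red_diff A_red_compose a F(1) divide_inverse mult.commute)
    qed
    ultimately have "((\<lambda>z. \<Psi> (a o\<^sub>L F z)) has_field_derivative \<Psi> (a o\<^sub>L D)) (at z)"
      by (simp add: DERIV_def)
    then show ?thesis by blast
  qed
  then show ?thesis by (auto simp: holomorphic_on_def field_differentiable_def)
qed

lemma card_powi_exp_real: "real CARD('x) powi k = exp (ln (real CARD('x)) * of_int k)"
  using card_gt_1 by (simp add: powr_real_of_int'[symmetric] powr_def mult.commute)

lemma card_powi_eq_exp: "of_real (real CARD('x) powi k) = exp (of_real (ln (real CARD('x))) * of_int k :: complex)"
  by (simp add: card_powi_exp_real exp_of_real[symmetric])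

text \<open>
  On the real line \<open>\<Psi>(W F(t))\<close> is \<open>e\<^sup>-\<^sup>i\<^sup>m\<^sup>t \<Psi>(W b)\<close> by gauge invariance, where \<open>m\<close> is the degree of the
  word \<open>W\<close>; by the identity theorem this holds for complex \<open>t\<close> as well.
\<close>

lemma Psi_entire_word:
  assumes F: "\<And>z. F z \<in> \<A>" "\<And>z. \<exists>D. (F has_derivative (\<lambda>h. h \<cdot>\<^sub>\<complex> D)) (at z)"
    and Ft: "\<And>t. F (of_real t) = gauge_aut t b" and b: "b \<in> \<A>" and u: "u \<in> gen_words"
  shows "\<Psi> (\<W> u o\<^sub>L F (\<i> * of_real (ln (real CARD('x))))) = \<Psi> (b o\<^sub>L \<W> u)"
proof -
  let ?W = "\<W> u" and ?m = "of_int (word_degree u) :: complex"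
  have W: "?W \<in> \<A>" by (rule rep_word_in_A_red[OF u])
  define f where "f z = \<Psi> (?W o\<^sub>L F z) - exp (- \<i> * ?m * z) * \<Psi> (?W o\<^sub>L b)" for z
  have hol: "f holomorphic_on UNIV"
    unfolding f_def by (intro holomorphic_intros Psi_compose_holomorphic F W)
  have real: "f z = 0" if z_real: "z \<in> \<real>" for z
  proof -
    obtain t where z: "z = of_real t" by (rule Reals_cases[OF z_real])
    have "\<Psi> (?W o\<^sub>L b) = \<Psi> (gauge_aut t (?W o\<^sub>L b))" by (simp add: Psi_gauge A_red_compose W b)
    also have "gauge_aut t (?W o\<^sub>L b) = cis (t * of_int (word_degree u)) \<cdot>\<^sub>\<complex> (?W o\<^sub>L F z)"
      by (simp add: gauge_compose gauge_rep_word[OF u] op_scale_compose_left Ft z)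
    also have "\<Psi> \<dots> = cis (t * of_int (word_degree u)) * \<Psi> (?W o\<^sub>L F z)"
      by (intro Psi_scale A_red_compose W F(1))
    finally have eq: "\<Psi> (?W o\<^sub>L b) = cis (t * of_int (word_degree u)) * \<Psi> (?W o\<^sub>L F z)" .
    have "exp (- \<i> * ?m * z) * cis (t * of_int (word_degree u)) = 1"
      by (simp add: cis_conv_exp z exp_add[symmetric] algebra_simps)
    then show ?thesis by (simp add: f_def eq mult.assoc[symmetric])
  qed
  have "f (\<i> * of_real (ln (real CARD('x)))) = 0"
    by (rule analytic_continuation[OF hol open_UNIV connected_UNIV subset_UNIV UNIV_I
        complex_zero_islimpt_Reals real]) auto
  then have "\<Psi> (?W o\<^sub>L F (\<i> * of_real (ln (real CARD('x))))) =
      exp (of_real (ln (real CARD('x))) * ?m) * \<Psi> (?W o\<^sub>L b)"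
    by (simp add: f_def algebra_simps)
  then show ?thesis unfolding Psi_word[OF u b] card_powi_eq_exp .
qed

text \<open>
  Both sides are bounded linear functionals of \<open>a\<close>, so words suffice.
\<close>

lemma Psi_entire:
  assumes F: "\<And>z. F z \<in> \<A>" "\<And>z. \<exists>D. (F has_derivative (\<lambda>h. h \<cdot>\<^sub>\<complex> D)) (at z)"
    and Ft: "\<And>t. F (of_real t) = gauge_aut t b" and b: "b \<in> \<A>" and a: "a \<in> \<A>"
  shows "\<Psi> (a o\<^sub>L F (\<i> * of_real (ln (real CARD('x))))) = \<Psi> (b o\<^sub>L a)"
proof -
  define c where "c = F (\<i> * of_real (ln (real CARD('x))))"
  have c: "c \<in> \<A>" unfolding c_def by (rule F(1))
  show ?thesis unfolding c_def[symmetric]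
  proof (rule functional_eq_on_words[of \<A> "\<lambda>a. \<Psi> (a o\<^sub>L c)" "\<lambda>a. \<Psi> (b o\<^sub>L a)" "norm c + norm b"])
    show "clinear_functional_on \<A> (\<lambda>a. \<Psi> (a o\<^sub>L c))"
      by (simp add: clinear_functional_on_def compose_add_left op_scale_compose_left Psi_add Psi_scale A_red_compose c)
    show "clinear_functional_on \<A> (\<lambda>a. \<Psi> (b o\<^sub>L a))"
      by (simp add: clinear_functional_on_def compose_add_right op_scale_compose_right complex_linear_A_red b
          Psi_add Psi_scale A_red_compose)
    fix a assume a: "a \<in> \<A>"
    have "cmod (\<Psi> (a o\<^sub>L c)) \<le> norm c * norm a"
      using norm_Psi_le[OF A_red_compose[OF a c]] norm_compose_le[of a c] by linarith
    then show "cmod (\<Psi> (a o\<^sub>L c)) \<le> (norm c + norm b) * norm a" by (simp add: distrib_right add_increasing2)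
    have "cmod (\<Psi> (b o\<^sub>L a)) \<le> norm b * norm a"
      using norm_Psi_le[OF A_red_compose[OF b a]] norm_blinfun_compose[of b a] by linarith
    then show "cmod (\<Psi> (b o\<^sub>L a)) \<le> (norm c + norm b) * norm a" by (simp add: distrib_right add_increasing)
  next
    fix u assume "u \<in> gen_words"
    then show "\<Psi> (\<W> u o\<^sub>L c) = \<Psi> (b o\<^sub>L \<W> u)"
      unfolding c_def by (rule Psi_entire_word[OF F Ft b])
  qed (simp_all add: generated_subset_A_red A_red_add A_red_scale a)
qed

lemma rep_one_in_O_min: "rep_one G \<phi> w \<in> \<B>"
  using rep_word_in_O_min[of "[]"] by (simp add: rep_word_Nil)

lemma Psi_KMS:
  "restrict \<Psi> (\<B>) \<in> KMS_states (\<B>) (rep_one G \<phi> w) (gauge_action G \<phi> w) (ln (real CARD('x)))"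
proof -
  note A = subsetD[OF O_min_subset_A_red]
  have "state_on (\<B>) (rep_one G \<phi> w) (restrict \<Psi> (\<B>))"
    by (simp add: state_on_def clinear_functional_on_def O_min_add O_min_scale O_min_compose O_min_adj
        Psi_add Psi_scale Psi_nonneg norm_Psi_le Psi_one rep_one_in_O_min A)
  moreover have "restrict \<Psi> (\<B>) (a o\<^sub>L F (\<i> * of_real (ln (real CARD('x))))) =
      restrict \<Psi> (\<B>) (b o\<^sub>L a)"
    if "a \<in> analytic_elements (\<B>) (gauge_action G \<phi> w)"
      "b \<in> analytic_elements (\<B>) (gauge_action G \<phi> w)"
      "entire_extension (\<B>) (gauge_action G \<phi> w) b F" for a b F
  proof -
    have ab: "a \<in> \<B>" "b \<in> \<B>" using that by (auto simp: analytic_elements_def)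
    have F: "\<And>z. F z \<in> \<B>" "\<And>z. \<exists>D. (F has_derivative (\<lambda>h. h \<cdot>\<^sub>\<complex> D)) (at z)"
      "\<And>t. F (of_real t) = gauge_aut t b"
      using that(3) gauge_action_eq[OF ab(2)] by (auto simp: entire_extension_def)
    have "\<Psi> (a o\<^sub>L F (\<i> * of_real (ln (real CARD('x))))) = \<Psi> (b o\<^sub>L a)"
      by (rule Psi_entire) (use F ab A in auto)
    then show ?thesis using F(1) ab by (simp add: O_min_compose)
  qed
  ultimately show ?thesis unfolding KMS_states_def by blast
qed

section \<open>Uniqueness of the KMS state\<close>

lemma entire_extension_rep_word:
  assumes u: "u \<in> gen_words"
  shows "entire_extension (\<B>) (gauge_action G \<phi> w) (\<W> u)
    (\<lambda>z. exp (\<i> * z * of_int (word_degree u)) \<cdot>\<^sub>\<complex> \<W> u)"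
  unfolding entire_extension_def
proof (intro conjI allI)
  let ?m = "of_int (word_degree u) :: complex" and ?W = "\<W> u"
  fix z
  show "exp (\<i> * z * ?m) \<cdot>\<^sub>\<complex> ?W \<in> \<B>" by (intro O_min_scale rep_word_in_O_min u)
  have "((\<lambda>z. exp (\<i> * z * ?m)) has_field_derivative exp (\<i> * z * ?m) * (\<i> * ?m)) (at z)"
    by (auto intro!: derivative_eq_intros)
  then have "((\<lambda>z. exp (\<i> * z * ?m)) has_derivative (\<lambda>h. exp (\<i> * z * ?m) * (\<i> * ?m) * h)) (at z)"
    by (simp add: has_field_derivative_def)
  from bounded_linear.has_derivative[OF bounded_linear_op_scale_left this, of ?W]
  have "((\<lambda>z. exp (\<i> * z * ?m) \<cdot>\<^sub>\<complex> ?W) has_derivative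
      (\<lambda>h. h \<cdot>\<^sub>\<complex> (exp (\<i> * z * ?m) * (\<i> * ?m)) \<cdot>\<^sub>\<complex> ?W)) (at z)"
    by (simp add: op_scale_op_scale mult.commute)
  then show "\<exists>D. ((\<lambda>z. exp (\<i> * z * ?m) \<cdot>\<^sub>\<complex> ?W) has_derivative (\<lambda>h. h \<cdot>\<^sub>\<complex> D)) (at z)" by blast
next
  fix t
  show "exp (\<i> * of_real t * of_int (word_degree u)) \<cdot>\<^sub>\<complex> \<W> u =
      gauge_action G \<phi> w t (\<W> u)"
    by (simp add: gauge_action_eq rep_word_in_O_min u gauge_rep_word cis_conv_exp mult.assoc)
qed

lemma words_analytic:
  "u \<in> gen_words \<Longrightarrow> \<W> u \<in> analytic_elements (\<B>) (gauge_action G \<phi> w)"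
  using entire_extension_rep_word[of u] rep_word_in_O_min[of u] by (auto simp: analytic_elements_def)

context
  fixes \<rho>
  assumes \<rho>: "\<rho> \<in> KMS_states (\<B>) (rep_one G \<phi> w) (gauge_action G \<phi> w) (ln (real CARD('x)))"
begin

lemma KMS_state: "state_on (\<B>) (rep_one G \<phi> w) \<rho>"
  using \<rho> by (simp add: KMS_states_def)

lemma KMS_add: "a \<in> \<B> \<Longrightarrow> b \<in> \<B> \<Longrightarrow> \<rho> (a + b) = \<rho> a + \<rho> b"
  and KMS_scale: "a \<in> \<B> \<Longrightarrow> \<rho> (c \<cdot>\<^sub>\<complex> a) = c * \<rho> a"
  and KMS_norm: "a \<in> \<B> \<Longrightarrow> cmod (\<rho> a) \<le> norm a"
  and KMS_one: "\<rho> (rep_one G \<phi> w) = 1"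
  using KMS_state by (auto simp: state_on_def clinear_functional_on_def)

lemma KMS_zero: "\<rho> 0 = 0"
  using KMS_scale[OF rep_one_in_O_min, of 0] by simp

text \<open>
  A word of degree \<open>m\<close> has the entire extension \<open>z \<mapsto> e\<^sup>i\<^sup>m\<^sup>z\<close> times the word, and
  \<open>z = i log |X|\<close> gives the factor \<open>|X|\<^sup>-\<^sup>m\<close>.
\<close>

lemma KMS_words:
  assumes u: "u \<in> gen_words" and v: "v \<in> gen_words"
  shows "\<rho> (\<W> (u @ v)) = of_real (real CARD('x) powi (- word_degree u)) * \<rho> (\<W> (v @ u))"
proof -
  let ?F = "\<lambda>z. exp (\<i> * z * of_int (word_degree u)) \<cdot>\<^sub>\<complex> \<W> u"
  let ?c = "of_real (real CARD('x) powi (- word_degree u)) :: complex"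
  have F: "?F (\<i> * of_real (ln (real CARD('x)))) = ?c \<cdot>\<^sub>\<complex> \<W> u"
  proof -
    have "\<i> * (\<i> * of_real (ln (real CARD('x)))) * of_int (word_degree u) =
        (of_real (ln (real CARD('x))) * of_int (- word_degree u) :: complex)"
      by (simp add: mult.assoc[symmetric])
    then show ?thesis by (simp only: card_powi_eq_exp)
  qed
  have "\<rho> (\<W> v o\<^sub>L ?F (\<i> * of_real (ln (real CARD('x))))) =
      \<rho> (\<W> u o\<^sub>L \<W> v)"
    using \<rho> words_analytic[OF u] words_analytic[OF v] entire_extension_rep_word[OF u]
    unfolding KMS_states_def by blast
  then have "\<rho> (?c \<cdot>\<^sub>\<complex> \<W> (v @ u)) = \<rho> (\<W> (u @ v))"
    unfolding F by (simp add: op_scale_compose_right complex_linear_rep_word u v rep_word_append)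
  then show ?thesis using KMS_scale[OF rep_word_in_O_min] u v by simp
qed

text \<open>
  With \<open>1\<close> as the second element, the KMS condition says that the value at a word of degree \<open>m\<close> does not
  change when it is multiplied by \<open>|X|\<^sup>-\<^sup>m\<close>.
\<close>

lemma KMS_degree_nonzero:
  assumes "u \<in> gen_words" "word_degree u \<noteq> 0"
  shows "\<rho> (\<W> u) = 0"
proof -
  have "real CARD('x) powi (- word_degree u) \<noteq> 1"
    using card_gt_1 assms(2) by (simp add: card_powi_exp_real exp_eq_one_iff)
  then have "(of_real (real CARD('x) powi (- word_degree u)) :: complex) \<noteq> 1" using of_real_eq_1_iff by blast
  then show ?thesis using KMS_words[OF assms(1), of "[]"] by auto
qed

lemma sum_cylinder_projections:
  "(\<Sum>v\<in>sample n. \<W> (map Iso (prefix n v) @ rev (map Iso_adj (prefix n v)))) = rep_one G \<phi> w"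
proof (rule ell2_op_eqI)
  let ?P = "\<lambda>u. \<W> (map Iso u @ rev (map Iso_adj u))"
  have t: "transversal n (sample n)" using sampling_sample by (simp add: sampling_def)
  fix a
  have wm: "word_map (map Iso u @ rev (map Iso_adj u)) a = (if a \<in> \<O> \<and> prefix (length u) a = u then Some a else None)" for u
  proof (cases "word_map (rev (map Iso_adj u)) a")
    case None
    then show ?thesis
      by (subst word_map_append, simp)
        (auto simp: word_map_Iso_adjs map_comp_def T_star_def split: if_splits, metis prefix_conc_suffix rangeI)
  next
    case (Some z)
    then have "a \<in> \<O>" "z \<in> \<O>" "a = u \<frown> z"
      using word_map_orbit[OF _ Some] by (auto simp: word_map_Iso_adjs T_star_Some_iff)
    then show ?thesis using Some by (subst word_map_append, simp) (simp add: map_comp_def word_map_Isos)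
  qed
  have "blinfun_apply (?P (prefix n v)) (\<delta> a) =
      (if prefix n a = prefix n v then blinfun_apply (rep_one G \<phi> w) (\<delta> a) else 0)" for v
    using wm[of "prefix n v"] by (simp add: rep_word_basis rep_word_Nil[symmetric] word_map_Nil)
  then have "blinfun_apply (\<Sum>v\<in>sample n. ?P (prefix n v)) (\<delta> a) =
      (\<Sum>v\<in>sample n. if prefix n a = prefix n v then blinfun_apply (rep_one G \<phi> w) (\<delta> a) else 0)"
    by (simp add: blinfun.sum_left)
  also obtain v0 where v0: "v0 \<in> sample n" "prefix n v0 = prefix n a"
    by (rule transversal_ex[OF t length_prefix[of a n]])
  have "(\<Sum>v\<in>sample n. if prefix n a = prefix n v then blinfun_apply (rep_one G \<phi> w) (\<delta> a) else 0) =
      (\<Sum>v\<in>sample n. if v = v0 then blinfun_apply (rep_one G \<phi> w) (\<delta> a) else 0)"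
    using v0 transversal_inj[OF t] by (intro sum.cong refl if_cong) metis
  also have "\<dots> = blinfun_apply (rep_one G \<phi> w) (\<delta> a)"
    using v0(1) transversal_card(1)[OF t] by simp
  finally show "blinfun_apply (\<Sum>v\<in>sample n. ?P (prefix n v)) (\<delta> a) = blinfun_apply (rep_one G \<phi> w) (\<delta> a)" .
qed (auto intro!: complex_linear_sum complex_linear_rep_word simp: rep_word_Nil[symmetric])

lemma KMS_sum: "finite I \<Longrightarrow> (\<And>i. i \<in> I \<Longrightarrow> T i \<in> \<B>) \<Longrightarrow>
  (\<Sum>i\<in>I. T i) \<in> \<B> \<and> \<rho> (\<Sum>i\<in>I. T i) = (\<Sum>i\<in>I. \<rho> (T i))"
proof (induction I rule: finite_induct)
  case empty
  then show ?case using O_min_scale[OF rep_one_in_O_min, of 0] KMS_zero by simp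
next
  case (insert i I)
  then show ?case by (simp add: KMS_add O_min_add)
qed

text \<open>
  Here \<open>c v\<close> is the value of the state at \<open>S\<^sub>u\<^sup>* g S\<^sub>u\<close>, where \<open>u\<close> is the prefix of \<open>v\<close>. It is known for
  the cylinders that are fixed pointwise or moved, and bounded by \<open>1\<close> for the others; the right-hand
  side of the estimate is the proportion of the others.
\<close>

lemma KMS_group_element_approx:
  assumes g: "g \<in> carrier G"
  shows "cmod (\<rho> (\<W> [Grp g]) - of_real (measure bernoulli_measure (fixed_nbhd g n))) \<le>
    1 - measure bernoulli_measure (moved g n) - measure bernoulli_measure (fixed_nbhd g n)"
proof -
  let ?S = "sample n" and ?F = "fixed_nbhd g n" and ?M = "moved g n" and ?d = "real CARD('x) ^ n"
  define c where "c v = \<rho> (\<W> (rev (map Iso_adj (prefix n v)) @ [Grp g] @ map Iso (prefix n v)))" for v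
  have t: "transversal n ?S" using sampling_sample by (simp add: sampling_def)
  note fin = transversal_card(1)[OF t]
  have dpos: "?d > 0" by simp
  have wm: "word_map (rev (map Iso_adj (prefix n v)) @ [Grp g] @ map Iso (prefix n v)) a =
      T_star (prefix n v) (\<phi> g (prefix n v \<frown> a))" if "a \<in> \<O>" for v a
    using that g
    by (subst word_map_append, simp)+
      (simp add: map_comp_def word_map_Isos word_map_single conc_in_orbit word_map_Iso_adjs act_in_orbit)
  have cF: "c v = 1" if "v \<in> ?F" for v
  proof -
    have "\<W> (rev (map Iso_adj (prefix n v)) @ [Grp g] @ map Iso (prefix n v)) = \<W> []"
    proof (rule rep_word_eqI)
      fix a assume a: "a \<in> \<O>"
      have "\<phi> g (prefix n v \<frown> a) = prefix n v \<frown> a" using that by (auto simp: fixed_nbhd_def)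
      then show "word_map (rev (map Iso_adj (prefix n v)) @ [Grp g] @ map Iso (prefix n v)) a = word_map [] a"
        unfolding wm[OF a] using a by (simp add: word_map_Nil)
    qed (use g in simp_all)
    then show ?thesis by (simp add: c_def rep_word_Nil KMS_one)
  qed
  have cM: "c v = 0" if "v \<in> ?M" for v
  proof -
    have "word_map (rev (map Iso_adj (prefix n v)) @ [Grp g] @ map Iso (prefix n v)) a = None" for a
    proof (cases "a \<in> \<O>")
      case True
      have "prefix n (\<phi> g (prefix n v \<frown> a)) = prefix n (\<phi> g v)" by (simp add: prefix_act_eq_iff[OF g])
      then have "prefix n (\<phi> g (prefix n v \<frown> a)) \<noteq> prefix n v" using that by (simp add: moved_def)
      then have "\<phi> g (prefix n v \<frown> a) \<noteq> prefix n v \<frown> z" for z by auto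
      then show ?thesis unfolding wm[OF True] by (metis T_star_Some_iff option.exhaust)
    next
      case False
      then show ?thesis
        using word_map_orbit[of "rev (map Iso_adj (prefix n v)) @ [Grp g] @ map Iso (prefix n v)" a] g
        by (metis gen_words_simps gens_simps(1) option.exhaust)
    qed
    then have "word_map (rev (map Iso_adj (prefix n v)) @ [Grp g] @ map Iso (prefix n v)) = Map.empty" by blast
    then show ?thesis using g by (simp add: c_def rep_word_eq pm_op_empty KMS_zero)
  qed
  have c1: "cmod (c v) \<le> 1" for v
  proof -
    have "rev (map Iso_adj (prefix n v)) @ [Grp g] @ map Iso (prefix n v) \<in> gen_words" using g by simp
    from KMS_norm[OF rep_word_in_O_min[OF this]] norm_rep_word_le[OF this] show ?thesis
      unfolding c_def by linarith
  qed
  have "\<W> [Grp g] = rep_one G \<phi> w o\<^sub>L \<W> [Grp g]"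
    by (rule rep_one_unit(2)[symmetric, OF rep_word_in_A_red]) (use g in simp)
  also have "\<dots> = (\<Sum>v\<in>?S. \<W> (map Iso (prefix n v) @ (rev (map Iso_adj (prefix n v)) @ [Grp g])))"
    unfolding sum_cylinder_projections[of n, symmetric] compose_sum_left using g
    by (intro sum.cong refl) (simp add: rep_word_append[symmetric])
  finally have "\<rho> (\<W> [Grp g]) =
      (\<Sum>v\<in>?S. \<rho> (\<W> (map Iso (prefix n v) @ (rev (map Iso_adj (prefix n v)) @ [Grp g]))))"
    using KMS_sum[OF fin, of "\<lambda>v. \<W> (map Iso (prefix n v) @ (rev (map Iso_adj (prefix n v)) @ [Grp g]))"] g
    by (simp add: rep_word_in_O_min)
  also have "\<dots> = (\<Sum>v\<in>?S. c v / of_real ?d)"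
  proof (rule sum.cong[OF refl])
    fix v
    show "\<rho> (\<W> (map Iso (prefix n v) @ (rev (map Iso_adj (prefix n v)) @ [Grp g]))) = c v / of_real ?d"
      using g by (subst KMS_words) (simp_all add: c_def power_int_minus divide_inverse mult.commute)
  qed
  finally have rho_g: "\<rho> (\<W> [Grp g]) = (\<Sum>v\<in>?S. c v) / of_real ?d"
    by (simp add: sum_divide_distrib)
  have disj: "?F \<inter> ?M = {}" by (auto simp: fixed_nbhd_def moved_def)
  let ?R = "?S - ?F - ?M"
  have part: "?S = (?S \<inter> ?F) \<union> (?S \<inter> ?M) \<union> ?R" by blast
  have split: "(\<Sum>v\<in>?S. f v) = (\<Sum>v\<in>?S \<inter> ?F. f v) + (\<Sum>v\<in>?S \<inter> ?M. f v) + (\<Sum>v\<in>?R. f v)"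
    for f :: "_ \<Rightarrow> 'c::comm_monoid_add"
    by (subst part, subst sum.union_disjoint, use fin disj in auto, subst sum.union_disjoint, use fin disj in auto)
  have "(\<Sum>v\<in>?S. c v) = of_nat (card (?S \<inter> ?F)) + (\<Sum>v\<in>?R. c v)"
    unfolding split[of c] by (simp add: cF cM)
  moreover have "cmod (\<Sum>v\<in>?R. c v) \<le> real (card ?R)"
    using sum_norm_bound[of ?R c 1] c1 by simp
  ultimately have "cmod ((\<Sum>v\<in>?S. c v) - of_nat (card (?S \<inter> ?F))) \<le> real (card ?R)" by simp
  also have "real (card ?R) = ?d - real (card (?S \<inter> ?M)) - real (card (?S \<inter> ?F))"
  proof -
    have "card ?S = card (?S \<inter> ?F) + card (?S \<inter> ?M) + card ?R"
      using split[of "\<lambda>_. 1 :: nat"] by simp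
    then have "CARD('x) ^ n = card (?S \<inter> ?F) + card (?S \<inter> ?M) + card ?R"
      by (simp add: transversal_card(2)[OF t])
    from arg_cong[OF this, of real] show ?thesis by simp
  qed
  finally have le: "cmod ((\<Sum>v\<in>?S. c v) - of_nat (card (?S \<inter> ?F))) \<le>
      ?d - real (card (?S \<inter> ?M)) - real (card (?S \<inter> ?F))" .
  have "\<rho> (\<W> [Grp g]) - of_real (measure bernoulli_measure ?F) =
      ((\<Sum>v\<in>?S. c v) - of_nat (card (?S \<inter> ?F))) / of_real ?d"
    unfolding rho_g saturated_measure(2)[OF saturated_fixed_nbhd t] by (simp add: diff_divide_distrib)
  then have "cmod (\<rho> (\<W> [Grp g]) - of_real (measure bernoulli_measure ?F)) =
      cmod ((\<Sum>v\<in>?S. c v) - of_nat (card (?S \<inter> ?F))) / ?d"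
    by (simp add: norm_divide norm_power)
  also have "\<dots> \<le> (?d - real (card (?S \<inter> ?M)) - real (card (?S \<inter> ?F))) / ?d"
    using le dpos by (intro divide_right_mono) auto
  finally show ?thesis
    unfolding saturated_measure(2)[OF saturated_fixed_nbhd t] saturated_measure(2)[OF saturated_moved[OF g] t]
    by (simp add: diff_divide_distrib)
qed

lemma KMS_group_element:
  assumes g: "g \<in> carrier G"
  shows "\<rho> (\<W> [Grp g]) = of_real (measure bernoulli_measure (invariants UNIV \<phi> g))"
proof -
  let ?m = "measure bernoulli_measure (invariants UNIV \<phi> g)"
  have "(\<lambda>n. 1 - measure bernoulli_measure (moved g n) - measure bernoulli_measure (fixed_nbhd g n))
      \<longlonglongrightarrow> 1 - (1 - ?m) - ?m"
    by (intro tendsto_diff tendsto_const moved_limit fixed_nbhd_limit g generic)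
  moreover have "(\<lambda>n. cmod (\<rho> (\<W> [Grp g]) - of_real (measure bernoulli_measure (fixed_nbhd g n))))
      \<longlonglongrightarrow> cmod (\<rho> (\<W> [Grp g]) - of_real ?m)"
    by (intro tendsto_norm tendsto_diff tendsto_const tendsto_of_real fixed_nbhd_limit g generic)
  ultimately have "cmod (\<rho> (\<W> [Grp g]) - of_real ?m) \<le> 1 - (1 - ?m) - ?m"
    using KMS_group_element_approx[OF g] by (intro LIMSEQ_le) auto
  then show ?thesis by simp
qed

lemma KMS_mono_word:
  assumes g: "g \<in> carrier G"
  shows "\<rho> (\<W> (mono_word u\<^sub>1 g u\<^sub>2)) = \<Psi> (\<W> (mono_word u\<^sub>1 g u\<^sub>2))"
proof (cases "length u\<^sub>1 = length u\<^sub>2")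
  case False
  then show ?thesis using g KMS_degree_nonzero[of "mono_word u\<^sub>1 g u\<^sub>2"] by (auto simp: Psi_mono_word)
next
  case True
  let ?v = "[Grp g] @ rev (map Iso_adj u\<^sub>2) @ map Iso u\<^sub>1"
  have v: "?v \<in> gen_words" using g by simp
  have "\<rho> (\<W> (mono_word u\<^sub>1 g u\<^sub>2)) = of_real (1 / real CARD('x) ^ length u\<^sub>1) * \<rho> (\<W> ?v)"
    using KMS_words[of "map Iso u\<^sub>1" "[Grp g] @ rev (map Iso_adj u\<^sub>2)"] g
    by (simp add: mono_word_def power_int_minus divide_inverse)
  also have "\<rho> (\<W> ?v) =
      (if u\<^sub>1 = u\<^sub>2 then of_real (measure bernoulli_measure (invariants UNIV \<phi> g)) else 0)"
  proof -
    have wm: "word_map ?v a = (if u\<^sub>1 = u\<^sub>2 then word_map [Grp g] a else None)" if a: "a \<in> \<O>" for a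
    proof -
      have T: "T_star u\<^sub>2 (u\<^sub>1 \<frown> a) = (if u\<^sub>1 = u\<^sub>2 then Some a else None)"
      proof (cases "T_star u\<^sub>2 (u\<^sub>1 \<frown> a)")
        case (Some z)
        then show ?thesis using conc_eq_conc_iff[OF True, of a z] by (auto simp: T_star_Some_iff)
      qed auto
      have "word_map ?v a = (case T_star u\<^sub>2 (u\<^sub>1 \<frown> a) of None \<Rightarrow> None
          | Some z \<Rightarrow> if z \<in> \<O> then Some (\<phi> g z) else None)"
        using a g by (subst word_map_append, simp)+
          (simp add: map_comp_def word_map_Isos word_map_Iso_adjs conc_in_orbit word_map_single)
      then show ?thesis using g unfolding T by (simp add: word_map_single)
    qed
    show ?thesis
    proof (cases "u\<^sub>1 = u\<^sub>2")
      case True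
      then have "\<W> ?v = \<W> [Grp g]"
      proof (intro rep_word_eqI[OF v])
        fix a assume a: "a \<in> \<O>"
        show "word_map ?v a = word_map [Grp g] a" unfolding wm[OF a] using True by simp
      qed (use g in simp)
      then show ?thesis using KMS_group_element[OF g] True by simp
    next
      case False
      have "word_map ?v = Map.empty"
      proof
        fix a show "word_map ?v a = None"
        proof (cases "a \<in> \<O>")
          case True
          show ?thesis unfolding wm[OF True] using False by simp
        next
          case False
          then show ?thesis using word_map_orbit[OF v, of a] by (meson not_None_eq)
        qed
      qed
      then show ?thesis using False v rep_word_eq[OF v] by (simp add: pm_op_empty KMS_zero)
    qed
  qed
  finally show ?thesis using g by (simp add: Psi_mono_word)
qed

lemma KMS_eq_Psi: "\<rho> = restrict \<Psi> (\<B>)"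
proof (rule extensionalityI[of _ "\<B>"])
  show "\<rho> \<in> extensional (\<B>)" using KMS_state by (simp add: state_on_def)
  fix a assume a: "a \<in> \<B>"
  note A = subsetD[OF O_min_subset_A_red]
  have "\<rho> a = \<Psi> a"
  proof (rule functional_eq_on_words[of "\<B>" \<rho> \<Psi> 1])
    show "clinear_functional_on (\<B>) \<rho>" using KMS_state by (simp add: state_on_def)
    show "clinear_functional_on (\<B>) \<Psi>"
      by (simp add: clinear_functional_on_def Psi_add Psi_scale A)
    fix u assume "u \<in> gen_words"
    then show "\<rho> (\<W> u) = \<Psi> (\<W> u)"
    proof (cases rule: rep_word_normal_form)
      case 1
      have "\<Psi> 0 = 0" using Psi_scale[OF rep_word_in_A_red[of "[]"], of 0] by simp
      then show ?thesis using 1 KMS_zero by simp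
    next
      case (2 u\<^sub>1 g u\<^sub>2)
      then show ?thesis using KMS_mono_word by simp
    qed
  qed (simp_all add: generated_subset_O_min O_min_subset_A_red O_min_add O_min_scale KMS_norm norm_Psi_le A a)
  then show "\<rho> a = restrict \<Psi> (\<B>) a" using a by simp
qed simp

end

end

theorem theorem3p11:
  fixes G :: "('g, 'b) monoid_scheme"
    and \<phi> :: "'g \<Rightarrow> ('x::finite) word \<Rightarrow> 'x word"
    and w :: "'x word"
  assumes "CARD('x) \<ge> 2"
    and "countable (carrier G)"
    and "self_similar_action G \<phi>"
    and "measure bernoulli_measure (generic_points G \<phi>) = 1"
    and "strictly_generic G \<phi> w"
  shows "\<exists>\<psi> \<psi>\<^sub>m\<^sub>i\<^sub>n.
    clinear_functional_on (generated_star_algebra G \<phi> w) \<psi> \<and>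
    (\<forall>u\<^sub>1 u\<^sub>2. \<forall>g\<in>carrier G.
      \<psi> (S_op G \<phi> w u\<^sub>1 o\<^sub>L grp_op G \<phi> w g o\<^sub>L op_adj (S_op G \<phi> w u\<^sub>2)) =
        (if u\<^sub>1 = u\<^sub>2
         then of_real (1 / real CARD('x) ^ length u\<^sub>1 * measure bernoulli_measure (invariants UNIV \<phi> g))
         else 0)) \<and>
    (\<forall>a\<in>generated_star_algebra G \<phi> w. \<psi>\<^sub>m\<^sub>i\<^sub>n a = \<psi> a) \<and>
    KMS_states (O_min G \<phi> w) (rep_one G \<phi> w) (gauge_action G \<phi> w) (ln (real CARD('x))) = {\<psi>\<^sub>m\<^sub>i\<^sub>n}"
proof -
  interpret measured_representation G \<phi> w
    using assms by unfold_locales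
  have "clinear_functional_on (generated_star_algebra G \<phi> w) \<Psi>"
    using Psi_add Psi_scale generated_subset_A_red by (auto simp: clinear_functional_on_def subset_iff)
  moreover have "\<forall>u\<^sub>1 u\<^sub>2. \<forall>g\<in>carrier G.
      \<Psi> (S_op G \<phi> w u\<^sub>1 o\<^sub>L grp_op G \<phi> w g o\<^sub>L op_adj (S_op G \<phi> w u\<^sub>2)) =
        (if u\<^sub>1 = u\<^sub>2
         then of_real (1 / real CARD('x) ^ length u\<^sub>1 * measure bernoulli_measure (invariants UNIV \<phi> g))
         else 0)"
    by (intro allI ballI) (simp only: rep_mono_word Psi_mono_word)
  moreover have "\<forall>a\<in>generated_star_algebra G \<phi> w. restrict \<Psi> (O_min G \<phi> w) a = \<Psi> a"
    using generated_subset_O_min by auto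
  moreover have "KMS_states (O_min G \<phi> w) (rep_one G \<phi> w) (gauge_action G \<phi> w) (ln (real CARD('x))) =
      {restrict \<Psi> (O_min G \<phi> w)}"
    using Psi_KMS KMS_eq_Psi by blast
  ultimately show ?thesis by blast
qed

end
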